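(* Either $\mathcal H_3=\{P\}$, where $P$ is the Petersen graph, or $\mathcal H_3$ is an infinite set. Moreover, if $r\ge 4$, then $\mathcal H_r$ is an infinite set.
   Context: All graphs are finite and may have parallel edges but no loops, and are considered up to isomorphism. For $X\subseteq V(G)$, $\partial_G(X)$ is the set of edges of $G$ with exactly one end in $X$; $\partial_G(v)=\partial_G(\{v\})$. An $r$-regular graph $G$ is an $r$-graph if $|\partial_G(X)|\ge r$ for every $X\subseteq V(G)$ of odd cardinality. An $H$-coloring of $G$ is a mapping $f\colon E(G)\to E(H)$ such that $f(e_1)\ne f(e_2)$ for adjacent edges $e_1,e_2$ of $G$, and for every $v\in V(G)$ there is $u\in V(H)$ with $f(\partial_G(v))=\partial_H(u)$. If such a mapping exists, $H$ is said to color $G$. A set $\mathcal A$ of connected $r$-graphs is $r$-complete if every connected $r$-graph $G$ is colored by some $H\in\mathcal A$. For $r\ge 3$, $\mathcal H_r$ denotes an inclusion-wise minimal $r$-complete set (such a set is unique up to isomorphism of its members). *)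

theory Defs
  imports Main "HOL-Library.FuncSet"
begin

record ('v, 'e) multigraph =
  verts :: "'v set"
  edges :: "'e set"
  ends :: "'e \<Rightarrow> 'v set"

text \<open>Parallel edges are distinct edges with the same set of ends; loops are excluded because
  every edge has exactly two ends. The values of \<open>ends\<close> outside \<open>edges\<close> are irrelevant.\<close>

definition graph :: "('v, 'e) multigraph \<Rightarrow> bool" where
  "graph G \<longleftrightarrow> finite (verts G) \<and> finite (edges G) \<and>
     (\<forall>e\<in>edges G. ends G e \<subseteq> verts G \<and> card (ends G e) = 2)"

definition isomorphic :: "('v, 'e) multigraph \<Rightarrow> ('w, 'f) multigraph \<Rightarrow> bool" where
  "isomorphic G H \<longleftrightarrow>
     (\<exists>\<phi> \<psi>. bij_betw \<phi> (verts G) (verts H) \<and> bij_betw \<psi> (edges G) (edges H) \<and>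
            (\<forall>e\<in>edges G. ends H (\<psi> e) = \<phi> ` ends G e))"

definition connected_graph :: "('v, 'e) multigraph \<Rightarrow> bool" where
  "connected_graph G \<longleftrightarrow> verts G \<noteq> {} \<and>
     (\<forall>u\<in>verts G. \<forall>v\<in>verts G. (u, v) \<in> {(x, y). \<exists>e\<in>edges G. ends G e = {x, y}}\<^sup>*)"

definition boundary :: "('v, 'e) multigraph \<Rightarrow> 'v set \<Rightarrow> 'e set" where
  "boundary G X = {e \<in> edges G. card (ends G e \<inter> X) = 1}"

definition regular_graph :: "nat \<Rightarrow> ('v, 'e) multigraph \<Rightarrow> bool" where
  "regular_graph r G \<longleftrightarrow> (\<forall>v\<in>verts G. card (boundary G {v}) = r)"

definition r_graph :: "nat \<Rightarrow> ('v, 'e) multigraph \<Rightarrow> bool" where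
  "r_graph r G \<longleftrightarrow> graph G \<and> regular_graph r G \<and>
     (\<forall>X. X \<subseteq> verts G \<and> odd (card X) \<longrightarrow> r \<le> card (boundary G X))"

definition adjacent_edges :: "('v, 'e) multigraph \<Rightarrow> 'e \<Rightarrow> 'e \<Rightarrow> bool" where
  "adjacent_edges G e1 e2 \<longleftrightarrow>
     e1 \<in> edges G \<and> e2 \<in> edges G \<and> e1 \<noteq> e2 \<and> ends G e1 \<inter> ends G e2 \<noteq> {}"

definition is_coloring ::
  "('w, 'f) multigraph \<Rightarrow> ('v, 'e) multigraph \<Rightarrow> ('e \<Rightarrow> 'f) \<Rightarrow> bool" where
  "is_coloring H G f \<longleftrightarrow> f \<in> edges G \<rightarrow> edges H \<and>
     (\<forall>e1 e2. adjacent_edges G e1 e2 \<longrightarrow> f e1 \<noteq> f e2) \<and>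
     (\<forall>v\<in>verts G. \<exists>u\<in>verts H. f ` boundary G {v} = boundary H {u})"

definition colors :: "('w, 'f) multigraph \<Rightarrow> ('v, 'e) multigraph \<Rightarrow> bool" where
  "colors H G \<longleftrightarrow> (\<exists>f. is_coloring H G f)"

text \<open>Every finite graph has an isomorphic copy whose vertices and edges are natural numbers, so
  sets of graphs up to isomorphism are represented by sets of such copies.\<close>

definition r_complete :: "nat \<Rightarrow> (nat, nat) multigraph set \<Rightarrow> bool" where
  "r_complete r A \<longleftrightarrow> (\<forall>H\<in>A. connected_graph H \<and> r_graph r H) \<and>
     (\<forall>G :: (nat, nat) multigraph. connected_graph G \<and> r_graph r G \<longrightarrow> (\<exists>H\<in>A. colors H G))"

definition minimal_r_complete :: "nat \<Rightarrow> (nat, nat) multigraph set \<Rightarrow> bool" where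
  "minimal_r_complete r A \<longleftrightarrow> r_complete r A \<and> (\<forall>B. B \<subset> A \<longrightarrow> \<not> r_complete r B)"

text \<open>The Petersen graph as the Kneser graph \<open>K(5, 2)\<close>.\<close>

definition petersen :: "(nat set, nat set set) multigraph" where
  "petersen = \<lparr>
     verts = {X. X \<subseteq> {..<5} \<and> card X = 2},
     edges = {{X, Y} | X Y. X \<subseteq> {..<5} \<and> card X = 2 \<and> Y \<subseteq> {..<5} \<and> card Y = 2 \<and> X \<inter> Y = {}},
     ends = (\<lambda>e. e)\<rparr>"

lemma isomorphic_boundary:
  assumes "graph G" and phi: "bij_betw \<phi> (verts G) (verts H)"
    and psi: "bij_betw \<psi> (edges G) (edges H)"
    and e: "\<forall>e\<in>edges G. ends H (\<psi> e) = \<phi> ` ends G e" and v: "v \<in> verts G"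
  shows "\<psi> ` boundary G {v} = boundary H {\<phi> v}"
proof -
  have eq: "card (ends H (\<psi> x) \<inter> {\<phi> v}) = card (ends G x \<inter> {v})" if x: "x \<in> edges G" for x
  proof -
    have "ends G x \<subseteq> verts G" using assms(1) x by (simp add: graph_def)
    then have "\<phi> v \<in> \<phi> ` ends G x \<longleftrightarrow> v \<in> ends G x"
      using phi v inj_on_image_mem_iff[of \<phi> "verts G" v "ends G x"] by (auto simp: bij_betw_def)
    then show ?thesis using e x by (cases "v \<in> ends G x") auto
  qed
  have im: "edges H = \<psi> ` edges G" using psi by (auto simp: bij_betw_def)
  show ?thesis unfolding boundary_def im using eq by auto
qed

lemma isomorphic_colors:
  assumes "isomorphic H K" "graph H" "colors H G"
  shows "colors K G"
proof -
  obtain \<phi> \<psi> where iso: "bij_betw \<phi> (verts H) (verts K)" "bij_betw \<psi> (edges H) (edges K)"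
    "\<forall>e\<in>edges H. ends K (\<psi> e) = \<phi> ` ends H e"
    using assms(1) by (auto simp: isomorphic_def)
  obtain f where f: "is_coloring H G f" using assms(3) by (auto simp: colors_def)
  have fE: "f \<in> edges G \<rightarrow> edges H" using f by (simp add: is_coloring_def)
  have "\<psi> \<circ> f \<in> edges G \<rightarrow> edges K"
    using fE bij_betwE[OF iso(2)] by auto
  moreover have "(\<psi> \<circ> f) e1 \<noteq> (\<psi> \<circ> f) e2" if a: "adjacent_edges G e1 e2" for e1 e2
  proof -
    have "f e1 \<noteq> f e2" using f a by (auto simp: is_coloring_def)
    moreover have "f e1 \<in> edges H" "f e2 \<in> edges H"
      using fE a by (auto simp: adjacent_edges_def)
    ultimately show ?thesis using iso(2) by (auto simp: bij_betw_def inj_on_def)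
  qed
  moreover have "\<exists>w\<in>verts K. (\<psi> \<circ> f) ` boundary G {v} = boundary K {w}"
    if v: "v \<in> verts G" for v
  proof -
    obtain u where u: "u \<in> verts H" "f ` boundary G {v} = boundary H {u}"
      using f v by (auto simp: is_coloring_def)
    then have "(\<psi> \<circ> f) ` boundary G {v} = boundary K {\<phi> u}"
      using isomorphic_boundary[OF assms(2) iso u(1)] by (simp only: image_comp[symmetric])
    moreover have "\<phi> u \<in> verts K" using iso(1) u(1) by (auto simp: bij_betw_def)
    ultimately show ?thesis by blast
  qed
  ultimately have "is_coloring K G (\<psi> \<circ> f)" by (simp add: is_coloring_def)
  then show ?thesis by (auto simp: colors_def)
qed

text \<open>A minimal complete set contains at most one representative of each isomorphism class, so its
  cardinality is the number of isomorphism classes it represents.\<close>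

lemma minimal_r_complete_isomorphic_eq:
  assumes A: "minimal_r_complete r A" and H: "H \<in> A" and K: "K \<in> A" and iso: "isomorphic H K"
  shows "H = K"
proof (rule ccontr)
  assume ne: "H \<noteq> K"
  have c: "r_complete r A" using A by (simp add: minimal_r_complete_def)
  then have g: "graph H" using H by (auto simp: r_complete_def r_graph_def)
  have "\<exists>L\<in>A - {H}. colors L G" if G: "connected_graph G" "r_graph r G" for G :: "(nat, nat) multigraph"
  proof -
    obtain L where L: "L \<in> A" "colors L G" using c G by (auto simp: r_complete_def)
    show ?thesis
      using L K ne isomorphic_colors[OF iso g, of G] by (cases "L = H") auto
  qed
  then have "r_complete r (A - {H})" using c by (auto simp: r_complete_def)
  moreover have "A - {H} \<subset> A" using H by auto
  ultimately show False using A by (auto simp: minimal_r_complete_def)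
qed

end

theory Submission
  imports Defs
begin

text \<open>Let \<open>m = r - 2\<close> and let \<open>Q\<close> be the Petersen graph in which the edges of one perfect matching are
  replaced by \<open>m\<close> parallel edges. Every edge of an \<open>r\<close>-graph \<open>K\<close> lies in a perfect matching (by Tutte's
  theorem), and colourings pull perfect matchings back. As the Petersen graph has only six perfect
  matchings, every colouring of \<open>Q\<close> by \<open>K\<close> is injective on the vertices, even when one simple edge of
  \<open>Q\<close> is cut open and its halves are attached to the rest of a larger graph. Hence such a colouring
  either embeds the opened copy of \<open>Q\<close> into \<open>K\<close> as one side of a 2-edge cut, or gives both halves the same
  colour; in the latter case \<open>K\<close> is isomorphic to \<open>Q\<close>.

  Now replace every edge of an \<open>r\<close>-graph \<open>G\<close> by an opened copy of \<open>Q\<close>, and let \<open>K\<close> colour the result. If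
  \<open>K\<close> is isomorphic to \<open>Q\<close>, then \<open>r = 3\<close> and \<open>K\<close> colours \<open>G\<close>; for \<open>r \<ge> 4\<close> this is impossible, since the cut
  edges have no parallels while some edges at every vertex of \<open>Q\<close> do. Otherwise contracting the images
  of all copies yields a graph with fewer vertices than \<open>K\<close> that colours \<open>G\<close>. So unless \<open>r = 3\<close> and the
  Petersen graph colours everything, the number of vertices needed to colour an \<open>r\<close>-graph is
  unbounded.\<close>

section \<open>Maximum matchings\<close>

text \<open>Each of the 15 edges of the Petersen graph lies in exactly two of its six perfect
  matchings, and any two of these share exactly one edge; so edges correspond to pairs of matchings.
  The perfect matchings of \<open>K\<close>, pulled back, cover all edges of the gadget. Hence at
  most one of the six patterns is missing, and the remaining ones still tell any two edges apart.
  The obstacle for \<open>m \<ge> 2\<close> is that a pattern records only that some copy of a spoke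
  is used, not which one. A colour shared by a cycle edge and a spoke then gives one inclusion of
  patterns instead of equality, and injectivity needs an extra argument. Opening an edge does no
  harm because of parity: a gadget has ten vertices, so a perfect matching contains both edges
  leaving it or neither. The opened edge is a cycle edge because these stay simple for every
  \<open>m\<close>. Contracting the images requires that they are equal or disjoint. They cannot
  cross, since the fat Petersen graph has no cut of fewer than three edges while each image is
  bounded by only two.\<close>

definition matching :: "'a set set \<Rightarrow> 'a set set \<Rightarrow> bool" where
  "matching E M \<longleftrightarrow> M \<subseteq> E \<and> (\<forall>A\<in>M. \<forall>B\<in>M. A \<noteq> B \<longrightarrow> A \<inter> B = {})"

definition max_matching :: "'a set set \<Rightarrow> 'a set set \<Rightarrow> bool" where
  "max_matching E M \<longleftrightarrow> matching E M \<and> (\<forall>N. matching E N \<longrightarrow> card N \<le> card M)"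

lemma bounded_nat_has_greatest:
  fixes f :: "'a \<Rightarrow> nat"
  assumes "P x" "\<And>y. P y \<Longrightarrow> f y \<le> b"
  shows "\<exists>x. P x \<and> (\<forall>y. P y \<longrightarrow> f y \<le> f x)"
  using ex_has_greatest_nat[of P x f "Suc b"] assms by (auto simp: less_Suc_eq_le)

lemma card_2_other:
  assumes "card A = 2" "x \<in> A"
  shows "\<exists>y. A = {x, y} \<and> x \<noteq> y"
  using assms by (auto simp: card_2_iff)

lemma max_matching_exists:
  assumes "finite E"
  shows "\<exists>M. max_matching E M"
proof -
  have "matching E {}" by (simp add: matching_def)
  moreover have "card N \<le> card E" if "matching E N" for N
    using that assms by (auto simp: matching_def intro: card_mono)
  ultimately show ?thesis
    using bounded_nat_has_greatest[of "matching E" "{}" card "card E"]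
    unfolding max_matching_def by blast
qed

lemma card_Union_matching:
  assumes "finite M" "\<forall>A\<in>M. card A = 2" "\<forall>A\<in>M. \<forall>B\<in>M. A \<noteq> B \<longrightarrow> A \<inter> B = {}"
  shows "card (\<Union>M) = 2 * card M"
proof -
  have "card (\<Union>M) = (\<Sum>A\<in>M. card A)"
    using assms by (intro card_Union_disjoint) (auto simp: pairwise_def disjnt_def intro: card_ge_0_finite)
  then show ?thesis using assms(2) by simp
qed

lemma max_matching_same_card: "max_matching E M \<Longrightarrow> max_matching E N \<Longrightarrow> card M = card N"
  unfolding max_matching_def by (meson le_antisym)

lemma max_matchingI_card:
  "max_matching E M \<Longrightarrow> matching E N \<Longrightarrow> card N = card M \<Longrightarrow> max_matching E N"
  unfolding max_matching_def by simp

lemma max_matching_no_add: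
  assumes "finite E" "max_matching E M" "A \<in> E" "A \<inter> \<Union>M = {}" "A \<noteq> {}"
  shows False
proof -
  have "matching E (insert A M)"
    using assms unfolding max_matching_def matching_def by blast
  moreover have "A \<notin> M" using assms(4,5) by blast
  moreover have "finite M" using assms(1,2) by (auto simp: max_matching_def matching_def intro: finite_subset)
  ultimately show False using assms(2) unfolding max_matching_def by fastforce
qed

text \<open>Gallai's argument: among the maximum matchings missing \<open>t\<close>, one that shares the most edges with
  \<open>M\<close> could be switched along a single edge of \<open>M\<close> to share one more.\<close>

lemma gallai:
  assumes fE: "finite E" and E2: "\<forall>A\<in>E. card A = 2"
    and M: "max_matching E M" "u \<notin> \<Union>M" "v \<notin> \<Union>M" "u \<noteq> v"
    and ut: "\<And>N. max_matching E N \<Longrightarrow> u \<notin> \<Union>N \<Longrightarrow> t \<in> \<Union>N"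
    and vt: "\<And>N. max_matching E N \<Longrightarrow> v \<notin> \<Union>N \<Longrightarrow> t \<in> \<Union>N"
    and t: "\<exists>N. max_matching E N \<and> t \<notin> \<Union>N"
  shows False
proof -
  have "card (N \<inter> M) \<le> card E" if "max_matching E N" for N
    using that fE by (intro card_mono) (auto simp: max_matching_def matching_def)
  moreover obtain N0 where "max_matching E N0 \<and> t \<notin> \<Union>N0" using t by blast
  ultimately obtain N where N: "max_matching E N" "t \<notin> \<Union>N"
    and Nmax: "\<And>N'. max_matching E N' \<and> t \<notin> \<Union>N' \<Longrightarrow> card (N' \<inter> M) \<le> card (N \<inter> M)"
    using bounded_nat_has_greatest[of "\<lambda>N. max_matching E N \<and> t \<notin> \<Union>N" N0 "\<lambda>N. card (N \<inter> M)" "card E"]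
    by blast
  have ME: "M \<subseteq> E" and Md: "\<And>A B. A \<in> M \<Longrightarrow> B \<in> M \<Longrightarrow> A \<noteq> B \<Longrightarrow> A \<inter> B = {}"
    using M(1) by (auto simp: max_matching_def matching_def)
  have NE: "N \<subseteq> E" and Nd: "\<And>A B. A \<in> N \<Longrightarrow> B \<in> N \<Longrightarrow> A \<noteq> B \<Longrightarrow> A \<inter> B = {}"
    using N(1) by (auto simp: max_matching_def matching_def)
  have fM: "finite M" and fN: "finite N" using ME NE fE finite_subset by auto
  have fin: "finite A" if "A \<in> E" for A using E2 that by (metis card.infinite zero_neq_numeral)
  have fUM: "finite (\<Union>M)" "finite (\<Union>N)" using fM fN fin ME NE by auto
  have cM: "card (\<Union>M) = 2 * card M" "card (\<Union>N) = 2 * card N"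
    using card_Union_matching[OF fM] card_Union_matching[OF fN] E2 ME NE Md Nd by blast+
  have eq: "card M = card N" using max_matching_same_card M(1) N(1) by blast
  have uN: "u \<in> \<Union>N" using ut[OF N(1)] N(2) by blast
  have vN: "v \<in> \<Union>N" using vt[OF N(1)] N(2) by blast
  \<comment> \<open>Both matchings cover equally many vertices, and \<open>N\<close> covers
    \<open>u\<close> and \<open>v\<close>, which \<open>M\<close> misses. So \<open>M\<close> covers
    at least two vertices missed by \<open>N\<close>, one of them different from
    \<open>t\<close>.\<close>
  have "card (\<Union>N - \<Union>M) = card (\<Union>M - \<Union>N)"
    using card_Diff_subset_Int[of "\<Union>N" "\<Union>M"] card_Diff_subset_Int[of "\<Union>M" "\<Union>N"] cM eq fUM
    by (simp add: Int_commute finite_Int)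
  moreover have "card {u, v} \<le> card (\<Union>N - \<Union>M)"
    using uN vN M fUM by (intro card_mono) auto
  ultimately have "2 \<le> card (\<Union>M - \<Union>N)" using M(4) by simp
  then have "\<not> (\<Union>M - \<Union>N) \<subseteq> {t}" using card_mono[of "{t}" "\<Union>M - \<Union>N"] by auto
  then obtain x where x: "x \<in> \<Union>M" "x \<notin> \<Union>N" "x \<noteq> t" by blast
  then obtain A where A: "A \<in> M" "x \<in> A" by blast
  then obtain y where y: "A = {x, y}" "x \<noteq> y"
    using card_2_other[of A x] E2 ME by blast
  have AE: "A \<in> E" using A ME by blast
  have "y \<in> \<Union>N" using max_matching_no_add[OF fE N(1) AE] x y by blast
  then obtain B where B: "B \<in> N" "y \<in> B" by blast
  have BM: "B \<notin> M" using Md[of A B] A B x y by blast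
  have AN: "A \<notin> N" using x A by blast
  have yt: "y \<noteq> t" using B N(2) by blast
  \<comment> \<open>The exchange keeps the size and still misses \<open>t\<close>; it gains an edge
    of \<open>M\<close> and loses only \<open>B\<close>, which is not in \<open>M\<close>.\<close>
  let ?N = "insert A (N - {B})"
  have "matching E ?N"
    unfolding matching_def
  proof (intro conjI ballI impI)
    show "?N \<subseteq> E" using NE AE by blast
    have *: "A \<inter> D = {}" if "D \<in> N - {B}" for D using that Nd[of B D] B x y by blast
    fix C D assume "C \<in> ?N" "D \<in> ?N" "C \<noteq> D"
    then show "C \<inter> D = {}" using * Nd by blast
  qed
  moreover have "card ?N = Suc (card (N - {B}))" "card N = Suc (card (N - {B}))"
    using AN fN card.remove[OF fN B(1)] by (simp_all add: card_insert_disjoint)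
  then have "card ?N = card M" using eq by simp
  ultimately have "max_matching E ?N" using max_matchingI_card M(1) by blast
  moreover have "t \<notin> \<Union>?N" using N(2) x y yt by blast
  ultimately have "card (?N \<inter> M) \<le> card (N \<inter> M)" using Nmax by blast
  moreover have "?N \<inter> M = insert A (N \<inter> M)" using A BM by blast
  ultimately show False using AN fN by simp
qed

text \<open>This is the hard inequality of the Tutte-Berge formula. The members of \<open>C\<close>
  are odd unions of components of the graph without \<open>S\<close>; they need not be connected, as
  the later count uses only parity and the absence of edges between them. The induction deletes a
  vertex covered by every maximum matching and puts it into \<open>S\<close>; once no such vertex
  exists, \<open>S = {}\<close> works.\<close>

lemma tutte_berge:
  assumes "finite V" "\<forall>A\<in>E. A \<subseteq> V \<and> card A = 2" "max_matching E M"
  shows "\<exists>S C. S \<subseteq> V \<and> (\<forall>X\<in>C. X \<subseteq> V - S \<and> odd (card X)) \<and>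
           (\<forall>X\<in>C. \<forall>Y\<in>C. X \<noteq> Y \<longrightarrow> X \<inter> Y = {}) \<and>
           (\<forall>X\<in>C. \<forall>A\<in>E. A \<inter> X \<noteq> {} \<longrightarrow> A \<subseteq> X \<union> S) \<and>
           card V + card S \<le> card C + 2 * card M"
  using assms
proof (induction "card V" arbitrary: V E M rule: less_induct)
  case less
  note fV = less.prems(1) and EV = less.prems(2) and M = less.prems(3)
  have fE: "finite E" using EV fV by (meson Sup_le_iff finite_UnionD finite_subset)
  have ME: "M \<subseteq> E" and Md: "\<And>A B. A \<in> M \<Longrightarrow> B \<in> M \<Longrightarrow> A \<noteq> B \<Longrightarrow> A \<inter> B = {}"
    using M(1) by (auto simp: max_matching_def matching_def)
  have fM: "finite M" using fE ME finite_subset by blast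
  show ?case
  proof (cases "\<exists>v\<in>V. \<forall>N. max_matching E N \<longrightarrow> v \<in> \<Union>N")
    case True
    then obtain v where v: "v \<in> V" "\<And>N. max_matching E N \<Longrightarrow> v \<in> \<Union>N" by blast
    let ?E = "{A \<in> E. v \<notin> A}"
    obtain M' where M': "max_matching ?E M'" using max_matching_exists[of ?E] fE by auto
    obtain A where A: "A \<in> M" "v \<in> A" using v(2)[OF M] by blast
    have mM': "matching E M'" "v \<notin> \<Union>M'" using M' by (auto simp: max_matching_def matching_def)
    \<comment> \<open>Deleting \<open>v\<close> lowers the matching number by exactly one: a
      matching of the old size avoiding \<open>v\<close> would be a maximum matching that misses
      \<open>v\<close>, and dropping the edge at \<open>v\<close> costs one edge.\<close>
    have "card M' < card M"
      using mM' v(2)[of M'] M max_matchingI_card[OF M mM'(1)] unfolding max_matching_def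
      by (metis le_neq_implies_less)
    moreover have "matching ?E (M - {A})"
      using Md A ME unfolding matching_def by blast
    then have "card (M - {A}) \<le> card M'" using M' by (simp add: max_matching_def)
    ultimately have cM': "card M = Suc (card M')" using A fM by simp
    have cV: "card V = Suc (card (V - {v}))" using v fV by (metis card_Suc_Diff1)
    have "\<forall>A\<in>?E. A \<subseteq> V - {v} \<and> card A = 2" using EV by blast
    then obtain S C where SC: "S \<subseteq> V - {v}" "\<forall>X\<in>C. X \<subseteq> V - {v} - S \<and> odd (card X)"
      "\<forall>X\<in>C. \<forall>Y\<in>C. X \<noteq> Y \<longrightarrow> X \<inter> Y = {}"
      "\<forall>X\<in>C. \<forall>A\<in>?E. A \<inter> X \<noteq> {} \<longrightarrow> A \<subseteq> X \<union> S"
      "card (V - {v}) + card S \<le> card C + 2 * card M'"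
      using less.hyps[of "V - {v}" ?E M'] cV fV M' by auto
    have c4: "\<forall>X\<in>C. \<forall>A\<in>E. A \<inter> X \<noteq> {} \<longrightarrow> A \<subseteq> X \<union> insert v S"
    proof (intro ballI impI)
      fix X A assume XA: "X \<in> C" "A \<in> E" "A \<inter> X \<noteq> {}"
      show "A \<subseteq> X \<union> insert v S"
      proof (cases "v \<in> A")
        case True
        have "card A = 2" using EV XA by blast
        then obtain w where "A = {v, w}" using True card_2_other[of A v] by blast
        then show ?thesis using XA SC(2) by blast
      next
        case False
        then show ?thesis using SC(4) XA by blast
      qed
    qed
    have "v \<notin> S" "finite S" using SC(1) fV finite_subset by auto
    then have c5: "card V + card (insert v S) \<le> card C + 2 * card M" using SC(5) cM' cV by simp
    show ?thesis
    proof (intro exI conjI)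
      show "insert v S \<subseteq> V" using SC(1) v(1) by blast
      show "\<forall>X\<in>C. X \<subseteq> V - insert v S \<and> odd (card X)" using SC(2) by blast
    qed (use SC(3) c4 c5 in blast)+
  next
    case False
    then have miss: "\<And>v. v \<in> V \<Longrightarrow> \<exists>N. max_matching E N \<and> v \<notin> \<Union>N" by blast
    \<comment> \<open>Related vertices are never missed together. Transitivity is exactly Gallai's
      argument, and the classes serve as the odd sets.\<close>
    define R where "R = {(u, v). u \<in> V \<and> v \<in> V \<and>
      (u = v \<or> (\<forall>N. max_matching E N \<longrightarrow> u \<in> \<Union>N \<or> v \<in> \<Union>N))}"
    have RE: "equiv V R"
    proof (rule equivI)
      show "R \<subseteq> V \<times> V" unfolding R_def by auto
      show "refl_on V R" unfolding R_def refl_on_def by auto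
      show "sym R" unfolding R_def sym_def by blast
      show "trans R"
      proof (rule transI)
        fix u t v assume 1: "(u, t) \<in> R" and 2: "(t, v) \<in> R"
        show "(u, v) \<in> R"
        proof (rule ccontr)
          assume n: "(u, v) \<notin> R"
          then have ne: "u \<noteq> t" "t \<noteq> v" "u \<noteq> v" using 1 2 unfolding R_def by auto
          obtain N where N: "max_matching E N" "u \<notin> \<Union>N" "v \<notin> \<Union>N"
            using n 1 2 unfolding R_def by blast
          have "\<exists>N. max_matching E N \<and> t \<notin> \<Union>N" using miss 1 unfolding R_def by blast
          then show False
            using gallai[of E N u v t] N ne fE EV 1 2 unfolding R_def by blast
        qed
      qed
    qed
    let ?C = "V // R"
    have edge: "(a, b) \<in> R" if "{a, b} \<in> E" for a b
    proof -
      have "a \<in> V" "b \<in> V" using EV that by auto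
      moreover have "a \<in> \<Union>N \<or> b \<in> \<Union>N" if "max_matching E N" for N
        using max_matching_no_add[OF fE that \<open>{a, b} \<in> E\<close>] by blast
      ultimately show ?thesis unfolding R_def by blast
    qed
    have inside: "A \<subseteq> X" if XA: "X \<in> ?C" "A \<in> E" "A \<inter> X \<noteq> {}" for X A
    proof -
      obtain a b where ab: "A = {a, b}" using EV XA by (metis card_2_iff)
      have "(a, b) \<in> R" "(b, a) \<in> R" using edge ab XA by (auto simp: insert_commute)
      then show ?thesis using XA ab in_quotient_imp_closed[OF RE XA(1)] by blast
    qed
    \<comment> \<open>A maximum matching that misses \<open>v\<close> covers the rest of the class
      of \<open>v\<close>. Edges stay inside classes, so it matches \<open>X - {v}\<close>
      perfectly.\<close>
    have oddX: "odd (card X)" if X: "X \<in> ?C" for X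
    proof -
      obtain v where v: "v \<in> X" using X RE in_quotient_imp_non_empty by blast
      have XV: "X \<subseteq> V" using X RE in_quotient_imp_subset by blast
      obtain N where N: "max_matching E N" "v \<notin> \<Union>N" using miss v XV by blast
      have NE: "N \<subseteq> E" using N by (auto simp: max_matching_def matching_def)
      let ?N = "{A \<in> N. A \<inter> X \<noteq> {}}"
      have "\<Union>?N = X - {v}"
      proof
        show "\<Union>?N \<subseteq> X - {v}" using inside[OF X] NE N(2) by blast
        show "X - {v} \<subseteq> \<Union>?N"
        proof
          fix w assume w: "w \<in> X - {v}"
          then have "(v, w) \<in> R" using in_quotient_imp_in_rel[OF RE X, of v w] v by simp
          then have "w \<in> \<Union>N" using w N unfolding R_def by blast
          then show "w \<in> \<Union>?N" using w by blast
        qed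
      qed
      moreover have "card (\<Union>?N) = 2 * card ?N"
        using N(1) NE EV fE finite_subset[OF NE fE]
        by (intro card_Union_matching) (auto simp: max_matching_def matching_def)
      ultimately have "even (card (X - {v}))" by simp
      then show ?thesis using v XV fV finite_subset by (metis card_Suc_Diff1 even_Suc)
    qed
    \<comment> \<open>Vertices missed by \<open>M\<close> are pairwise unrelated, hence in different
      classes.\<close>
    have "card (V - \<Union>M) \<le> card ?C"
    proof (rule card_inj_on_le[of "\<lambda>v. R `` {v}"])
      show "inj_on (\<lambda>v. R `` {v}) (V - \<Union>M)"
      proof (rule inj_onI)
        fix u v assume uv: "u \<in> V - \<Union>M" "v \<in> V - \<Union>M" "R `` {u} = R `` {v}"
        then have "(u, v) \<in> R" using eq_equiv_class[OF uv(3) RE] by blast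
        then show "u = v" using uv M unfolding R_def by blast
      qed
      show "(\<lambda>v. R `` {v}) ` (V - \<Union>M) \<subseteq> ?C" by (auto intro: quotientI)
      show "finite ?C" using finite_quotient[of V R] fV RE equiv_type by blast
    qed
    moreover have "card (\<Union>M) = 2 * card M"
      using card_Union_matching[OF fM] EV ME Md by blast
    moreover have "\<Union>M \<subseteq> V" using ME EV by blast
    then have "card (V - \<Union>M) = card V - card (\<Union>M)" "card (\<Union>M) \<le> card V"
      using fV finite_subset[of "\<Union>M" V] by (auto intro: card_Diff_subset card_mono)
    ultimately have c: "card V + card {} \<le> card ?C + 2 * card M" by simp
    show ?thesis
    proof (intro exI conjI)
      show "\<forall>X\<in>?C. X \<subseteq> V - {} \<and> odd (card X)"
        using oddX in_quotient_imp_subset[OF RE] by blast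
      show "\<forall>X\<in>?C. \<forall>Y\<in>?C. X \<noteq> Y \<longrightarrow> X \<inter> Y = {}" using quotient_disj[OF RE] by blast
      show "\<forall>X\<in>?C. \<forall>A\<in>E. A \<inter> X \<noteq> {} \<longrightarrow> A \<subseteq> X \<union> {}" using inside by blast
    qed (use c in auto)
  qed
qed

section \<open>Cuts and perfect matchings of r-graphs\<close>

lemma boundary_subset: "boundary G X \<subseteq> edges G"
  by (auto simp: boundary_def)

lemma boundary_edge: "e \<in> boundary G X \<Longrightarrow> e \<in> edges G"
  by (simp add: boundary_def)

lemma finite_boundary: "graph G \<Longrightarrow> finite (boundary G X)"
  using boundary_subset[of G X] by (auto simp: graph_def intro: finite_subset)

lemma boundary_vertex:
  assumes "graph G"
  shows "boundary G {v} = {e \<in> edges G. v \<in> ends G e}"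
proof -
  have "card (ends G e \<inter> {v}) = 1 \<longleftrightarrow> v \<in> ends G e" for e
    by (cases "v \<in> ends G e") auto
  then show ?thesis by (auto simp: boundary_def)
qed

lemma ends_obtain:
  assumes "graph G" "e \<in> edges G"
  obtains u v where "ends G e = {u, v}" "u \<noteq> v" "u \<in> verts G" "v \<in> verts G"
proof -
  have "card (ends G e) = 2" "ends G e \<subseteq> verts G" using assms by (auto simp: graph_def)
  then show ?thesis using that by (auto simp: card_2_iff)
qed

lemma mem_boundary:
  assumes "ends G e = {u, v}" "u \<noteq> v"
  shows "e \<in> boundary G X \<longleftrightarrow> e \<in> edges G \<and> (u \<in> X) \<noteq> (v \<in> X)"
proof -
  have "{u, v} \<inter> X = (if u \<in> X then {u} else {}) \<union> (if v \<in> X then {v} else {})" by auto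
  then show ?thesis using assms by (auto simp: boundary_def)
qed

lemma mem_boundary_iff:
  assumes "graph G" "e \<in> edges G"
  shows "e \<in> boundary G X \<longleftrightarrow> ends G e \<inter> X \<noteq> {} \<and> \<not> ends G e \<subseteq> X"
  using ends_obtain[OF assms] mem_boundary[of G e] assms(2) by (metis Int_insert_left_if0 Int_insert_left_if1 empty_not_insert Int_empty_left empty_subsetI insert_subset)

lemma boundary_obtain:
  assumes "graph G" "e \<in> boundary G X"
  obtains u v where "ends G e = {u, v}" "u \<in> X" "v \<notin> X" "u \<in> verts G" "v \<in> verts G"
proof -
  obtain x y where xy: "ends G e = {x, y}" "x \<noteq> y" "x \<in> verts G" "y \<in> verts G"
    using ends_obtain[OF assms(1) boundary_edge[OF assms(2)]] .
  have "(x \<in> X) \<noteq> (y \<in> X)" using mem_boundary[OF xy(1,2)] assms(2) by simp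
  then show ?thesis using that[of x y] that[of y x] xy by (cases "x \<in> X") (simp_all add: insert_commute)
qed

text \<open>Double counting of incidences with a free edge set \<open>N\<close>: all edges give the
  degree count of a regular graph, a perfect matching gives the parity of its share of a
  cut.\<close>

lemma handshake:
  assumes G: "graph G" and X: "X \<subseteq> verts G" and N: "N \<subseteq> edges G"
  shows "(\<Sum>v\<in>X. card (N \<inter> boundary G {v})) =
    card (N \<inter> boundary G X) + 2 * card {e \<in> N. ends G e \<subseteq> X}"
proof -
  have fX: "finite X" using G X by (auto simp: graph_def intro: finite_subset)
  have fN: "finite N" using G N by (auto simp: graph_def intro: finite_subset)
  have 1: "card (ends G e \<inter> X) = (if e \<in> boundary G X then 1 else 0) + (if ends G e \<subseteq> X then 2 else 0)"
    if "e \<in> N" for e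
  proof -
    have eE: "e \<in> edges G" using that N by blast
    obtain u v where "ends G e = {u, v}" "u \<noteq> v" using ends_obtain[OF G eE] .
    moreover have "{u, v} \<inter> X = (if u \<in> X then {u} else {}) \<union> (if v \<in> X then {v} else {})" by auto
    ultimately show ?thesis using mem_boundary[of G e u v X] that N by auto
  qed
  have "(\<Sum>v\<in>X. card (N \<inter> boundary G {v})) = (\<Sum>v\<in>X. card {e \<in> N. v \<in> ends G e})"
    using boundary_vertex[OF G] N by (intro sum.cong arg_cong[of _ _ card]) auto
  also have "\<dots> = (\<Sum>v\<in>X. \<Sum>e\<in>N. if v \<in> ends G e then 1 else 0)"
    using fN by (intro sum.cong) (auto simp: sum.If_cases Int_def)
  also have "\<dots> = (\<Sum>e\<in>N. \<Sum>v\<in>X. if v \<in> ends G e then 1 else 0)" by (rule sum.swap)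
  also have "\<dots> = (\<Sum>e\<in>N. card (ends G e \<inter> X))"
    using fX by (intro sum.cong) (auto simp: sum.If_cases Int_commute)
  also have "\<dots> = (\<Sum>e\<in>N. if e \<in> boundary G X then 1 else 0) + (\<Sum>e\<in>N. if ends G e \<subseteq> X then 2 else 0)"
    using 1 by (simp add: sum.distrib)
  also have "\<dots> = card (N \<inter> boundary G X) + 2 * card {e \<in> N. ends G e \<subseteq> X}"
    using fN by (simp add: sum.If_cases Int_def)
  finally show ?thesis .
qed

lemma regular_handshake:
  assumes "graph G" "regular_graph r G" "X \<subseteq> verts G"
  shows "r * card X = card (boundary G X) + 2 * card {e \<in> edges G. ends G e \<subseteq> X}"
proof -
  have "edges G \<inter> boundary G Y = boundary G Y" for Y using boundary_subset[of G] by blast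
  moreover have "card (boundary G {v}) = r" if "v \<in> X" for v
    using assms that by (auto simp: regular_graph_def)
  ultimately show ?thesis using handshake[OF assms(1,3) order.refl] by (simp add: mult.commute)
qed

section \<open>Perfect matchings, connectivity and cuts\<close>

text \<open>Phrased through stars because a colouring is bijective on stars and therefore pulls this
  condition back.\<close>

definition perfect_matching :: "('v, 'e) multigraph \<Rightarrow> 'e set \<Rightarrow> bool" where
  "perfect_matching G N \<longleftrightarrow> N \<subseteq> edges G \<and> (\<forall>v\<in>verts G. card (N \<inter> boundary G {v}) = 1)"

lemma perfect_matching_even:
  assumes "graph G" "perfect_matching G N" "X \<subseteq> verts G"
  shows "even (card X) \<longleftrightarrow> even (card (N \<inter> boundary G X))"
proof -
  have N: "N \<subseteq> edges G" using assms(2) by (simp add: perfect_matching_def)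
  have "card X = (\<Sum>v\<in>X. card (N \<inter> boundary G {v}))"
    using assms by (subst sum.cong[OF refl, of X _ "\<lambda>_. 1"]) (auto simp: perfect_matching_def)
  also have "\<dots> = card (N \<inter> boundary G X) + 2 * card {e \<in> N. ends G e \<subseteq> X}"
    by (rule handshake[OF assms(1,3) N])
  finally show ?thesis by simp
qed

text \<open>Puts connectivity into the language of cuts, so that it can be verified by the same
  counts as the condition on odd sets.\<close>

lemma connected_graph_iff_boundary:
  assumes G: "graph G"
  shows "connected_graph G \<longleftrightarrow> verts G \<noteq> {} \<and>
    (\<forall>X. X \<subseteq> verts G \<and> X \<noteq> {} \<and> X \<noteq> verts G \<longrightarrow> boundary G X \<noteq> {})"
proof -
  let ?R = "{(x, y). \<exists>e\<in>edges G. ends G e = {x, y}}"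
  have step: "y \<in> X" if "(x, y) \<in> ?R" "x \<in> X" "boundary G X = {}" for x y X
  proof -
    obtain e where e: "e \<in> edges G" "ends G e = {x, y}" using \<open>(x, y) \<in> ?R\<close> by blast
    then have "x \<noteq> y" using G by (auto simp: graph_def)
    then have "e \<in> boundary G X \<longleftrightarrow> (x \<in> X) \<noteq> (y \<in> X)" using mem_boundary[OF e(2)] e(1) by simp
    then show ?thesis using that(2,3) by simp
  qed
  show ?thesis
  proof (intro iffI conjI allI impI)
    assume c: "connected_graph G"
    then show "verts G \<noteq> {}" by (simp add: connected_graph_def)
    fix X assume X: "X \<subseteq> verts G \<and> X \<noteq> {} \<and> X \<noteq> verts G"
    then obtain u v where uv: "u \<in> X" "v \<in> verts G" "v \<notin> X" "u \<in> verts G" by blast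
    have uvR: "(u, v) \<in> ?R\<^sup>*" using c uv unfolding connected_graph_def by blast
    show "boundary G X \<noteq> {}"
    proof
      assume b: "boundary G X = {}"
      have "v \<in> X" using uvR uv(1) by (induction rule: rtrancl_induct) (use step b in blast)+
      then show False using uv by simp
    qed
  next
    assume a: "verts G \<noteq> {} \<and> (\<forall>X. X \<subseteq> verts G \<and> X \<noteq> {} \<and> X \<noteq> verts G \<longrightarrow> boundary G X \<noteq> {})"
    have "(u, v) \<in> ?R\<^sup>*" if u: "u \<in> verts G" and v: "v \<in> verts G" for u v
    proof -
      define X where "X = {w \<in> verts G. (u, w) \<in> ?R\<^sup>*}"
      have "boundary G X = {}"
      proof (rule ccontr)
        assume "boundary G X \<noteq> {}"
        then obtain e where e: "e \<in> boundary G X" by blast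
        then have eE: "e \<in> edges G" using boundary_edge by fast
        obtain x y where xy: "ends G e = {x, y}" "x \<noteq> y" "x \<in> verts G" "y \<in> verts G"
          using ends_obtain[OF G eE] .
        have "(x, y) \<in> ?R" "(y, x) \<in> ?R" using eE xy by auto
        then have "(u, x) \<in> ?R\<^sup>* \<longleftrightarrow> (u, y) \<in> ?R\<^sup>*" by (meson rtrancl.rtrancl_into_rtrancl)
        moreover have "(x \<in> X) \<noteq> (y \<in> X)" using mem_boundary[OF xy(1,2)] e by simp
        ultimately show False using xy(3,4) by (simp add: X_def)
      qed
      moreover have "u \<in> X" using u by (simp add: X_def)
      moreover have "X \<subseteq> verts G" by (auto simp: X_def)
      ultimately have "X = verts G" using a by blast
      then have "v \<in> X" using v by simp
      then show ?thesis by (simp add: X_def)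
    qed
    then show "connected_graph G" using a unfolding connected_graph_def by blast
  qed
qed

text \<open>For even \<open>X\<close> the degree count makes the cut even, and connectivity makes it
  nonempty; for odd \<open>X\<close> the cut has at least \<open>r\<close> edges.\<close>

lemma r_graph_even_boundary:
  assumes "connected_graph G" "r_graph r G" "X \<subseteq> verts G" "X \<noteq> {}" "X \<noteq> verts G" "r \<ge> 2"
  shows "2 \<le> card (boundary G X)"
proof (cases "odd (card X)")
  case True
  then have "r \<le> card (boundary G X)" using assms(2,3) by (simp add: r_graph_def)
  then show ?thesis using assms(6) by simp
next
  case False
  have g: "graph G" "regular_graph r G" using assms(2) by (auto simp: r_graph_def)
  have "boundary G X \<noteq> {}" using assms connected_graph_iff_boundary[OF g(1)] by blast
  then have "card (boundary G X) \<noteq> 0" using finite_boundary[OF g(1)] by simp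
  moreover have "even (r * card X)" using False by simp
  then have "even (card (boundary G X))" unfolding regular_handshake[OF g assms(3)] by simp
  ultimately show ?thesis by (cases "card (boundary G X) = 1") auto
qed

text \<open>Apply Tutte's condition to the graph without the ends of the given edge.\<close>

lemma r_graph_edge_in_perfect_matching:
  assumes rG: "r_graph r G" and r: "r > 0" and a: "a \<in> edges G"
  shows "\<exists>N. perfect_matching G N \<and> a \<in> N"
proof -
  have G: "graph G" and reg: "regular_graph r G" using rG by (auto simp: r_graph_def)
  obtain p q where pq: "ends G a = {p, q}" "p \<noteq> q" "p \<in> verts G" "q \<in> verts G"
    using ends_obtain[OF G a] .
  define V where "V = verts G - {p, q}"
  define E where "E = {A \<in> ends G ` edges G. A \<subseteq> V}"
  have fG: "finite (verts G)" "finite (edges G)" using G by (auto simp: graph_def)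
  have fV: "finite V" using fG by (simp add: V_def)
  have E2: "\<forall>A\<in>E. A \<subseteq> V \<and> card A = 2" using G by (auto simp: E_def graph_def)
  have fE: "finite E" using fG by (simp add: E_def)
  obtain M where M: "max_matching E M" using max_matching_exists[OF fE] by blast
  have ME: "M \<subseteq> E" and Md: "\<And>A B. A \<in> M \<Longrightarrow> B \<in> M \<Longrightarrow> A \<noteq> B \<Longrightarrow> A \<inter> B = {}"
    using M(1) by (auto simp: max_matching_def matching_def)
  have fM: "finite M" using ME fE finite_subset by blast
  have UM: "\<Union>M \<subseteq> V" using ME E2 by blast
  have cUM: "card (\<Union>M) = 2 * card M" using card_Union_matching[OF fM] ME E2 Md by blast
  \<comment> \<open>Otherwise the whole vertex set would be an odd set with an empty cut.\<close>
  have evG: "even (card (verts G))"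
  proof (rule ccontr)
    assume "odd (card (verts G))"
    then have "r \<le> card (boundary G (verts G))" using rG by (auto simp: r_graph_def)
    moreover have "boundary G (verts G) = {}"
      using boundary_obtain[OF G, of _ "verts G"] by (metis equals0I)
    ultimately show False using r by simp
  qed
  have cV: "card (verts G) = card V + 2"
  proof -
    have "verts G = insert p (insert q V)" "p \<notin> insert q V" "q \<notin> V" using pq by (auto simp: V_def)
    then show ?thesis using fV by simp
  qed
  have full: "\<Union>M = V"
  proof (rule ccontr)
    assume ne: "\<Union>M \<noteq> V"
    then have "card (\<Union>M) < card V" using UM fV by (simp add: psubset_card_mono psubsetI)
    \<comment> \<open>As \<open>V\<close> is even, a matching that is not perfect misses at least
      two vertices.\<close>
    then have cM: "2 * card M + 2 \<le> card V"
      using cUM evG cV by (metis Suc_1 Suc_leI add_2_eq_Suc' dvd_triv_left even_Suc even_add le_neq_implies_less)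
    obtain S C where SC: "S \<subseteq> V" "\<forall>X\<in>C. X \<subseteq> V - S \<and> odd (card X)"
      "\<forall>X\<in>C. \<forall>Y\<in>C. X \<noteq> Y \<longrightarrow> X \<inter> Y = {}"
      "\<forall>X\<in>C. \<forall>A\<in>E. A \<inter> X \<noteq> {} \<longrightarrow> A \<subseteq> X \<union> S"
      "card V + card S \<le> card C + 2 * card M"
      using tutte_berge[OF fV E2 M] by (elim exE conjE) (rule that)
    have cC: "card S + 2 \<le> card C" using SC(5) cM by simp
    define T where "T = insert p (insert q S)"
    have TV: "T \<subseteq> verts G" using SC(1) pq by (auto simp: T_def V_def)
    have fS: "finite S" using SC(1) fV finite_subset by blast
    have "p \<notin> insert q S" "q \<notin> S" using SC(1) pq(2) by (auto simp: V_def)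
    then have cT: "card T = card S + 2" using fS by (simp add: T_def)
    have bd: "ends G e \<inter> T \<noteq> {} \<and> ends G e \<subseteq> X \<union> T"
      if X: "X \<in> C" and e: "e \<in> boundary G X" for X e
    proof -
      have eE: "e \<in> edges G" using boundary_edge[OF e] .
      have XV: "X \<subseteq> V" using SC(2) X by blast
      obtain u v where uv: "ends G e = {u, v}" "u \<in> X" "v \<notin> X" "u \<in> verts G" "v \<in> verts G"
        using boundary_obtain[OF G e] .
      have "v \<in> T"
      proof (rule ccontr)
        assume "v \<notin> T"
        then have "v \<in> V" using uv by (auto simp: T_def V_def)
        then have "ends G e \<in> E" using uv XV eE by (auto simp: E_def)
        then have "ends G e \<subseteq> X \<union> S" using SC(4) X uv by blast
        then show False using uv \<open>v \<notin> T\<close> by (auto simp: T_def)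
      qed
      then show ?thesis using uv by auto
    qed
    have XT: "X \<inter> T = {}" if "X \<in> C" for X using SC(2) that by (auto simp: T_def V_def)
    have "C \<subseteq> Pow V" using SC(2) by blast
    then have fC: "finite C" using fV by (meson finite_Pow_iff finite_subset)
    \<comment> \<open>The odd sets send at least \<open>r\<close> edges each, all of them to
      \<open>T\<close>, which has at most \<open>card C\<close> vertices. The edge \<open>a\<close>
      lies inside \<open>T\<close> and takes up two of its \<open>r * card T\<close> incidences, so
      too few are left.\<close>
    have "r * card C \<le> (\<Sum>X\<in>C. card (boundary G X))"
    proof -
      have "r \<le> card (boundary G X)" if "X \<in> C" for X
        using SC(2) that rG by (auto simp: r_graph_def V_def)
      then show ?thesis using sum_mono[of C "\<lambda>_. r" "\<lambda>X. card (boundary G X)"] by (simp add: mult.commute)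
    qed
    also have "\<dots> = card (\<Union>X\<in>C. boundary G X)"
    proof (rule card_UN_disjoint[symmetric])
      show "finite C" by (rule fC)
      show "\<forall>X\<in>C. finite (boundary G X)" using finite_boundary[OF G] by blast
      show "\<forall>X\<in>C. \<forall>Y\<in>C. X \<noteq> Y \<longrightarrow> boundary G X \<inter> boundary G Y = {}"
      proof (intro ballI impI equals0I)
        fix X Y e assume XY: "X \<in> C" "Y \<in> C" "X \<noteq> Y" "e \<in> boundary G X \<inter> boundary G Y"
        then have eE: "e \<in> edges G" using boundary_edge by fast
        have "ends G e \<subseteq> X \<union> T" "ends G e \<subseteq> Y \<union> T" using bd XY by blast+
        then have "ends G e \<subseteq> T" using SC(3) XY by blast
        moreover have "ends G e \<inter> X \<noteq> {}" using mem_boundary_iff[OF G eE, of X] XY(4) by simp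
        ultimately show False using XT[OF XY(1)] by blast
      qed
    qed
    also have "\<dots> \<le> card (boundary G T)"
    proof (rule card_mono[OF finite_boundary[OF G]], rule subsetI)
      fix e assume "e \<in> (\<Union>X\<in>C. boundary G X)"
      then obtain X where X: "X \<in> C" "e \<in> boundary G X" by blast
      then have eE: "e \<in> edges G" using boundary_edge by fast
      show "e \<in> boundary G T"
        using mem_boundary_iff[OF G eE, of T] mem_boundary_iff[OF G eE, of X] bd[OF X] X(2) XT[OF X(1)] by blast
    qed
    also have "card (boundary G T) + 2 \<le> r * card T"
    proof -
      have "a \<in> {e \<in> edges G. ends G e \<subseteq> T}" using a pq by (auto simp: T_def)
      then have "card {e \<in> edges G. ends G e \<subseteq> T} \<noteq> 0" using fG by auto
      then show ?thesis using regular_handshake[OF G reg TV] by linarith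
    qed
    finally have "r * card C + 2 \<le> r * (card S + 2)" using cT by simp
    moreover have "r * (card S + 2) \<le> r * card C" using cC by (rule mult_le_mono2)
    ultimately show False by linarith
  qed
  have "\<exists>e. e \<in> edges G \<and> ends G e = A" if "A \<in> M" for A using that ME by (auto simp: E_def)
  then obtain h where h: "\<And>A. A \<in> M \<Longrightarrow> h A \<in> edges G \<and> ends G (h A) = A" by metis
  define N where "N = insert a (h ` M)"
  have "card (N \<inter> boundary G {v}) = 1" if v: "v \<in> verts G" for v
  proof -
    have "\<exists>e. N \<inter> boundary G {v} = {e}"
    proof (cases "v \<in> {p, q}")
      case True
      have "N \<inter> boundary G {v} = {a}"
      proof
        show "N \<inter> boundary G {v} \<subseteq> {a}"
        proof
          fix e assume e: "e \<in> N \<inter> boundary G {v}"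
          then have ve: "v \<in> ends G e" unfolding boundary_vertex[OF G] by simp
          show "e \<in> {a}"
          proof (rule ccontr)
            assume "e \<notin> {a}"
            then obtain A where A: "A \<in> M" "e = h A" using e by (auto simp: N_def)
            then have "v \<in> V" using h ve UM by auto
            then show False using True by (simp add: V_def)
          qed
        qed
        show "{a} \<subseteq> N \<inter> boundary G {v}"
          using True a pq unfolding boundary_vertex[OF G] N_def by auto
      qed
      then show ?thesis by blast
    next
      case False
      then have "v \<in> \<Union>M" using full v by (simp add: V_def)
      then obtain A where A: "A \<in> M" "v \<in> A" by blast
      have "N \<inter> boundary G {v} = {h A}"
      proof
        show "N \<inter> boundary G {v} \<subseteq> {h A}"
        proof
          fix e assume e: "e \<in> N \<inter> boundary G {v}"
          then have ve: "v \<in> ends G e" unfolding boundary_vertex[OF G] by simp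
          then have "e \<noteq> a" using False pq(1) by auto
          then obtain B where B: "B \<in> M" "e = h B" using e by (auto simp: N_def)
          then have "v \<in> B" using h ve by auto
          then have "A = B" using Md[OF A(1) B(1)] A(2) by auto
          then show "e \<in> {h A}" using B by simp
        qed
        show "{h A} \<subseteq> N \<inter> boundary G {v}"
          using A h unfolding boundary_vertex[OF G] N_def by auto
      qed
      then show ?thesis by blast
    qed
    then show ?thesis by auto
  qed
  then have "perfect_matching G N" using a h by (auto simp: perfect_matching_def N_def)
  then show ?thesis by (auto simp: N_def)
qed

section \<open>Perfect matchings of the Petersen graph\<close>

text \<open>The edges of the Petersen graph: 0 to 4 form the outer cycle, 5 to 9 the inner cycle, and 10 to 14
  are the spokes.\<close>

definition pos_ends :: "nat \<Rightarrow> nat set" where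
  "pos_ends p = (if p < 5 then {p, (p + 1) mod 5} else if p < 10 then {p, 5 + (p + 2) mod 5}
     else {p - 10, p - 5})"

definition mult :: "nat \<Rightarrow> nat \<Rightarrow> nat" where
  "mult m p = (if p < 10 then 1 else m)"

definition fat_petersen :: "nat \<Rightarrow> (nat, nat \<times> nat) multigraph" where
  "fat_petersen m = \<lparr>verts = {..<10}, edges = {(p, k). p < 15 \<and> k < mult m p},
     ends = (\<lambda>e. pos_ends (fst e))\<rparr>"

text \<open>The perfect matchings of the Petersen graph that contain the edge \<open>p\<close>: number 5 consists of all
  spokes, and number \<open>k < 5\<close> contains exactly one spoke, the one at the vertex \<open>k\<close>.\<close>

definition types :: "nat \<Rightarrow> nat set" where
  "types p = (if p < 5 then {(p + 4) mod 5, (p + 2) mod 5}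
     else if p < 10 then {(p + 3) mod 5, (p + 4) mod 5} else {p - 10, 5})"

section \<open>Case checks on the six perfect matchings of the Petersen graph\<close>

lemma all_less_5: "(\<forall>i<5::nat. P i) \<longleftrightarrow> P 0 \<and> P 1 \<and> P 2 \<and> P 3 \<and> P 4"
  by (auto simp: numeral_eq_Suc All_less_Suc)

lemma all_less_6: "(\<forall>i<6::nat. P i) \<longleftrightarrow> P 0 \<and> P 1 \<and> P 2 \<and> P 3 \<and> P 4 \<and> P 5"
  by (auto simp: numeral_eq_Suc All_less_Suc)

lemma ex_less_6: "(\<exists>i<6::nat. P i) \<longleftrightarrow> P 0 \<or> P 1 \<or> P 2 \<or> P 3 \<or> P 4 \<or> P 5"
  by (auto simp: numeral_eq_Suc Ex_less_Suc)

lemma all_less_10: "(\<forall>i<10::nat. P i) \<longleftrightarrow> P 0 \<and> P 1 \<and> P 2 \<and> P 3 \<and> P 4 \<and> P 5 \<and> P 6 \<and> P 7 \<and> P 8 \<and> P 9"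
  by (auto simp: numeral_eq_Suc All_less_Suc)

lemma all_less_15: "(\<forall>i<15::nat. P i) \<longleftrightarrow> P 0 \<and> P 1 \<and> P 2 \<and> P 3 \<and> P 4 \<and> P 5 \<and> P 6 \<and> P 7 \<and> P 8 \<and> P 9
    \<and> P 10 \<and> P 11 \<and> P 12 \<and> P 13 \<and> P 14"
  by (auto simp: numeral_eq_Suc All_less_Suc)

lemma ex_less_15: "(\<exists>i<15::nat. P i) \<longleftrightarrow> P 0 \<or> P 1 \<or> P 2 \<or> P 3 \<or> P 4 \<or> P 5 \<or> P 6 \<or> P 7 \<or> P 8 \<or> P 9
    \<or> P 10 \<or> P 11 \<or> P 12 \<or> P 13 \<or> P 14"
  by (auto simp: numeral_eq_Suc Ex_less_Suc)

text \<open>The letters \<open>c\<close>, \<open>d\<close>, \<open>s\<close> stand for outer edges,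
  inner edges and spokes. Each hypothesis is exact cover at one vertex, and the disjuncts list the
  six matchings in the numbering of \<open>types\<close>. The spokes and one edge of each cycle
  determine the rest, so seven case splits suffice.\<close>

lemma perfect_matching_types_bool:
  assumes
    "(c0 \<and> \<not> c4 \<and> \<not> s0) \<or> (\<not> c0 \<and> c4 \<and> \<not> s0) \<or> (\<not> c0 \<and> \<not> c4 \<and> s0)"
    "(c1 \<and> \<not> c0 \<and> \<not> s1) \<or> (\<not> c1 \<and> c0 \<and> \<not> s1) \<or> (\<not> c1 \<and> \<not> c0 \<and> s1)"
    "(c2 \<and> \<not> c1 \<and> \<not> s2) \<or> (\<not> c2 \<and> c1 \<and> \<not> s2) \<or> (\<not> c2 \<and> \<not> c1 \<and> s2)"
    "(c3 \<and> \<not> c2 \<and> \<not> s3) \<or> (\<not> c3 \<and> c2 \<and> \<not> s3) \<or> (\<not> c3 \<and> \<not> c2 \<and> s3)"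
    "(c4 \<and> \<not> c3 \<and> \<not> s4) \<or> (\<not> c4 \<and> c3 \<and> \<not> s4) \<or> (\<not> c4 \<and> \<not> c3 \<and> s4)"
    "(d0 \<and> \<not> d3 \<and> \<not> s0) \<or> (\<not> d0 \<and> d3 \<and> \<not> s0) \<or> (\<not> d0 \<and> \<not> d3 \<and> s0)"
    "(d1 \<and> \<not> d4 \<and> \<not> s1) \<or> (\<not> d1 \<and> d4 \<and> \<not> s1) \<or> (\<not> d1 \<and> \<not> d4 \<and> s1)"
    "(d2 \<and> \<not> d0 \<and> \<not> s2) \<or> (\<not> d2 \<and> d0 \<and> \<not> s2) \<or> (\<not> d2 \<and> \<not> d0 \<and> s2)"
    "(d3 \<and> \<not> d1 \<and> \<not> s3) \<or> (\<not> d3 \<and> d1 \<and> \<not> s3) \<or> (\<not> d3 \<and> \<not> d1 \<and> s3)"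
    "(d4 \<and> \<not> d2 \<and> \<not> s4) \<or> (\<not> d4 \<and> d2 \<and> \<not> s4) \<or> (\<not> d4 \<and> \<not> d2 \<and> s4)"
  shows
    "(\<not> c0 \<and> c1 \<and> \<not> c2 \<and> c3 \<and> \<not> c4 \<and> \<not> d0 \<and> d1 \<and> d2 \<and> \<not> d3 \<and> \<not> d4 \<and> s0 \<and> \<not> s1 \<and> \<not> s2 \<and> \<not> s3 \<and> \<not> s4) \<or>
     (\<not> c0 \<and> \<not> c1 \<and> c2 \<and> \<not> c3 \<and> c4 \<and> \<not> d0 \<and> \<not> d1 \<and> d2 \<and> d3 \<and> \<not> d4 \<and> \<not> s0 \<and> s1 \<and> \<not> s2 \<and> \<not> s3 \<and> \<not> s4) \<or>
     (c0 \<and> \<not> c1 \<and> \<not> c2 \<and> c3 \<and> \<not> c4 \<and> \<not> d0 \<and> \<not> d1 \<and> \<not> d2 \<and> d3 \<and> d4 \<and> \<not> s0 \<and> \<not> s1 \<and> s2 \<and> \<not> s3 \<and> \<not> s4) \<or>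
     (\<not> c0 \<and> c1 \<and> \<not> c2 \<and> \<not> c3 \<and> c4 \<and> d0 \<and> \<not> d1 \<and> \<not> d2 \<and> \<not> d3 \<and> d4 \<and> \<not> s0 \<and> \<not> s1 \<and> \<not> s2 \<and> s3 \<and> \<not> s4) \<or>
     (c0 \<and> \<not> c1 \<and> c2 \<and> \<not> c3 \<and> \<not> c4 \<and> d0 \<and> d1 \<and> \<not> d2 \<and> \<not> d3 \<and> \<not> d4 \<and> \<not> s0 \<and> \<not> s1 \<and> \<not> s2 \<and> \<not> s3 \<and> s4) \<or>
     (\<not> c0 \<and> \<not> c1 \<and> \<not> c2 \<and> \<not> c3 \<and> \<not> c4 \<and> \<not> d0 \<and> \<not> d1 \<and> \<not> d2 \<and> \<not> d3 \<and> \<not> d4 \<and> s0 \<and> s1 \<and> s2 \<and> s3 \<and> s4)"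
  using assms by (cases s0; cases s1; cases s2; cases s3; cases s4; cases c0; cases d0; simp)

lemma ex1_three:
  "\<lbrakk>\<exists>!p. p = a \<and> P a \<or> p = b \<and> P b \<or> p = c \<and> P c; a \<noteq> b; b \<noteq> c; a \<noteq> c\<rbrakk>
    \<Longrightarrow> (P a \<and> \<not> P b \<and> \<not> P c) \<or> (\<not> P a \<and> P b \<and> \<not> P c) \<or> (\<not> P a \<and> \<not> P b \<and> P c)"
  for P :: "nat \<Rightarrow> bool"
  by metis

lemma perfect_matching_types:
  assumes "\<forall>i<10. \<exists>!p. p < 15 \<and> i \<in> pos_ends p \<and> b p"
  shows "\<exists>k<6. \<forall>p<15. b p \<longleftrightarrow> k \<in> types p"
proof -
  have e: "(b x \<and> \<not> b y \<and> \<not> b z) \<or> (\<not> b x \<and> b y \<and> \<not> b z) \<or> (\<not> b x \<and> \<not> b y \<and> b z)"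
    if i: "i < 10" and x: "\<forall>p<15. i \<in> pos_ends p \<longleftrightarrow> p = x \<or> p = y \<or> p = z"
      and d: "x < 15" "y < 15" "z < 15" "x \<noteq> y" "y \<noteq> z" "x \<noteq> z" for i x y z
  proof -
    have *: "(p < 15 \<and> i \<in> pos_ends p \<and> b p) \<longleftrightarrow> p = x \<and> b x \<or> p = y \<and> b y \<or> p = z \<and> b z" for p
      using x d by blast
    have "\<exists>!p. p < 15 \<and> i \<in> pos_ends p \<and> b p" using assms i by blast
    then have "\<exists>!p. p = x \<and> b x \<or> p = y \<and> b y \<or> p = z \<and> b z" unfolding * .
    from ex1_three[OF this] d show ?thesis by simp
  qed
  have "(b 0 \<and> \<not> b 4 \<and> \<not> b 10) \<or> (\<not> b 0 \<and> b 4 \<and> \<not> b 10) \<or> (\<not> b 0 \<and> \<not> b 4 \<and> b 10)"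
    by (rule e[of 0]) (simp_all add: all_less_15 pos_ends_def)
  moreover have "(b 1 \<and> \<not> b 0 \<and> \<not> b 11) \<or> (\<not> b 1 \<and> b 0 \<and> \<not> b 11) \<or> (\<not> b 1 \<and> \<not> b 0 \<and> b 11)"
    by (rule e[of 1]) (simp_all add: all_less_15 pos_ends_def)
  moreover have "(b 2 \<and> \<not> b 1 \<and> \<not> b 12) \<or> (\<not> b 2 \<and> b 1 \<and> \<not> b 12) \<or> (\<not> b 2 \<and> \<not> b 1 \<and> b 12)"
    by (rule e[of 2]) (simp_all add: all_less_15 pos_ends_def)
  moreover have "(b 3 \<and> \<not> b 2 \<and> \<not> b 13) \<or> (\<not> b 3 \<and> b 2 \<and> \<not> b 13) \<or> (\<not> b 3 \<and> \<not> b 2 \<and> b 13)"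
    by (rule e[of 3]) (simp_all add: all_less_15 pos_ends_def)
  moreover have "(b 4 \<and> \<not> b 3 \<and> \<not> b 14) \<or> (\<not> b 4 \<and> b 3 \<and> \<not> b 14) \<or> (\<not> b 4 \<and> \<not> b 3 \<and> b 14)"
    by (rule e[of 4]) (simp_all add: all_less_15 pos_ends_def)
  moreover have "(b 5 \<and> \<not> b 8 \<and> \<not> b 10) \<or> (\<not> b 5 \<and> b 8 \<and> \<not> b 10) \<or> (\<not> b 5 \<and> \<not> b 8 \<and> b 10)"
    by (rule e[of 5]) (simp_all add: all_less_15 pos_ends_def)
  moreover have "(b 6 \<and> \<not> b 9 \<and> \<not> b 11) \<or> (\<not> b 6 \<and> b 9 \<and> \<not> b 11) \<or> (\<not> b 6 \<and> \<not> b 9 \<and> b 11)"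
    by (rule e[of 6]) (simp_all add: all_less_15 pos_ends_def)
  moreover have "(b 7 \<and> \<not> b 5 \<and> \<not> b 12) \<or> (\<not> b 7 \<and> b 5 \<and> \<not> b 12) \<or> (\<not> b 7 \<and> \<not> b 5 \<and> b 12)"
    by (rule e[of 7]) (simp_all add: all_less_15 pos_ends_def)
  moreover have "(b 8 \<and> \<not> b 6 \<and> \<not> b 13) \<or> (\<not> b 8 \<and> b 6 \<and> \<not> b 13) \<or> (\<not> b 8 \<and> \<not> b 6 \<and> b 13)"
    by (rule e[of 8]) (simp_all add: all_less_15 pos_ends_def)
  moreover have "(b 9 \<and> \<not> b 7 \<and> \<not> b 14) \<or> (\<not> b 9 \<and> b 7 \<and> \<not> b 14) \<or> (\<not> b 9 \<and> \<not> b 7 \<and> b 14)"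
    by (rule e[of 9]) (simp_all add: all_less_15 pos_ends_def)
  ultimately show ?thesis
    unfolding ex_less_6 all_less_15
    using perfect_matching_types_bool[of "b 0" "b 4" "b 10" "b 1" "b 11" "b 2" "b 12" "b 3" "b 13" "b 14"
        "b 5" "b 8" "b 6" "b 9" "b 7"]
    by (simp add: types_def)
qed

text \<open>Two of the six matchings share an edge that lies in no third one. If the matchings
  satisfying \<open>t\<close> cover all positions, this edge forces one of the two. So at most one
  of the six fails \<open>t\<close>.\<close>

lemma types_pair:
  assumes "\<forall>p<15. \<exists>k<6. t k \<and> k \<in> types p" "a < 6" "b < 6" "a \<noteq> b"
  shows "t a \<or> t b"
proof -
  have "\<forall>a<6. \<forall>b<6. a \<noteq> b \<longrightarrow> (\<exists>p<15. \<forall>k<6. k \<in> types p \<longrightarrow> k = a \<or> k = b)"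
    unfolding all_less_6 ex_less_15 by (simp add: types_def)
  then have "\<exists>p<15. \<forall>k<6. k \<in> types p \<longrightarrow> k = a \<or> k = b" using assms(2-4) by simp
  then obtain p where p: "p < 15" "\<forall>k<6. k \<in> types p \<longrightarrow> k = a \<or> k = b" by blast
  obtain k where "k < 6" "t k" "k \<in> types p" using assms(1) p(1) by blast
  then show ?thesis using p(2) by blast
qed

lemma types_card: "p < 15 \<Longrightarrow> card (types p) = 2 \<and> types p \<subseteq> {..<6}"
proof -
  have "\<forall>p<15. card (types p) = 2 \<and> types p \<subseteq> {..<6}"
    unfolding all_less_15 by (simp add: types_def)
  then show "p < 15 \<Longrightarrow> ?thesis" by simp
qed

lemma map_distinct_inj:
  assumes "distinct (map f [0..<n])" "p < n" "q < n" "f p = f q"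
  shows "p = q"
  using assms by (auto simp: distinct_map inj_on_def)

lemma types_inj: "p < 15 \<Longrightarrow> q < 15 \<Longrightarrow> types p = types q \<Longrightarrow> p = q"
  by (rule map_distinct_inj[of types 15])
    (simp_all add: upt_rec types_def doubleton_eq_iff)

text \<open>Of two different edges, each lies in a matching that avoids the other. These are two
  different matchings, and at most one of them can be absent.\<close>

lemma types_distinguish:
  assumes "\<forall>p<15. \<exists>k<6. t k \<and> k \<in> types p" "p < 15" "q < 15"
    "\<forall>k<6. t k \<longrightarrow> (k \<in> types p \<longleftrightarrow> k \<in> types q)"
  shows "p = q"
proof (rule ccontr)
  assume "p \<noteq> q"
  then have ne: "types p \<noteq> types q" using types_inj assms(2,3) by blast
  have c: "card (types p) = 2" "card (types q) = 2" "types p \<subseteq> {..<6}" "types q \<subseteq> {..<6}"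
    using types_card assms(2,3) by auto
  have f: "finite (types p)" "finite (types q)" using c(3,4) finite_subset by auto
  have "\<not> types p \<subseteq> types q" using card_subset_eq[OF f(2)] c ne by auto
  then obtain a where a: "a \<in> types p" "a \<notin> types q" by blast
  have "\<not> types q \<subseteq> types p" using card_subset_eq[OF f(1)] c ne by auto
  then obtain b where b: "b \<in> types q" "b \<notin> types p" by blast
  have l: "a < 6" "b < 6" using a b c by auto
  have "a \<noteq> b" using a b by blast
  then have "t a \<or> t b" using types_pair[OF assms(1) l] by blast
  then show False using assms(4) a b l by blast
qed

text \<open>A cycle edge never lies in matching 5. If its present types are among those of the
  spoke, \<open>{s, 5}\<close>, then its two types are \<open>s\<close> and an absent one. Only one
  type can be absent, so the cycle edge is determined.\<close>

lemma types_spoke_unique: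
  assumes t: "\<forall>p<15. \<exists>k<6. t k \<and> k \<in> types p" and "p < 10" "q < 10" "s < 5"
    and 1: "\<forall>k<6. t k \<longrightarrow> k \<in> types p \<longrightarrow> k \<in> types (10 + s)"
    and 2: "\<forall>k<6. t k \<longrightarrow> k \<in> types q \<longrightarrow> k \<in> types (10 + s)"
  shows "p = q"
proof -
  have ts: "types (10 + s) = {s, 5}" using assms(4) by (simp add: types_def)
  have *: "\<exists>b. types p = {s, b} \<and> b \<noteq> s \<and> b < 6 \<and> \<not> t b"
    if p: "p < 10" and sub: "\<forall>k<6. t k \<longrightarrow> k \<in> types p \<longrightarrow> k \<in> types (10 + s)" for p
  proof -
    have c: "card (types p) = 2" "types p \<subseteq> {..<6}" using types_card p by auto
    have p5: "5 \<notin> types p" using p by (auto simp: types_def)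
    obtain a b where ab: "types p = {a, b}" "a \<noteq> b" using c(1) by (auto simp: card_2_iff)
    have n: "\<not> t k" if "k \<in> types p" "k \<noteq> s" for k
      using sub that c(2) ts p5 by auto
    have "t a \<or> t b" using types_pair[OF t, of a b] ab c(2) by auto
    then have "a = s \<or> b = s" using n ab by auto
    then show ?thesis
    proof
      assume "a = s"
      then show ?thesis using ab c(2) n[of b] by auto
    next
      assume "b = s"
      then show ?thesis using ab c(2) n[of a] by (intro exI[of _ a]) auto
    qed
  qed
  obtain b where b: "types p = {s, b}" "b < 6" "\<not> t b" using *[OF assms(2) 1] by blast
  obtain c where c: "types q = {s, c}" "c < 6" "\<not> t c" using *[OF assms(3) 2] by blast
  have "b = c" using types_pair[OF t b(2) c(2)] b(3) c(3) by blast
  then show ?thesis using types_inj[of p q] b c assms(2,3) by simp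
qed

section \<open>Incidences in the Petersen graph\<close>

lemma pos_ends_inj:
  assumes "p < 15" "q < 15" "i \<noteq> j" "{i, j} \<subseteq> pos_ends p" "{i, j} \<subseteq> pos_ends q"
  shows "p = q"
proof -
  have "pos_ends p = pos_ends q"
    using assms(3-5) by (auto simp: pos_ends_def split: if_splits)
  then show ?thesis
    using map_distinct_inj[of pos_ends 15 p q] assms(1,2)
    by (simp add: upt_rec pos_ends_def doubleton_eq_iff)
qed

lemma pos_ends_card:
  assumes "p < 15"
  shows "pos_ends p \<subseteq> {..<10} \<and> card (pos_ends p) = 2"
proof -
  have "\<forall>p<15. pos_ends p \<subseteq> {..<10} \<and> card (pos_ends p) = 2"
    unfolding all_less_15 by (simp add: pos_ends_def)
  then show ?thesis using assms by simp
qed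

lemma pos_ends_cycle_two:
  assumes "i < 10"
  shows "\<exists>p<10. \<exists>q<10. p \<noteq> q \<and> i \<in> pos_ends p \<and> i \<in> pos_ends q"
proof -
  have "\<forall>i<10. \<exists>p<15. \<exists>q<15. p < 10 \<and> q < 10 \<and> p \<noteq> q \<and> i \<in> pos_ends p \<and> i \<in> pos_ends q"
    unfolding all_less_10 ex_less_15 by (simp add: pos_ends_def)
  then have "\<exists>p<15. \<exists>q<15. p < 10 \<and> q < 10 \<and> p \<noteq> q \<and> i \<in> pos_ends p \<and> i \<in> pos_ends q"
    using assms by simp
  then show ?thesis by blast
qed

lemma pos_ends_spoke:
  assumes "i < 10"
  shows "i \<in> pos_ends q \<and> 10 \<le> q \<and> q < 15 \<longleftrightarrow> q = 10 + i mod 5"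
proof (cases "i < 5")
  case True
  then show ?thesis by (auto simp: pos_ends_def)
next
  case False
  then have "i mod 5 = i - 5" using assms by (simp add: mod_if)
  then show ?thesis using False assms by (auto simp: pos_ends_def)
qed

lemma pos_ends_spoke_eq: 
  assumes "i < 10"
  shows "pos_ends (10 + i mod 5) = {i, (i + 5) mod 10}"
proof (cases "i < 5")
  case True
  then show ?thesis by (auto simp: pos_ends_def)
next
  case False
  then have "i mod 5 = i - 5" "(i + 5) mod 10 = i - 5" using assms by (simp_all add: mod_if)
  then show ?thesis using False assms by (auto simp: pos_ends_def)
qed

text \<open>The ends of a spoke are \<open>i\<close> and \<open>(i + 5) mod 10\<close>.\<close>

lemma pos_ends_partner:
  assumes "p < 10" "pos_ends p = {i, j}" "q < 10"
  shows "pos_ends q \<noteq> {(i + 5) mod 10, (j + 5) mod 10} \<and> pos_ends q \<noteq> {i, (j + 5) mod 10} \<and> i mod 5 \<noteq> j mod 5"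
proof -
  \<comment> \<open>The inner cycle advances by two, so the spoke partners of neighbours on one
    cycle are at distance two on the other. Both orders of the ends of \<open>p\<close> are checked,
    as the statement does not fix which end is \<open>i\<close>.\<close>
  let ?P = "\<lambda>i j. (\<forall>q<10. pos_ends q \<noteq> {(i + 5) mod 10, (j + 5) mod 10} \<and> pos_ends q \<noteq> {i, (j + 5) mod 10}) \<and> i mod 5 \<noteq> j mod (5::nat)"
  have c: "p = 0 \<or> p = 1 \<or> p = 2 \<or> p = 3 \<or> p = 4 \<or> p = 5 \<or> p = 6 \<or> p = 7 \<or> p = 8 \<or> p = 9"
    using assms(1) by arith
  define b where "b = (if p < 5 then (p + 1) mod 5 else 5 + (p + 2) mod 5)"
  have ab: "pos_ends p = {p, b}" using assms(1) by (simp add: pos_ends_def b_def)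
  have "?P p b \<and> ?P b p"
    unfolding all_less_10 b_def using c by (elim disjE) (simp_all add: pos_ends_def doubleton_eq_iff)
  then have "?P i j" using assms(2) ab by (auto simp: doubleton_eq_iff)
  then show ?thesis using assms(3) by blast
qed

section \<open>Edge cuts of the fat Petersen graph\<close>

lemma card_of_bool: "card {i. i < (10::nat) \<and> y i} = of_bool (y 0) + of_bool (y 1) + of_bool (y 2) + of_bool (y 3)
  + of_bool (y 4) + of_bool (y 5) + of_bool (y 6) + of_bool (y 7) + of_bool (y 8) + of_bool (y 9)"
proof -
  have "{i. i < (10::nat) \<and> y i} = {i \<in> {..<10}. y i}" by auto
  then have "card {i. i < (10::nat) \<and> y i} = (\<Sum>i<10. of_bool (y i))"
    by (simp add: of_bool_def sum.If_cases Int_def)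
  then show ?thesis by (simp add: numeral_eq_Suc lessThan_Suc)
qed

text \<open>Here \<open>t\<close> counts the chosen vertices, \<open>c\<close> the cut cycle edges
  and \<open>s\<close> the cut spokes. The bound for odd \<open>t\<close> is split in this way
  because spokes have multiplicity \<open>m\<close>: both alternatives give
  \<open>c + s * m \<ge> m + 2\<close> for every \<open>m \<ge> 1\<close>.\<close>

lemma petersen_cut_bool:
  fixes t c s :: nat
  assumes t: "t = of_bool y0 + of_bool y1 + of_bool y2 + of_bool y3 + of_bool y4
    + of_bool y5 + of_bool y6 + of_bool y7 + of_bool y8 + of_bool y9"
    and c: "c = of_bool (y0 \<noteq> y1) + of_bool (y1 \<noteq> y2) + of_bool (y2 \<noteq> y3) + of_bool (y3 \<noteq> y4) + of_bool (y4 \<noteq> y0)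
    + of_bool (y5 \<noteq> y7) + of_bool (y6 \<noteq> y8) + of_bool (y7 \<noteq> y9) + of_bool (y8 \<noteq> y5) + of_bool (y9 \<noteq> y6)"
    and s: "s = of_bool (y0 \<noteq> y5) + of_bool (y1 \<noteq> y6) + of_bool (y2 \<noteq> y7) + of_bool (y3 \<noteq> y8) + of_bool (y4 \<noteq> y9)"
  shows "(odd t \<longrightarrow> c \<ge> 2 \<and> s \<ge> 1 \<or> s \<ge> 3) \<and> (t \<noteq> 0 \<and> t \<noteq> 10 \<longrightarrow> c + s \<ge> 3)"
  unfolding t c s
  by (cases y0; cases y1; cases y2; cases y3; cases y4; cases y5; cases y6; cases y7; cases y8; cases y9; simp)

lemma fat_petersen_simps:
  "verts (fat_petersen m) = {..<10}"
  "edges (fat_petersen m) = {(p, k). p < 15 \<and> k < mult m p}"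
  "ends (fat_petersen m) e = pos_ends (fst e)"
  by (simp_all add: fat_petersen_def)

lemma graph_fat_petersen: "graph (fat_petersen m)"
proof -
  have "finite {(p, k). p < 15 \<and> k < mult m p}"
    by (rule finite_subset[of _ "{..<15} \<times> {..<Suc m}"]) (auto simp: mult_def split: if_splits)
  then show ?thesis using pos_ends_card by (auto simp: graph_def fat_petersen_simps)
qed

lemma fat_petersen_boundary:
  "boundary (fat_petersen m) Y = Sigma {p. p < 15 \<and> card (pos_ends p \<inter> Y) = 1} (\<lambda>p. {..<mult m p})"
  by (auto simp: boundary_def fat_petersen_simps)

lemma card_fat_petersen_boundary:
  "card (boundary (fat_petersen m) Y) = (\<Sum>p<15. of_bool (card (pos_ends p \<inter> Y) = 1) * mult m p)"
proof -
  have "card (boundary (fat_petersen m) Y) = (\<Sum>p\<in>{p. p < 15 \<and> card (pos_ends p \<inter> Y) = 1}. mult m p)"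
    by (simp add: fat_petersen_boundary)
  also have "\<dots> = (\<Sum>p\<in>{p\<in>{..<15}. card (pos_ends p \<inter> Y) = 1}. mult m p)" by (rule sum.cong) auto
  also have "\<dots> = (\<Sum>p<15. if card (pos_ends p \<inter> Y) = 1 then mult m p else 0)" by (rule sum.inter_filter) simp
  also have "\<dots> = (\<Sum>p<15. of_bool (card (pos_ends p \<inter> Y) = 1) * mult m p)" by (rule sum.cong) auto
  finally show ?thesis .
qed

lemma card_doubleton_Int: "a \<noteq> b \<Longrightarrow> card ({a, b} \<inter> Y) = 1 \<longleftrightarrow> (a \<in> Y) \<noteq> (b \<in> Y)"
  by (cases "a \<in> Y"; cases "b \<in> Y") auto

lemma sum_less_15: "(\<Sum>p<15. f p) = f 0 + f 1 + f 2 + f 3 + f 4 + f 5 + f 6 + f 7 + f 8 + f 9 + f 10 + f 11 + f 12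
  + f 13 + f (14::nat)" for f :: "nat \<Rightarrow> nat"
  by (simp add: numeral_eq_Suc lessThan_Suc)

lemma fat_petersen_cut:
  assumes m: "m \<ge> 1" and Y: "Y \<subseteq> {..<10}"
  shows "odd (card Y) \<Longrightarrow> m + 2 \<le> card (boundary (fat_petersen m) Y)"
    and "Y \<noteq> {} \<Longrightarrow> Y \<noteq> {..<10} \<Longrightarrow> 3 \<le> card (boundary (fat_petersen m) Y)"
proof -
  define c :: nat where "c = of_bool ((0 \<in> Y) \<noteq> (1 \<in> Y)) + of_bool ((1 \<in> Y) \<noteq> (2 \<in> Y)) + of_bool ((2 \<in> Y) \<noteq> (3 \<in> Y))
    + of_bool ((3 \<in> Y) \<noteq> (4 \<in> Y)) + of_bool ((4 \<in> Y) \<noteq> (0 \<in> Y)) + of_bool ((5 \<in> Y) \<noteq> (7 \<in> Y)) + of_bool ((6 \<in> Y) \<noteq> (8 \<in> Y))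
    + of_bool ((7 \<in> Y) \<noteq> (9 \<in> Y)) + of_bool ((8 \<in> Y) \<noteq> (5 \<in> Y)) + of_bool ((9 \<in> Y) \<noteq> (6 \<in> Y))"
  define s :: nat where "s = of_bool ((0 \<in> Y) \<noteq> (5 \<in> Y)) + of_bool ((1 \<in> Y) \<noteq> (6 \<in> Y)) + of_bool ((2 \<in> Y) \<noteq> (7 \<in> Y))
    + of_bool ((3 \<in> Y) \<noteq> (8 \<in> Y)) + of_bool ((4 \<in> Y) \<noteq> (9 \<in> Y))"
  have "Y = {i. i < 10 \<and> i \<in> Y}" using Y by auto
  then have t: "card Y = of_bool (0 \<in> Y) + of_bool (1 \<in> Y) + of_bool (2 \<in> Y) + of_bool (3 \<in> Y) + of_bool (4 \<in> Y)
    + of_bool (5 \<in> Y) + of_bool (6 \<in> Y) + of_bool (7 \<in> Y) + of_bool (8 \<in> Y) + of_bool (9 \<in> Y)"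
    using card_of_bool[of "\<lambda>i. i \<in> Y"] by simp
  have b: "card (boundary (fat_petersen m) Y) = c + s * m"
    unfolding card_fat_petersen_boundary sum_less_15 c_def s_def
    by (simp add: pos_ends_def mult_def card_doubleton_Int[unfolded One_nat_def] distrib_right flip: numeral_2_eq_2)
  have "(odd (card Y) \<longrightarrow> c \<ge> 2 \<and> s \<ge> 1 \<or> s \<ge> 3) \<and> (card Y \<noteq> 0 \<and> card Y \<noteq> 10 \<longrightarrow> c + s \<ge> 3)"
    by (rule petersen_cut_bool[OF t c_def s_def])
  note * = this
  have sm: "s \<le> s * m" using m by simp
  { assume "odd (card Y)"
    then consider "c \<ge> 2" "s \<ge> 1" | "s \<ge> 3" using * by blast
    then show "m + 2 \<le> card (boundary (fat_petersen m) Y)"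
    proof cases
      case 1
      have "m \<le> s * m" using mult_le_mono1[OF 1(2), of m] by simp
      then show ?thesis using 1 b by linarith
    next
      case 2
      then have "3 * m \<le> s * m" by (rule mult_le_mono1)
      then show ?thesis using m b by linarith
    qed }
  { assume "Y \<noteq> {}" "Y \<noteq> {..<10}"
    then have "card Y \<noteq> 0" "card Y \<noteq> 10"
      using Y card_subset_eq[of "{..<10}" Y] finite_subset[OF Y] by auto
    then show "3 \<le> card (boundary (fat_petersen m) Y)" using * sm b by linarith }
qed

lemma r_graph_fat_petersen:
  assumes m: "m \<ge> 1"
  shows "r_graph (m + 2) (fat_petersen m)"
proof -
  have "card (boundary (fat_petersen m) {v}) = m + 2" if "v < 10" for v
  proof -
    have "\<forall>v<10. card (boundary (fat_petersen m) {v}) = m + 2"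
      unfolding all_less_10 card_fat_petersen_boundary sum_less_15
      by (simp add: pos_ends_def mult_def)
    then show ?thesis using that by simp
  qed
  then show ?thesis
    using graph_fat_petersen fat_petersen_cut(1)[OF m]
    by (simp add: r_graph_def regular_graph_def fat_petersen_simps)
qed

lemma connected_fat_petersen:
  assumes m: "m \<ge> 1"
  shows "connected_graph (fat_petersen m)"
  unfolding connected_graph_iff_boundary[OF graph_fat_petersen] fat_petersen_simps(1)
proof (intro conjI allI impI)
  show "{..<10::nat} \<noteq> {}" using lessThan_iff[of 0 "10::nat"] by (metis empty_iff zero_less_numeral)
  fix X :: "nat set" assume "X \<subseteq> {..<10} \<and> X \<noteq> {} \<and> X \<noteq> {..<10}"
  then have "3 \<le> card (boundary (fat_petersen m) X)" using fat_petersen_cut(2)[OF m] by simp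
  then show "boundary (fat_petersen m) X \<noteq> {}" by (metis card.empty not_numeral_le_zero)
qed

section \<open>Colouring a fat Petersen graph with one edge cut open\<close>

text \<open>A fixed choice of one end of each position, at which the colour of an edge is read
  off.\<close>

definition pos_src :: "nat \<Rightarrow> nat" where
  "pos_src p = (if p < 10 then p else p - 10)"

lemma pos_src_in: "p < 15 \<Longrightarrow> pos_src p \<in> pos_ends p \<and> pos_src p < 10"
  by (auto simp: pos_src_def pos_ends_def)

lemma fat_petersen_star:
  "(p, k) \<in> boundary (fat_petersen m) {i} \<longleftrightarrow> p < 15 \<and> k < mult m p \<and> i \<in> pos_ends p"
  unfolding boundary_vertex[OF graph_fat_petersen] by (auto simp: fat_petersen_simps)

text \<open>The fat Petersen graph with the edge \<open>(0, 0)\<close> cut into two half-edges is coloured by \<open>K\<close>: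
  \<open>lab i g\<close> is the colour of \<open>g\<close> at its end \<open>i\<close>. The two halves may get different colours, as long
  as no perfect matching of \<open>K\<close> separates these colours.\<close>

locale gadget_coloring =
  fixes K :: "('w, 'f) multigraph" and m :: nat and \<phi> :: "nat \<Rightarrow> 'w" and lab :: "nat \<Rightarrow> nat \<times> nat \<Rightarrow> 'f"
  assumes rK: "r_graph (m + 2) K" and m: "m \<ge> 1"
    and phi: "i < 10 \<Longrightarrow> \<phi> i \<in> verts K"
    and bij: "i < 10 \<Longrightarrow> bij_betw (lab i) (boundary (fat_petersen m) {i}) (boundary K {\<phi> i})"
    and inner: "g \<in> edges (fat_petersen m) \<Longrightarrow> g \<noteq> (0, 0) \<Longrightarrow> i \<in> pos_ends (fst g) \<Longrightarrow> j \<in> pos_ends (fst g)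
      \<Longrightarrow> lab i g = lab j g"
    and outer: "perfect_matching K N \<Longrightarrow> lab 0 (0, 0) \<in> N \<longleftrightarrow> lab 1 (0, 0) \<in> N"
begin

lemma gK: "graph K"
  using rK by (simp add: r_graph_def)

lemma lab_in: "p < 15 \<Longrightarrow> k < mult m p \<Longrightarrow> i \<in> pos_ends p \<Longrightarrow> lab i (p, k) \<in> boundary K {\<phi> i}"
  using bij[of i] fat_petersen_star[of p k m i] pos_ends_card[of p] by (auto simp: bij_betw_def)

lemma lab_inj: "lab i (p, k) = lab i (q, l) \<Longrightarrow> p < 15 \<Longrightarrow> k < mult m p \<Longrightarrow> i \<in> pos_ends p
  \<Longrightarrow> q < 15 \<Longrightarrow> l < mult m q \<Longrightarrow> i \<in> pos_ends q \<Longrightarrow> p = q \<and> k = l"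
  using bij[of i] fat_petersen_star[of p k m i] fat_petersen_star[of q l m i] pos_ends_card[of p]
  by (auto simp: bij_betw_def inj_on_def)

lemma lab_surj:
  assumes "a \<in> boundary K {\<phi> i}" "i < 10"
  shows "\<exists>p k. p < 15 \<and> k < mult m p \<and> i \<in> pos_ends p \<and> a = lab i (p, k)"
proof -
  obtain g where g: "g \<in> boundary (fat_petersen m) {i}" "a = lab i g"
    using bij_betw_imp_surj_on[OF bij[OF assms(2)]] assms(1) by blast
  obtain p k where "g = (p, k)" by (cases g)
  then show ?thesis using g fat_petersen_star[of p k m i] by blast
qed

lemma lab_mem_iff:
  assumes "perfect_matching K N" "p < 15" "k < mult m p" "i \<in> pos_ends p" "j \<in> pos_ends p"
  shows "lab i (p, k) \<in> N \<longleftrightarrow> lab j (p, k) \<in> N"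
proof (cases "(p, k) = (0, 0)")
  case True
  then have "i = 0 \<or> i = 1" "j = 0 \<or> j = 1" using assms(4,5) by (auto simp: pos_ends_def)
  then show ?thesis using outer[OF assms(1)] True by auto
next
  case False
  then show ?thesis using inner[of "(p, k)" i j] assms by (simp add: fat_petersen_simps)
qed

text \<open>For a perfect matching \<open>N\<close> the choice of the end is immaterial, by
  \<open>lab_mem_iff\<close>. At a spoke the predicate does not reveal which of the \<open>m\<close>
  parallel copies is used.\<close>

definition used :: "'f set \<Rightarrow> nat \<Rightarrow> bool" where
  "used N p \<longleftrightarrow> (\<exists>k<mult m p. lab (pos_src p) (p, k) \<in> N)"

lemma used_iff:
  assumes "perfect_matching K N" "p < 15" "i \<in> pos_ends p"
  shows "used N p \<longleftrightarrow> (\<exists>k<mult m p. lab i (p, k) \<in> N)"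
  unfolding used_def using lab_mem_iff[OF assms(1,2)] assms(3) pos_src_in[OF assms(2)] by blast

text \<open>\<open>N\<close> contains one edge of the star of \<phi> i, and \<open>lab i\<close> is
  a bijection onto this star; so exactly one position at each \<open>i\<close> is used, and the used
  positions form a perfect matching of the Petersen graph.\<close>

lemma used_type:
  assumes N: "perfect_matching K N"
  shows "\<exists>t<6. \<forall>p<15. used N p \<longleftrightarrow> t \<in> types p"
proof (rule perfect_matching_types, intro allI impI)
  fix i :: nat assume i: "i < 10"
  have "card (N \<inter> boundary K {\<phi> i}) = 1" using N phi[OF i] by (simp add: perfect_matching_def)
  then obtain a where a: "N \<inter> boundary K {\<phi> i} = {a}" using card_1_singletonE by blast
  then obtain p k where pk: "p < 15" "k < mult m p" "i \<in> pos_ends p" "a = lab i (p, k)"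
    using lab_surj[of a i] i by blast
  show "\<exists>!p. p < 15 \<and> i \<in> pos_ends p \<and> used N p"
  proof (rule ex1I[of _ p])
    show "p < 15 \<and> i \<in> pos_ends p \<and> used N p" using pk a used_iff[OF N pk(1,3)] by blast
    fix q assume q: "q < 15 \<and> i \<in> pos_ends q \<and> used N q"
    then obtain l where l: "l < mult m q" "lab i (q, l) \<in> N" using used_iff[OF N] by blast
    then have "lab i (q, l) = a" using a lab_in[of q l i] q by blast
    then show "q = p" using lab_inj[of i q l p k] pk q l by simp
  qed
qed

definition present :: "nat \<Rightarrow> bool" where
  "present t \<longleftrightarrow> (\<exists>N. perfect_matching K N \<and> (\<forall>p<15. used N p \<longleftrightarrow> t \<in> types p))"

text \<open>The colour of copy 0 at position \<open>p\<close> lies in some perfect matching of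
  \<open>K\<close>, and the type of that matching contains \<open>p\<close>.\<close>

lemma present_cover: "\<forall>p<15. \<exists>t<6. present t \<and> t \<in> types p"
proof (intro allI impI)
  fix p :: nat assume p: "p < 15"
  have k: "0 < mult m p" using m by (simp add: mult_def)
  have "lab (pos_src p) (p, 0) \<in> edges K"
    using lab_in[OF p k] pos_src_in[OF p] boundary_edge by metis
  then obtain N where N: "perfect_matching K N" "lab (pos_src p) (p, 0) \<in> N"
    using r_graph_edge_in_perfect_matching[OF rK] by auto
  then have u: "used N p" using k by (auto simp: used_def)
  obtain t where t: "t < 6" "\<forall>p<15. used N p \<longleftrightarrow> t \<in> types p" using used_type[OF N(1)] by blast
  then have "present t" using N(1) by (auto simp: present_def)
  then show "\<exists>t<6. present t \<and> t \<in> types p" using t u p by blast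
qed

text \<open>A cycle position has a single copy, so it is used exactly when its colour belongs to
  \<open>N\<close>. For a spoke with parallel copies only one implication survives; if
  \<open>q\<close> has a single copy too, both positions have the same present types and
  coincide.\<close>

lemma same_color_types:
  assumes "lab i (p, 0) = lab j (q, l)" "p < 10" "i \<in> pos_ends p"
    "q < 15" "l < mult m q" "j \<in> pos_ends q"
  shows "\<forall>t<6. present t \<longrightarrow> t \<in> types p \<longrightarrow> t \<in> types q"
    and "q < 10 \<or> m = 1 \<Longrightarrow> p = q"
proof -
  have p15: "p < 15" using assms(2) by simp
  have up: "used N p \<longleftrightarrow> lab i (p, 0) \<in> N" if "perfect_matching K N" for N
    using used_iff[OF that p15 assms(3)] assms(2) by (simp add: mult_def)
  have uq: "lab j (q, l) \<in> N \<Longrightarrow> used N q" if "perfect_matching K N" for N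
    using used_iff[OF that assms(4,6)] assms(5) by blast
  show "\<forall>t<6. present t \<longrightarrow> t \<in> types p \<longrightarrow> t \<in> types q"
    using up uq assms(1,4) p15 unfolding present_def by metis
  assume s: "q < 10 \<or> m = 1"
  have m1: "mult m q = 1" using s by (auto simp: mult_def)
  then have l0: "l = 0" using assms(5) by simp
  have uq': "used N q \<longleftrightarrow> lab j (q, l) \<in> N" if "perfect_matching K N" for N
    using used_iff[OF that assms(4,6)] m1 l0 by simp
  have "\<forall>t<6. present t \<longrightarrow> (t \<in> types p \<longleftrightarrow> t \<in> types q)"
    using up uq' assms(1,4) p15 unfolding present_def by metis
  then show "p = q" using types_distinguish[OF present_cover p15 assms(4)] by blast
qed

text \<open>Compensates for the one-sided information at parallel spokes: all cycle edges that share
  a colour with some copy of the same spoke occupy one position.\<close>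

lemma spoke_same_color_unique:
  assumes "lab i (p, 0) = lab j (q, l)" "p < 10" "i \<in> pos_ends p" "l < mult m q" "j \<in> pos_ends q" "q < 15" "q \<ge> 10"
    and "lab i' (p', 0) = lab j' (q, l')" "p' < 10" "i' \<in> pos_ends p'" "l' < mult m q" "j' \<in> pos_ends q"
  shows "p = p'"
proof (rule types_spoke_unique[OF present_cover assms(2,9)])
  show "q - 10 < 5" using assms(6,7) by simp
  have q: "10 + (q - 10) = q" using assms(7) by simp
  show "\<forall>k<6. present k \<longrightarrow> k \<in> types p \<longrightarrow> k \<in> types (10 + (q - 10))"
    unfolding q by (rule same_color_types(1)[OF assms(1,2,3,6,4,5)])
  show "\<forall>k<6. present k \<longrightarrow> k \<in> types p' \<longrightarrow> k \<in> types (10 + (q - 10))"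
    unfolding q by (rule same_color_types(1)[OF assms(8-10,6,11,12)])
qed

text \<open>The colours of both cycle edges at \<open>i\<close> reappear at \<open>j\<close>. They
  cannot both reappear on copies of the spoke at \<open>j\<close>, so one of them reappears on a
  cycle edge, which must be the same position and thus joins \<open>i\<close> and \<open>j\<close>.
  For \<open>m = 1\<close> this would hold for both cycle edges, although no two positions have the
  same ends.\<close>

lemma phi_eq_cycle:
  assumes ij: "i < 10" "j < 10" "i \<noteq> j" "\<phi> i = \<phi> j"
  shows "\<exists>p<10. pos_ends p = {i, j}" and "m \<ge> 2"
proof -
  obtain p p' where p: "p < 10" "p' < 10" "p \<noteq> p'" "i \<in> pos_ends p" "i \<in> pos_ends p'"
    using pos_ends_cycle_two[OF ij(1)] by blast
  have ex: "\<exists>q l. q < 15 \<and> l < mult m q \<and> j \<in> pos_ends q \<and> lab i (p, 0) = lab j (q, l)"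
    if "p < 10" "i \<in> pos_ends p" for p
    using lab_surj[of "lab i (p, 0)" j] lab_in[of p 0 i] that ij by (simp add: mult_def)
  obtain q l where q: "q < 15" "l < mult m q" "j \<in> pos_ends q" "lab i (p, 0) = lab j (q, l)"
    using ex[OF p(1,4)] by blast
  obtain q' l' where q': "q' < 15" "l' < mult m q'" "j \<in> pos_ends q'" "lab i (p', 0) = lab j (q', l')"
    using ex[OF p(2,5)] by blast
  have 1: "q < 10 \<or> m = 1 \<Longrightarrow> p = q" by (rule same_color_types(2)[OF q(4) p(1,4) q(1-3)])
  have 2: "q' < 10 \<or> m = 1 \<Longrightarrow> p' = q'" by (rule same_color_types(2)[OF q'(4) p(2,5) q'(1-3)])
  have two: "pos_ends p = {i, j}" if "p < 15" "i \<in> pos_ends p" "j \<in> pos_ends p" for p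
  proof -
    have "finite (pos_ends p)" using pos_ends_card[OF that(1)] finite_subset by blast
    then show ?thesis using card_subset_eq[of "pos_ends p" "{i, j}"] that ij(3) pos_ends_card[OF that(1)] by simp
  qed
  have "q < 10 \<or> q' < 10"
  proof (rule ccontr)
    assume "\<not> (q < 10 \<or> q' < 10)"
    then have q10: "q \<ge> 10" "q' \<ge> 10" by auto
    then have "q = q'" using pos_ends_spoke[OF ij(2), of q] pos_ends_spoke[OF ij(2), of q'] q(1,3) q'(1,3) by simp
    then have "p = p'"
      using spoke_same_color_unique[of i p j q l i p' j l'] p q q' q10 by simp
    then show False using p by simp
  qed
  then have "(q = p \<and> q < 10) \<or> (q' = p' \<and> q' < 10)" using 1 2 by blast
  then show "\<exists>p<10. pos_ends p = {i, j}"
  proof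
    assume "q = p \<and> q < 10"
    then have "pos_ends p = {i, j}" using two[of p] p q by simp
    then show ?thesis using p(1) by blast
  next
    assume "q' = p' \<and> q' < 10"
    then have "pos_ends p' = {i, j}" using two[of p'] p q' by simp
    then show ?thesis using p(2) by blast
  qed
  show "m \<ge> 2"
  proof (rule ccontr)
    assume "\<not> m \<ge> 2"
    then have "m = 1" using m by simp
    then have "p = q" "p' = q'" using 1 2 by auto
    then have "pos_ends p = {i, j}" "pos_ends p' = {i, j}" using two p q q' by auto
    then show False using pos_ends_inj[of p p' i j] p ij by simp
  qed
qed

lemma phi_inj: "inj_on \<phi> {..<10}"
proof (rule inj_onI, rule ccontr)
  fix i j :: nat assume "i \<in> {..<10}" "j \<in> {..<10}" and eq: "\<phi> i = \<phi> j" and ne: "i \<noteq> j"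
  then have i: "i < 10" and j: "j < 10" by auto
  obtain p where p: "p < 10" "pos_ends p = {i, j}" using phi_eq_cycle(1)[OF i j ne eq] by blast
  have m2: "m \<ge> 2" using phi_eq_cycle(2)[OF i j ne eq] .
  define i' j' where "i' = (i + 5) mod 10" and "j' = (j + 5) mod 10"
  have l': "i' < 10" "j' < 10" by (auto simp: i'_def j'_def)
  have mod: "i mod 5 \<noteq> j mod 5" using pos_ends_partner[OF p p(1)] by blast
  have ne': "i' \<noteq> j'" "i \<noteq> j'" "j \<noteq> i'" "i \<noteq> i'"
  proof -
    have "i' mod 5 = i mod 5" "j' mod 5 = j mod 5"
      by (simp_all add: i'_def j'_def mod_mod_cancel)
    then show "i' \<noteq> j'" "i \<noteq> j'" "j \<noteq> i'" using mod by auto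
    show "i \<noteq> i'" using i by (cases "i < 5") (auto simp: i'_def mod_if)
  qed
  have p': "pos_ends p = {j, i}" using p(2) by (simp add: insert_commute)
  \<comment> \<open>None of these pairs is joined by a cycle edge, so \<open>phi_eq_cycle\<close>
    keeps their images apart. As \<phi> i = \<phi> j, the last inequality also separates \<phi> i
    from the image of its own partner.\<close>
  have c: "\<phi> i' \<noteq> \<phi> j'" "\<phi> i \<noteq> \<phi> j'" "\<phi> j \<noteq> \<phi> i'"
  proof -
    show "\<phi> i' \<noteq> \<phi> j'"
      using phi_eq_cycle(1)[OF l' ne'(1)] pos_ends_partner[OF p] by (auto simp: i'_def j'_def)
    show "\<phi> i \<noteq> \<phi> j'"
      using phi_eq_cycle(1)[OF i l'(2) ne'(2)] pos_ends_partner[OF p] by (auto simp: j'_def)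
    show "\<phi> j \<noteq> \<phi> i'"
      using phi_eq_cycle(1)[OF j l'(1) ne'(3)] pos_ends_partner[OF p(1) p'] by (auto simp: i'_def)
  qed
  let ?s = "10 + i mod 5"
  have s: "?s < 15" "pos_ends ?s = {i, i'}" "mult m ?s = m"
    using pos_ends_spoke_eq[OF i] by (auto simp: i'_def mult_def)
  let ?u = "10 + j mod 5"
  have u: "?u < 15" "pos_ends ?u = {j, j'}" "mult m ?u = m"
    using pos_ends_spoke_eq[OF j] by (auto simp: j'_def mult_def)
  have ex: "\<exists>q l. q < 15 \<and> l < mult m q \<and> j \<in> pos_ends q \<and> lab i (?s, k) = lab j (q, l)" if "k < m" for k
    using lab_surj[of "lab i (?s, k)" j] lab_in[of ?s k i] that s eq j by simp
  obtain q l where q: "q < 15" "l < mult m q" "j \<in> pos_ends q" "lab i (?s, 0) = lab j (q, l)"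
    using ex[of 0] m2 by auto
  obtain q' l' where q': "q' < 15" "l' < mult m q'" "j \<in> pos_ends q'" "lab i (?s, 1) = lab j (q', l')"
    using ex[of 1] m2 by auto
  \<comment> \<open>Two parallel spokes at \<open>i\<close> cannot both be coloured like cycle edges at \<open>j\<close>, so some spoke at \<open>i\<close> and
    some spoke at \<open>j\<close> share a colour, whose two ends would have to cover three distinct vertices.\<close>
  have "q \<ge> 10 \<or> q' \<ge> 10"
  proof (rule ccontr)
    assume "\<not> (q \<ge> 10 \<or> q' \<ge> 10)"
    then have q10: "q < 10" "q' < 10" by auto
    then have l0: "l = 0" "l' = 0" using q(2) q'(2) by (auto simp: mult_def)
    have "q = q'"
      using spoke_same_color_unique[of j q i ?s 0 j q' i 1] q q' q10 l0 s m2 by simp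
    then have "lab i (?s, 0) = lab i (?s, 1)" using q(4) q'(4) l0 by simp
    then show False using lab_inj[of i ?s 0 ?s 1] s m2 by simp
  qed
  then have "\<exists>k l. k < m \<and> l < m \<and> lab i (?s, k) = lab j (?u, l)"
  proof
    assume "q \<ge> 10"
    then have "q = ?u" using pos_ends_spoke[OF j, of q] q by simp
    then show ?thesis using q u m2 by (intro exI[of _ 0] exI[of _ l]) simp
  next
    assume "q' \<ge> 10"
    then have "q' = ?u" using pos_ends_spoke[OF j, of q'] q' by simp
    then show ?thesis using q' u m2 by (intro exI[of _ 1] exI[of _ l']) simp
  qed
  then obtain k l where kl: "k < m" "l < m" "lab i (?s, k) = lab j (?u, l)" by blast
  let ?a = "lab i (?s, k)"
  have "lab i (?s, k) = lab i' (?s, k)" "lab j (?u, l) = lab j' (?u, l)"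
    using inner[of "(?s, k)" i i'] inner[of "(?u, l)" j j'] s u kl by (simp_all add: fat_petersen_simps)
  then have "?a \<in> boundary K {\<phi> i}" "?a \<in> boundary K {\<phi> i'}" "?a \<in> boundary K {\<phi> j'}"
    using lab_in[of ?s k i] lab_in[of ?s k i'] lab_in[of ?u l j'] s u kl by auto
  then have "{\<phi> i, \<phi> i', \<phi> j'} \<subseteq> ends K ?a" "?a \<in> edges K"
    unfolding boundary_vertex[OF gK] by auto
  moreover have "card {\<phi> i, \<phi> i', \<phi> j'} = 3" using c eq by simp
  moreover have "card (ends K ?a) = 2" "finite (ends K ?a)"
    using gK \<open>?a \<in> edges K\<close> by (auto simp: graph_def intro: card_ge_0_finite)
  ultimately show False using card_mono[of "ends K ?a" "{\<phi> i, \<phi> i', \<phi> j'}"] by simp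
qed

end

section \<open>The image of the gadget in \<open>K\<close>\<close>

context gadget_coloring
begin

abbreviation "W \<equiv> \<phi> ` {..<10}"

text \<open>The disjunction, which recurs below, treats two situations together: an edge that was
  not opened, and an opened edge whose halves happen to receive the same colour.\<close>

lemma lab_eq:
  assumes "p < 15" "k < mult m p" "i \<in> pos_ends p" "j \<in> pos_ends p"
    "(p, k) \<noteq> (0, 0) \<or> lab 0 (0, 0) = lab 1 (0, 0)"
  shows "lab i (p, k) = lab j (p, k)"
proof (cases "(p, k) = (0, 0)")
  case True
  then have "i = 0 \<or> i = 1" "j = 0 \<or> j = 1" using assms(3,4) by (auto simp: pos_ends_def)
  then show ?thesis using True assms(5) by auto
next
  case False
  then show ?thesis using inner[of "(p, k)" i j] assms(1-4) by (simp add: fat_petersen_simps)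
qed

text \<open>The colour belongs to the stars of the images of both ends of \<open>p\<close>. These
  images differ by injectivity, so they are the ends of the colour.\<close>

lemma lab_ends:
  assumes "p < 15" "k < mult m p" "i \<in> pos_ends p"
    "(p, k) \<noteq> (0, 0) \<or> lab 0 (0, 0) = lab 1 (0, 0)"
  shows "ends K (lab i (p, k)) = \<phi> ` pos_ends p"
proof -
  obtain j where j: "pos_ends p = {i, j}" "i \<noteq> j"
    using card_2_other[of "pos_ends p" i] pos_ends_card[OF assms(1)] assms(3) by blast
  then have l: "i < 10" "j < 10" using pos_ends_card[OF assms(1)] by auto
  let ?a = "lab i (p, k)"
  have "?a \<in> boundary K {\<phi> i}" "?a \<in> boundary K {\<phi> j}"
    using lab_in[OF assms(1,2), of i] lab_in[OF assms(1,2), of j] lab_eq[OF assms(1-3) _ assms(4), of j] j by auto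
  then have s: "{\<phi> i, \<phi> j} \<subseteq> ends K ?a" "?a \<in> edges K" unfolding boundary_vertex[OF gK] by auto
  have "\<phi> i \<noteq> \<phi> j" using phi_inj l j(2) by (auto simp: inj_on_def)
  moreover have c: "card (ends K ?a) = 2" using gK s(2) by (auto simp: graph_def)
  moreover have "finite (ends K ?a)" using c by (simp add: card_ge_0_finite)
  ultimately have "{\<phi> i, \<phi> j} = ends K ?a" using card_subset_eq[OF _ s(1)] by simp
  then show ?thesis using j(1) by simp
qed

lemma W_subset: "W \<subseteq> verts K"
  using phi by auto

lemma card_W: "card W = 10"
  using card_image[OF phi_inj] by simp

text \<open>The edge map that goes with \<phi>. At an opened edge \<open>(0, 0)\<close> with
  different halves it returns just the half at 0, so the statements below exclude that case.\<close>

definition \<psi> :: "nat \<times> nat \<Rightarrow> 'f" where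
  "\<psi> g = lab (pos_src (fst g)) g"

lemma psi_ends:
  assumes "g \<in> edges (fat_petersen m)" "g \<noteq> (0, 0) \<or> lab 0 (0, 0) = lab 1 (0, 0)"
  shows "ends K (\<psi> g) = \<phi> ` pos_ends (fst g)" "\<psi> g \<in> edges K"
proof -
  obtain p k where g: "g = (p, k)" by (cases g)
  then have p: "p < 15" "k < mult m p" using assms(1) by (auto simp: fat_petersen_simps)
  show "ends K (\<psi> g) = \<phi> ` pos_ends (fst g)"
    using lab_ends[OF p, of "pos_src p"] pos_src_in[OF p(1)] assms(2) g by (simp add: \<psi>_def)
  show "\<psi> g \<in> edges K"
    using lab_in[OF p, of "pos_src p"] pos_src_in[OF p(1)] boundary_edge g unfolding \<psi>_def by fastforce
qed

text \<open>Equal colours have equal ends, so the edges are parallel; and parallel edges meet in a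
  star, on which \<open>lab\<close> is injective.\<close>

lemma psi_inj: "inj_on \<psi> {g \<in> edges (fat_petersen m). g \<noteq> (0, 0) \<or> lab 0 (0, 0) = lab 1 (0, 0)}"
proof (rule inj_onI)
  fix g h assume g: "g \<in> {g \<in> edges (fat_petersen m). g \<noteq> (0, 0) \<or> lab 0 (0, 0) = lab 1 (0, 0)}"
    and h: "h \<in> {g \<in> edges (fat_petersen m). g \<noteq> (0, 0) \<or> lab 0 (0, 0) = lab 1 (0, 0)}" and eq: "\<psi> g = \<psi> h"
  obtain p k where gp: "g = (p, k)" by (cases g)
  obtain q l where hq: "h = (q, l)" by (cases h)
  have p: "p < 15" "k < mult m p" and q: "q < 15" "l < mult m q"
    using g h gp hq by (auto simp: fat_petersen_simps)
  have "\<phi> ` pos_ends p = \<phi> ` pos_ends q"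
  proof -
    have "g \<in> edges (fat_petersen m)" "g \<noteq> (0, 0) \<or> lab 0 (0, 0) = lab 1 (0, 0)"
      and "h \<in> edges (fat_petersen m)" "h \<noteq> (0, 0) \<or> lab 0 (0, 0) = lab 1 (0, 0)"
      using g h by blast+
    then show ?thesis using psi_ends(1)[of g] psi_ends(1)[of h] eq gp hq by (metis fst_conv)
  qed
  then have pe: "pos_ends p = pos_ends q"
    using inj_on_image_eq_iff[OF phi_inj] pos_ends_card[OF p(1)] pos_ends_card[OF q(1)] by blast
  obtain i j where ij: "pos_ends p = {i, j}" "i \<noteq> j"
    using pos_ends_card[OF p(1)] by (auto simp: card_2_iff)
  have "p = q" by (rule pos_ends_inj[OF p(1) q(1) ij(2)]) (use ij pe in auto)
  then show "g = h"
    using lab_inj[of "pos_src p" p k q l] p q eq pos_src_in[OF p(1)] gp hq by (simp add: \<psi>_def)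
qed

text \<open>If the other end were \<phi> j, the colour would occur among the edges at
  \<open>j\<close>. It cannot be the other half, as the halves differ; any other edge would then
  also be incident with \<open>i\<close> and repeat a colour there.\<close>

lemma half_edge:
  assumes i: "i = 0 \<or> i = 1" and ne: "lab 0 (0, 0) \<noteq> lab 1 (0, 0)"
  shows "\<exists>z. ends K (lab i (0, 0)) = {\<phi> i, z} \<and> z \<notin> W"
proof -
  have z: "(0::nat) < 15" "0 < mult m 0" "0 \<in> pos_ends 0" "1 \<in> pos_ends 0" "pos_ends 0 = {0, 1}"
    by (auto simp: mult_def pos_ends_def)
  have i10: "i < 10" using i by auto
  let ?a = "lab i (0, 0)"
  have a: "?a \<in> boundary K {\<phi> i}" using lab_in[OF z(1,2)] i z(3,4) by auto
  then have aE: "?a \<in> edges K" "\<phi> i \<in> ends K ?a" unfolding boundary_vertex[OF gK] by auto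
  obtain w where w: "ends K ?a = {\<phi> i, w}" "\<phi> i \<noteq> w"
    using card_2_other[of "ends K ?a" "\<phi> i"] aE gK by (auto simp: graph_def)
  have "w \<notin> W"
  proof
    assume "w \<in> W"
    then obtain j where j: "j < 10" "w = \<phi> j" by auto
    have "?a \<in> boundary K {\<phi> j}" unfolding boundary_vertex[OF gK] using aE w j by simp
    then obtain p k where p: "p < 15" "k < mult m p" "j \<in> pos_ends p" "?a = lab j (p, k)"
      using lab_surj j(1) by blast
    show False
    proof (cases "(p, k) = (0, 0)")
      case True
      then have "j = 0 \<or> j = 1" using p(3) by (auto simp: pos_ends_def)
      then show False using True p(4) i j w ne by auto
    next
      case False
      then have "\<phi> i \<in> \<phi> ` pos_ends p" using lab_ends[OF p(1-3)] p(4) w by auto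
      then have ip: "i \<in> pos_ends p"
        using phi_inj i10 pos_ends_card[OF p(1)] inj_on_image_mem_iff[OF phi_inj, of i "pos_ends p"] by auto
      then have "lab i (0, 0) = lab i (p, k)" using lab_eq[OF p(1,2) p(3) ip] False p(4) by metis
      then show False using lab_inj[of i 0 0 p k] z i ip p False by auto
    qed
  qed
  then show ?thesis using w by blast
qed

lemma boundary_W_subset: "boundary K W \<subseteq> {lab 0 (0, 0), lab 1 (0, 0)}"
proof
  fix a assume a: "a \<in> boundary K W"
  obtain u v where uv: "ends K a = {u, v}" "u \<in> W" "v \<notin> W" using boundary_obtain[OF gK a] .
  obtain i where i: "i < 10" "u = \<phi> i" using uv(2) by auto
  have "a \<in> boundary K {\<phi> i}" unfolding boundary_vertex[OF gK] using boundary_edge[OF a] uv i by simp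
  then obtain p k where p: "p < 15" "k < mult m p" "i \<in> pos_ends p" "a = lab i (p, k)"
    using lab_surj i(1) by blast
  have "(p, k) = (0, 0)"
  proof (rule ccontr)
    assume "(p, k) \<noteq> (0, 0)"
    then have "ends K a = \<phi> ` pos_ends p" using lab_ends[OF p(1-3)] p(4) by simp
    then show False using uv(1,3) pos_ends_card[OF p(1)] by blast
  qed
  moreover then have "i = 0 \<or> i = 1" using p(3) by (auto simp: pos_ends_def)
  ultimately show "a \<in> {lab 0 (0, 0), lab 1 (0, 0)}" using p(4) by auto
qed

lemma boundary_W_split:
  assumes ne: "lab 0 (0, 0) \<noteq> lab 1 (0, 0)"
  shows "boundary K W = {lab 0 (0, 0), lab 1 (0, 0)}"
proof -
  have "lab i (0, 0) \<in> boundary K W" if i: "i = 0 \<or> i = 1" for i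
  proof -
    obtain z where z: "ends K (lab i (0, 0)) = {\<phi> i, z}" "z \<notin> W" using half_edge[OF i ne] by blast
    have "lab i (0, 0) \<in> edges K"
      using lab_in[of 0 0 i] i boundary_edge by (auto simp: mult_def pos_ends_def)
    moreover have "\<phi> i \<in> W" using i by auto
    ultimately show ?thesis using mem_boundary[of K "lab i (0, 0)" "\<phi> i" z W] z by auto
  qed
  then show ?thesis using boundary_W_subset by blast
qed

text \<open>The part of \<open>Y\<close> in \<open>W\<close> pulls back to a proper nonempty vertex
  set of the fat Petersen graph, whose cut has at least three edges. All of them except possibly
  \<open>(0, 0)\<close> are mapped injectively into \<open>I\<close>. The bounds are used with
  \<open>Y\<close> the image of another gadget, which is bounded by two edges only.\<close>

lemma W_crossing:
  assumes "W \<inter> Y \<noteq> {}" "\<not> W \<subseteq> Y"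
  defines "I \<equiv> {a \<in> boundary K Y. ends K a \<subseteq> W}"
  shows "2 \<le> card I" and "(\<phi> 0 \<in> Y) = (\<phi> 1 \<in> Y) \<Longrightarrow> 3 \<le> card I"
proof -
  define X where "X = {i. i < 10 \<and> \<phi> i \<in> Y}"
  have X: "X \<subseteq> {..<10}" "X \<noteq> {}" "X \<noteq> {..<10}" using assms(1,2) by (auto simp: X_def)
  let ?B = "boundary (fat_petersen m) X"
  have B3: "3 \<le> card ?B" using fat_petersen_cut(2)[OF m X] .
  have fB: "finite ?B" using finite_boundary[OF graph_fat_petersen] .
  have fI: "finite I" using finite_boundary[OF gK, of Y] by (simp add: I_def)
  have img: "\<psi> ` (?B - {(0, 0)}) \<subseteq> I"
  proof
    fix a assume "a \<in> \<psi> ` (?B - {(0, 0)})"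
    then obtain g where g: "g \<in> ?B" "g \<noteq> (0, 0)" "a = \<psi> g" by blast
    obtain u v where uv: "pos_ends (fst g) = {u, v}" "u \<in> X" "v \<notin> X" "u < 10" "v < 10"
      using boundary_obtain[OF graph_fat_petersen g(1)] by (metis fat_petersen_simps(1,3) lessThan_iff)
    have e: "ends K a = {\<phi> u, \<phi> v}" "a \<in> edges K"
      using psi_ends[OF boundary_edge[OF g(1)]] g uv by auto
    have "\<phi> u \<in> Y" "\<phi> v \<notin> Y" using uv by (auto simp: X_def)
    then have "a \<in> boundary K Y" using mem_boundary[OF e(1), of Y] e(2) by metis
    then show "a \<in> I" using e uv by (simp add: I_def)
  qed
  have "inj_on \<psi> (?B - {(0, 0)})"
    by (rule inj_on_subset[OF psi_inj]) (auto dest: boundary_edge)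
  then have c: "card (?B - {(0, 0)}) \<le> card I" using card_inj_on_le img fI by blast
  have "card ?B \<le> card (?B - {(0, 0)}) + 1" 
    using card.remove[OF fB, of "(0, 0)"] by (cases "(0, 0) \<in> ?B") simp_all
  then show "2 \<le> card I" using c B3 by simp
  assume eq: "(\<phi> 0 \<in> Y) = (\<phi> 1 \<in> Y)"
  have "(0, 0) \<notin> ?B"
    using mem_boundary[of "fat_petersen m" "(0, 0)" 0 1 X] eq by (auto simp: fat_petersen_simps pos_ends_def X_def)
  then have "?B - {(0, 0)} = ?B" by simp
  then show "3 \<le> card I" using c B3 by simp
qed

section \<open>Halves of equal colour: \<open>K\<close> is a fat Petersen graph\<close>

context
  assumes eq: "lab 0 (0, 0) = lab 1 (0, 0)" and conn: "connected_graph K"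
begin

text \<open>With equal halves every colour at a vertex of \<open>W\<close> has both ends in
  \<open>W\<close>, so connectivity leaves nothing outside.\<close>

lemma W_all: "W = verts K"
proof (rule ccontr)
  assume ne: "W \<noteq> verts K"
  have "boundary K W = {}"
  proof (rule equals0I)
    fix a assume a: "a \<in> boundary K W"
    then have "a = lab 0 (0, 0)" using boundary_W_subset eq by auto
    then have "ends K a = \<phi> ` pos_ends 0" using lab_ends[of 0 0 0] eq by (simp add: mult_def pos_ends_def)
    then have "ends K a \<subseteq> W" by (auto simp: pos_ends_def)
    then show False using boundary_obtain[OF gK a] by (metis insert_subset)
  qed
  moreover have "W \<noteq> {}" using card_W by force
  ultimately show False using conn W_subset ne connected_graph_iff_boundary[OF gK] by blast
qed

lemma psi_surj: "a \<in> edges K \<Longrightarrow> \<exists>g\<in>edges (fat_petersen m). a = \<psi> g"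
proof -
  assume a: "a \<in> edges K"
  obtain u v where uv: "ends K a = {u, v}" "u \<in> verts K" using ends_obtain[OF gK a] .
  obtain i where i: "i < 10" "u = \<phi> i" using uv(2) W_all by auto
  have "a \<in> boundary K {\<phi> i}" unfolding boundary_vertex[OF gK] using a uv i by simp
  then obtain p k where p: "p < 15" "k < mult m p" "i \<in> pos_ends p" "a = lab i (p, k)"
    using lab_surj i(1) by blast
  have "a = \<psi> (p, k)" using lab_eq[OF p(1-3)] pos_src_in[OF p(1)] eq p(4) by (simp add: \<psi>_def)
  then show ?thesis using p by (auto simp: fat_petersen_simps)
qed

lemma fat_petersen_isomorphic: "isomorphic (fat_petersen m) K"
  unfolding isomorphic_def
proof (intro exI conjI ballI)
  show "bij_betw \<phi> (verts (fat_petersen m)) (verts K)"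
    using phi_inj W_all by (simp add: bij_betw_def fat_petersen_simps)
  show "bij_betw \<psi> (edges (fat_petersen m)) (edges K)"
    using psi_inj psi_surj psi_ends(2) eq by (auto simp: bij_betw_def)
  fix e assume "e \<in> edges (fat_petersen m)"
  then show "ends K (\<psi> e) = \<phi> ` ends (fat_petersen m) e"
    using psi_ends(1) eq by (simp add: fat_petersen_simps)
qed

text \<open>The opened edge lies on a cycle, where multiplicities are 1. Against
  \<open>parallel_at\<close>, this later rules out \<open>m \<ge> 2\<close>.\<close>

lemma no_parallel:
  assumes "a \<in> edges K" "ends K a = ends K (lab 0 (0, 0))"
  shows "a = lab 0 (0, 0)"
proof -
  obtain g where g: "g \<in> edges (fat_petersen m)" "a = \<psi> g" using psi_surj[OF assms(1)] by blast
  obtain p k where pk: "g = (p, k)" by (cases g)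
  then have p: "p < 15" "k < mult m p" using g by (auto simp: fat_petersen_simps)
  have "\<phi> ` pos_ends p = \<phi> ` pos_ends 0"
    using assms(2) psi_ends(1)[OF g(1)] lab_ends[of 0 0 0] eq g(2) pk by (simp add: mult_def pos_ends_def)
  then have "pos_ends p = pos_ends 0"
    using inj_on_image_eq_iff[OF phi_inj] pos_ends_card[OF p(1)] pos_ends_card[of 0] by simp
  then have "p = 0" using pos_ends_inj[of p 0 0 1] p by (simp add: pos_ends_def)
  then show ?thesis using g pk p by (simp add: \<psi>_def mult_def pos_src_def)
qed

lemma parallel_at:
  assumes "m \<ge> 2" "u \<in> verts K"
  shows "\<exists>a\<in>boundary K {u}. \<exists>b\<in>edges K. a \<noteq> b \<and> ends K b = ends K a"
proof -
  obtain i where i: "i < 10" "u = \<phi> i" using assms(2) W_all by auto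
  let ?s = "10 + i mod 5"
  have s: "?s < 15" "i \<in> pos_ends ?s" "mult m ?s = m"
    using pos_ends_spoke_eq[OF i(1)] by (auto simp: mult_def)
  have l: "0 < mult m ?s" "1 < mult m ?s" using assms(1) s(3) by simp_all
  have "lab i (?s, 0) \<noteq> lab i (?s, 1)" using lab_inj[of i ?s 0 ?s 1] s l by auto
  moreover have "ends K (lab i (?s, 1)) = ends K (lab i (?s, 0))"
    using lab_ends[OF s(1) l(1) s(2)] lab_ends[OF s(1) l(2) s(2)] eq by simp
  moreover have "lab i (?s, 0) \<in> boundary K {u}" "lab i (?s, 1) \<in> edges K"
    using lab_in[OF s(1) l(1) s(2)] boundary_edge[OF lab_in[OF s(1) l(2) s(2)]] i(2) by auto
  ultimately show ?thesis by blast
qed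

end

end

section \<open>Inflating the edges of a graph\<close>

text \<open>An arbitrary orientation, which decides to which end of \<open>x\<close> each half of
  the opened edge is attached.\<close>

definition tail :: "('v, 'e) multigraph \<Rightarrow> 'e \<Rightarrow> 'v" where
  "tail G x = (SOME s. s \<in> ends G x)"

definition head :: "('v, 'e) multigraph \<Rightarrow> 'e \<Rightarrow> 'v" where
  "head G x = (SOME t. t \<in> ends G x \<and> t \<noteq> tail G x)"

lemma tail_head:
  assumes "graph G" "x \<in> edges G"
  shows "ends G x = {tail G x, head G x}" "tail G x \<noteq> head G x" "tail G x \<in> verts G" "head G x \<in> verts G"
proof -
  obtain u v where uv: "ends G x = {u, v}" "u \<noteq> v" "u \<in> verts G" "v \<in> verts G"
    using ends_obtain[OF assms] .
  have "\<exists>s. s \<in> ends G x" using uv(1) by blast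
  then have t: "tail G x \<in> ends G x" unfolding tail_def by (rule someI_ex)
  then have "\<exists>w. w \<in> ends G x \<and> w \<noteq> tail G x" using uv(1,2) by auto
  then have h: "head G x \<in> ends G x \<and> head G x \<noteq> tail G x" unfolding head_def by (rule someI_ex)
  show "ends G x = {tail G x, head G x}" "tail G x \<noteq> head G x" "tail G x \<in> verts G" "head G x \<in> verts G"
    using t h uv by auto
qed

text \<open>As the fat Petersen graph has no edges \<open>(15, 0)\<close> and \<open>(16, 0)\<close>, these names serve for the two halves
  of its edge \<open>(0, 0)\<close>.\<close>

definition inflate :: "nat \<Rightarrow> ('v, 'e) multigraph \<Rightarrow> ('v + 'e \<times> nat, 'e \<times> nat \<times> nat) multigraph" where
  "inflate m G = \<lparr>
     verts = Inl ` verts G \<union> Inr ` (edges G \<times> {..<10}),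
     edges = edges G \<times> (edges (fat_petersen m) - {(0, 0)} \<union> {(15, 0), (16, 0)}),
     ends = (\<lambda>(x, g). if g = (15, 0) then {Inl (tail G x), Inr (x, 0)}
       else if g = (16, 0) then {Inl (head G x), Inr (x, 1)}
       else (\<lambda>i. Inr (x, i)) ` pos_ends (fst g))\<rparr>"

lemma inflate_simps:
  "verts (inflate m G) = Inl ` verts G \<union> Inr ` (edges G \<times> {..<10})"
  "edges (inflate m G) = edges G \<times> (edges (fat_petersen m) - {(0, 0)} \<union> {(15, 0), (16, 0)})"
  "ends (inflate m G) (x, (15, 0)) = {Inl (tail G x), Inr (x, 0)}"
  "ends (inflate m G) (x, (16, 0)) = {Inl (head G x), Inr (x, 1)}"
  "g \<in> edges (fat_petersen m) \<Longrightarrow> ends (inflate m G) (x, g) = (\<lambda>i. Inr (x, i)) ` pos_ends (fst g)"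
  by (auto simp: inflate_def fat_petersen_simps)

lemma inflate_edge_cases:
  assumes "e \<in> edges (inflate m G)"
  obtains x where "x \<in> edges G" "e = (x, (15, 0))" | x where "x \<in> edges G" "e = (x, (16, 0))"
    | x g where "x \<in> edges G" "g \<in> edges (fat_petersen m)" "g \<noteq> (0, 0)" "e = (x, g)"
  using assms unfolding inflate_simps by blast

lemma graph_inflate:
  assumes G: "graph G"
  shows "graph (inflate m G)"
  unfolding graph_def
proof (intro conjI ballI)
  have f: "finite (verts G)" "finite (edges G)" using G by (auto simp: graph_def)
  show "finite (verts (inflate m G))" using f by (simp add: inflate_simps)
  have "finite (edges (fat_petersen m))" using graph_fat_petersen by (auto simp: graph_def)
  then show "finite (edges (inflate m G))" using f by (simp add: inflate_simps)
  fix e assume e: "e \<in> edges (inflate m G)"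
  show "ends (inflate m G) e \<subseteq> verts (inflate m G)" "card (ends (inflate m G) e) = 2"
    using e
  proof (atomize(full), cases rule: inflate_edge_cases)
    case (1 x)
    then show "ends (inflate m G) e \<subseteq> verts (inflate m G) \<and> card (ends (inflate m G) e) = 2"
      using tail_head[OF G 1(1)] by (simp add: inflate_simps)
  next
    case (2 x)
    then show "ends (inflate m G) e \<subseteq> verts (inflate m G) \<and> card (ends (inflate m G) e) = 2"
      using tail_head[OF G 2(1)] by (simp add: inflate_simps)
  next
    case (3 x g)
    then have p: "fst g < 15" by (auto simp: fat_petersen_simps)
    have "card ((\<lambda>i. Inr (x, i)) ` pos_ends (fst g) :: ('a + 'b \<times> nat) set) = card (pos_ends (fst g))"
      by (rule card_image) (auto simp: inj_on_def)
    then show "ends (inflate m G) e \<subseteq> verts (inflate m G) \<and> card (ends (inflate m G) e) = 2"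
      using 3 pos_ends_card[OF p] by (auto simp: inflate_simps)
  qed
qed

text \<open>The edge that takes the place of \<open>x\<close> at the original vertex
  \<open>v\<close>; meaningful only when \<open>v\<close> is an end of \<open>x\<close>.\<close>

definition link :: "('v, 'e) multigraph \<Rightarrow> 'v \<Rightarrow> 'e \<Rightarrow> 'e \<times> nat \<times> nat" where
  "link G v x = (if v = tail G x then (x, (15, 0)) else (x, (16, 0)))"

text \<open>Translates edges of the closed gadget, as seen from its vertex \<open>i\<close>, into
  edges of the inflated graph. Only \<open>(0, 0)\<close> depends on \<open>i\<close>: it becomes
  the half attached to \<open>i\<close>.\<close>

definition gadget_edge :: "'e \<Rightarrow> nat \<Rightarrow> nat \<times> nat \<Rightarrow> 'e \<times> nat \<times> nat" where
  "gadget_edge x i g = (if g = (0, 0) then if i = 0 then (x, (15, 0)) else (x, (16, 0)) else (x, g))"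

lemma link_bij:
  assumes G: "graph G"
  shows "bij_betw (link G v) (boundary G {v}) (boundary (inflate m G) {Inl v})"
  unfolding bij_betw_def
proof
  show "inj_on (link G v) (boundary G {v})" by (auto simp: inj_on_def link_def split: if_splits)
  show "link G v ` boundary G {v} = boundary (inflate m G) {Inl v}"
    unfolding boundary_vertex[OF G] boundary_vertex[OF graph_inflate[OF G]]
  proof (intro equalityI subsetI)
    fix e assume "e \<in> link G v ` {e \<in> edges G. v \<in> ends G e}"
    then obtain x where x: "x \<in> edges G" "v \<in> ends G x" "e = link G v x" by blast
    then have "v = tail G x \<or> v = head G x" using tail_head(1)[OF G x(1)] by auto
    then show "e \<in> {e \<in> edges (inflate m G). Inl v \<in> ends (inflate m G) e}"
      using x tail_head(2)[OF G x(1)] by (auto simp: link_def inflate_simps)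
  next
    fix e assume "e \<in> {e \<in> edges (inflate m G). Inl v \<in> ends (inflate m G) e}"
    then have e: "e \<in> edges (inflate m G)" "Inl v \<in> ends (inflate m G) e" by auto
    from e(1) show "e \<in> link G v ` {e \<in> edges G. v \<in> ends G e}"
    proof (cases rule: inflate_edge_cases)
      case (1 x)
      then have "v = tail G x" using e(2) by (simp add: inflate_simps)
      then show ?thesis using 1 tail_head[OF G 1(1)] by (intro image_eqI[of _ _ x]) (auto simp: link_def)
    next
      case (2 x)
      then have "v = head G x" using e(2) by (simp add: inflate_simps)
      then show ?thesis using 2 tail_head[OF G 2(1)] by (intro image_eqI[of _ _ x]) (auto simp: link_def)
    next
      case (3 x g)
      then show ?thesis using e(2) by (auto simp: inflate_simps)
    qed
  qed
qed

lemma gadget_edge_bij: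
  assumes G: "graph G" and m: "m \<ge> 1" and x: "x \<in> edges G" and i: "i < 10"
  shows "bij_betw (gadget_edge x i) (boundary (fat_petersen m) {i}) (boundary (inflate m G) {Inr (x, i)})"
  unfolding bij_betw_def
proof
  have e0: "(0, 0) \<in> edges (fat_petersen m)" by (simp add: fat_petersen_simps mult_def)
  have p0: "pos_ends 0 = {0, 1}" by (simp add: pos_ends_def)
  have small: "fst g < 15" if "g \<in> edges (fat_petersen m)" for g
    using that by (auto simp: fat_petersen_simps)
  show "inj_on (gadget_edge x i) (boundary (fat_petersen m) {i})"
    using small[OF boundary_edge] by (fastforce simp: inj_on_def gadget_edge_def split: if_splits)
  show "gadget_edge x i ` boundary (fat_petersen m) {i} = boundary (inflate m G) {Inr (x, i)}"
    unfolding boundary_vertex[OF graph_fat_petersen] boundary_vertex[OF graph_inflate[OF G]]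
  proof (intro equalityI subsetI)
    fix e assume "e \<in> gadget_edge x i ` {e \<in> edges (fat_petersen m). i \<in> ends (fat_petersen m) e}"
    then obtain g where g: "g \<in> edges (fat_petersen m)" "i \<in> pos_ends (fst g)" "e = gadget_edge x i g"
      by (auto simp: fat_petersen_simps)
    show "e \<in> {e \<in> edges (inflate m G). Inr (x, i) \<in> ends (inflate m G) e}"
    proof (cases "g = (0, 0)")
      case True
      then have "i = 0 \<or> i = 1" using g p0 by auto
      then show ?thesis using True g x by (auto simp: gadget_edge_def inflate_simps)
    next
      case False
      then have "e = (x, g)" using g by (simp add: gadget_edge_def)
      then show ?thesis using False g x by (simp add: inflate_simps)
    qed
  next
    fix e assume "e \<in> {e \<in> edges (inflate m G). Inr (x, i) \<in> ends (inflate m G) e}"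
    then have e: "e \<in> edges (inflate m G)" "Inr (x, i) \<in> ends (inflate m G) e" by auto
    from e(1) show "e \<in> gadget_edge x i ` {e \<in> edges (fat_petersen m). i \<in> ends (fat_petersen m) e}"
    proof (cases rule: inflate_edge_cases)
      case (1 y)
      then show ?thesis using e(2) e0 p0
        by (intro image_eqI[of _ _ "(0, 0)"]) (auto simp: gadget_edge_def inflate_simps fat_petersen_simps)
    next
      case (2 y)
      then show ?thesis using e(2) e0 p0
        by (intro image_eqI[of _ _ "(0, 0)"]) (auto simp: gadget_edge_def inflate_simps fat_petersen_simps)
    next
      case (3 y g)
      then show ?thesis using e(2)
        by (intro image_eqI[of _ _ g]) (auto simp: gadget_edge_def inflate_simps fat_petersen_simps)
    qed
  qed
qed

section \<open>Cuts of the inflated graph\<close>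

definition gadget_cut :: "nat \<Rightarrow> ('v, 'e) multigraph \<Rightarrow> ('v + 'e \<times> nat) set \<Rightarrow> 'e \<Rightarrow> (nat \<times> nat) set" where
  "gadget_cut m G Y x = {g. (x, g) \<in> boundary (inflate m G) Y}"

lemma gadget_cut_mem:
  assumes G: "graph G" and x: "x \<in> edges G"
  shows "(15, 0) \<in> gadget_cut m G Y x \<longleftrightarrow> (Inl (tail G x) \<in> Y) \<noteq> (Inr (x, 0) \<in> Y)"
    and "(16, 0) \<in> gadget_cut m G Y x \<longleftrightarrow> (Inl (head G x) \<in> Y) \<noteq> (Inr (x, 1) \<in> Y)"
    and "g \<in> edges (fat_petersen m) \<Longrightarrow> g \<noteq> (0, 0) \<Longrightarrow>
      g \<in> gadget_cut m G Y x \<longleftrightarrow> g \<in> boundary (fat_petersen m) {i. i < 10 \<and> Inr (x, i) \<in> Y}"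
proof -
  show "(15, 0) \<in> gadget_cut m G Y x \<longleftrightarrow> (Inl (tail G x) \<in> Y) \<noteq> (Inr (x, 0) \<in> Y)"
    unfolding gadget_cut_def mem_Collect_eq
    by (subst mem_boundary[of _ _ "Inl (tail G x)" "Inr (x, 0)"]) (use x in \<open>simp_all add: inflate_simps\<close>)
  show "(16, 0) \<in> gadget_cut m G Y x \<longleftrightarrow> (Inl (head G x) \<in> Y) \<noteq> (Inr (x, 1) \<in> Y)"
    unfolding gadget_cut_def mem_Collect_eq
    by (subst mem_boundary[of _ _ "Inl (head G x)" "Inr (x, 1)"]) (use x in \<open>simp_all add: inflate_simps\<close>)
  assume g: "g \<in> edges (fat_petersen m)" "g \<noteq> (0, 0)"
  obtain u v where uv: "pos_ends (fst g) = {u, v}" "u \<noteq> v" "u < 10" "v < 10"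
    using ends_obtain[OF graph_fat_petersen g(1)] by (metis fat_petersen_simps(1,3) lessThan_iff)
  have "(x, g) \<in> boundary (inflate m G) Y \<longleftrightarrow> (Inr (x, u) \<in> Y) \<noteq> (Inr (x, v) \<in> Y)"
    by (subst mem_boundary[of _ _ "Inr (x, u)" "Inr (x, v)"]) (use x g uv in \<open>simp_all add: inflate_simps\<close>)
  moreover have "g \<in> boundary (fat_petersen m) {i. i < 10 \<and> Inr (x, i) \<in> Y} \<longleftrightarrow>
      (Inr (x, u) \<in> Y) \<noteq> (Inr (x, v) \<in> Y)"
    by (subst mem_boundary[of _ _ u v]) (use g uv in \<open>simp_all add: fat_petersen_simps(3)\<close>)
  ultimately show "g \<in> gadget_cut m G Y x \<longleftrightarrow> g \<in> boundary (fat_petersen m) {i. i < 10 \<and> Inr (x, i) \<in> Y}"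
    by (simp add: gadget_cut_def)
qed

text \<open>\<open>Z\<close> and \<open>Y0\<close> are the parts of \<open>Y\<close> in the gadget
  of \<open>x\<close> and among the original vertices. An odd \<open>Z\<close> cuts at least
  \<open>m + 2\<close> edges of the closed gadget, and at most \<open>(0, 0)\<close> is lost by
  opening it; the third bound recovers this loss. The last claim says that an uncut gadget lies on
  one side together with both ends of \<open>x\<close>.\<close>

lemma gadget_cut_bounds:
  fixes Y :: "('v + 'e \<times> nat) set" and G :: "('v, 'e) multigraph"
  assumes G: "graph G" and m: "m \<ge> 1" and x: "x \<in> edges G"
  defines "Z \<equiv> {i. i < 10 \<and> Inr (x, i) \<in> Y}" and "Y0 \<equiv> {v. Inl v \<in> Y}"
  shows "x \<in> boundary G Y0 \<Longrightarrow> 1 \<le> card (gadget_cut m G Y x)"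
    and "odd (card Z) \<Longrightarrow> m + 1 \<le> card (gadget_cut m G Y x)"
    and "odd (card Z) \<Longrightarrow> x \<notin> boundary G Y0 \<Longrightarrow> m + 2 \<le> card (gadget_cut m G Y x)"
    and "gadget_cut m G Y x = {} \<Longrightarrow> x \<notin> boundary G Y0 \<and>
      (Z = {} \<and> tail G x \<notin> Y0 \<or> Z = {..<10} \<and> tail G x \<in> Y0)"
proof -
  let ?C = "gadget_cut m G Y x" and ?B = "boundary (fat_petersen m) Z"
  note mem = gadget_cut_mem[OF G x, where m = m and Y = Y, folded Z_def]
  have fC: "finite ?C"
  proof (rule finite_subset)
    show "?C \<subseteq> snd ` boundary (inflate m G) Y" by (force simp: gadget_cut_def)
    show "finite (snd ` boundary (inflate m G) Y)" using finite_boundary[OF graph_inflate[OF G]] by blast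
  qed
  have fB: "finite ?B" using finite_boundary[OF graph_fat_petersen] .
  have Zs: "Z \<subseteq> {..<10}" by (auto simp: Z_def)
  have BC: "?B - {(0, 0)} \<subseteq> ?C"
  proof
    fix g assume g: "g \<in> ?B - {(0, 0)}"
    then have "g \<in> edges (fat_petersen m)" "g \<noteq> (0, 0)" using boundary_edge by auto
    then show "g \<in> ?C" using mem(3) g by simp
  qed
  then have cBC: "card ?B \<le> card ?C + 1"
    using card.remove[OF fB, of "(0, 0)"] card_mono[OF fC BC] by (cases "(0, 0) \<in> ?B") simp_all
  have Z01: "0 \<in> Z \<longleftrightarrow> Inr (x, 0) \<in> Y" "1 \<in> Z \<longleftrightarrow> Inr (x, 1) \<in> Y" by (auto simp: Z_def)
  have eB: "(0, 0) \<in> ?B \<longleftrightarrow> (0 \<in> Z) \<noteq> (1 \<in> Z)"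
    by (subst mem_boundary[of _ _ 0 1]) (simp_all add: fat_petersen_simps pos_ends_def mult_def)
  have xB: "x \<in> boundary G Y0 \<longleftrightarrow> (tail G x \<in> Y0) \<noteq> (head G x \<in> Y0)"
    using mem_boundary[OF tail_head(1,2)[OF G x]] x by simp
  have l: "(15, 0) \<in> ?C \<longleftrightarrow> (tail G x \<in> Y0) \<noteq> (0 \<in> Z)" "(16, 0) \<in> ?C \<longleftrightarrow> (head G x \<in> Y0) \<noteq> (1 \<in> Z)"
    using mem(1,2) Z01 by (simp_all add: Y0_def)
  have big: "Z \<noteq> {} \<Longrightarrow> Z \<noteq> {..<10} \<Longrightarrow> 2 \<le> card ?C"
    using fat_petersen_cut(2)[OF m Zs] cBC by linarith
  { assume a: "x \<in> boundary G Y0"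
    show "1 \<le> card ?C"
    proof (cases "Z = {} \<or> Z = {..<10}")
      case True
      then have "(0 \<in> Z) = (1 \<in> Z)" by auto
      then have "?C \<noteq> {}" using a l xB by blast
      then show ?thesis using fC by (simp add: Suc_leI card_gt_0_iff)
    next
      case False
      then show ?thesis using big by simp
    qed }
  { assume o: "odd (card Z)"
    show "m + 1 \<le> card ?C" using fat_petersen_cut(1)[OF m Zs o] cBC by simp
    assume a: "x \<notin> boundary G Y0"
    show "m + 2 \<le> card ?C"
    proof (cases "(0, 0) \<in> ?B")
      case False
      then have "?B \<subseteq> ?C" using BC by auto
      then show ?thesis using fat_petersen_cut(1)[OF m Zs o] card_mono[OF fC] by (meson order_trans)
    next
      case True
      \<comment> \<open>The ends of \<open>x\<close> are on the same side while the gadget vertices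
        0 and 1 are not, so one of the two half-edges is cut and makes up for
        \<open>(0, 0)\<close>.\<close>
      then obtain h where h: "h \<in> ?C" "h = (15, 0) \<or> h = (16, 0)" using a l xB eB by blast
      have "h \<notin> ?B" using h(2) boundary_edge[of h "fat_petersen m" Z] by (auto simp: fat_petersen_simps)
      then have "card (insert h (?B - {(0, 0)})) = card ?B" using fB True card.remove[OF fB True] by simp
      moreover have "insert h (?B - {(0, 0)}) \<subseteq> ?C" using BC h by blast
      ultimately show ?thesis
        using fat_petersen_cut(1)[OF m Zs o] card_mono[OF fC] by (metis order_trans)
    qed }
  { assume C: "?C = {}"
    have "Z = {} \<or> Z = {..<10}" using big C by auto
    moreover have n: "{..<10::nat} \<noteq> {}" by (metis empty_iff lessThan_iff zero_less_numeral)
    ultimately have "(0 \<in> Z) = (1 \<in> Z)" "0 \<in> Z \<longleftrightarrow> Z = {..<10}" by auto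
    moreover have "(tail G x \<in> Y0) = (0 \<in> Z)" "(head G x \<in> Y0) = (1 \<in> Z)" using l C by simp_all
    ultimately show "x \<notin> boundary G Y0 \<and> (Z = {} \<and> tail G x \<notin> Y0 \<or> Z = {..<10} \<and> tail G x \<in> Y0)"
      using xB \<open>Z = {} \<or> Z = {..<10}\<close> n by blast }
qed

lemma boundary_inflate:
  "boundary (inflate m G) Y = Sigma (edges G) (gadget_cut m G Y)"
  by (auto simp: gadget_cut_def inflate_simps(2) dest: boundary_edge)

lemma card_boundary_inflate:
  assumes G: "graph G"
  shows "card (boundary (inflate m G) Y) = (\<Sum>x\<in>edges G. card (gadget_cut m G Y x))"
proof -
  have "finite (gadget_cut m G Y x)" for x
  proof (rule finite_subset)
    show "gadget_cut m G Y x \<subseteq> snd ` boundary (inflate m G) Y" by (force simp: gadget_cut_def)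
    show "finite (snd ` boundary (inflate m G) Y)" using finite_boundary[OF graph_inflate[OF G]] by blast
  qed
  moreover have "finite (edges G)" using G by (simp add: graph_def)
  ultimately show ?thesis unfolding boundary_inflate by simp
qed

lemma card_inflate_subset:
  assumes G: "graph G" and Y: "Y \<subseteq> verts (inflate m G)"
  shows "card Y = card {v. Inl v \<in> Y} + (\<Sum>x\<in>edges G. card {i. i < 10 \<and> Inr (x, i) \<in> Y})"
proof -
  have f: "finite (verts G)" "finite (edges G)" using G by (auto simp: graph_def)
  let ?S = "Sigma (edges G) (\<lambda>x. {i. i < 10 \<and> Inr (x, i) \<in> Y})"
  have "Y = Inl ` {v. Inl v \<in> Y} \<union> Inr ` ?S" using Y by (auto simp: inflate_simps)
  moreover have "finite {v. Inl v \<in> Y}"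
    by (rule finite_subset[OF _ f(1)]) (use Y in \<open>auto simp: inflate_simps\<close>)
  moreover have fS: "finite ?S" using f by auto
  ultimately have "card Y = card (Inl ` {v. Inl v \<in> Y} :: ('a + 'b \<times> nat) set) + card (Inr ` ?S :: ('a + 'b \<times> nat) set)"
    by (metis (no_types, lifting) card_Un_disjoint finite_imageI Inl_Inr_False disjoint_iff imageE)
  also have "\<dots> = card {v. Inl v \<in> Y} + card ?S" by (simp add: card_image)
  also have "card ?S = (\<Sum>x\<in>edges G. card {i. i < 10 \<and> Inr (x, i) \<in> Y})" using f by simp
  finally show ?thesis .
qed

lemma connected_inflate:
  assumes m: "m \<ge> 1" and c: "connected_graph G" and G: "graph G"
  shows "connected_graph (inflate m G)"
  unfolding connected_graph_iff_boundary[OF graph_inflate[OF G]]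
proof (intro conjI allI impI)
  have cG: "verts G \<noteq> {}" "\<And>X. X \<subseteq> verts G \<Longrightarrow> X \<noteq> {} \<Longrightarrow> X \<noteq> verts G \<Longrightarrow> boundary G X \<noteq> {}"
    using c connected_graph_iff_boundary[OF G] by blast+
  then show "verts (inflate m G) \<noteq> {}" by (simp add: inflate_simps)
  fix Y assume Y: "Y \<subseteq> verts (inflate m G) \<and> Y \<noteq> {} \<and> Y \<noteq> verts (inflate m G)"
  show "boundary (inflate m G) Y \<noteq> {}"
  proof
    assume b: "boundary (inflate m G) Y = {}"
    define Y0 where "Y0 = {v. Inl v \<in> Y}"
    have C: "gadget_cut m G Y x = {}" for x using b by (simp add: gadget_cut_def)
    have k: "x \<notin> boundary G Y0 \<and> ({i. i < 10 \<and> Inr (x, i) \<in> Y} = {} \<and> tail G x \<notin> Y0 \<or>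
        {i. i < 10 \<and> Inr (x, i) \<in> Y} = {..<10} \<and> tail G x \<in> Y0)" if "x \<in> edges G" for x
      using gadget_cut_bounds(4)[OF G m that C] by (simp add: Y0_def)
    have "boundary G Y0 = {}"
    proof (rule equals0I)
      fix x assume x: "x \<in> boundary G Y0"
      show False using k[OF boundary_edge[OF x]] x by simp
    qed
    moreover have s: "Y0 \<subseteq> verts G" using Y by (auto simp: Y0_def inflate_simps)
    ultimately have "Y0 = {} \<or> Y0 = verts G" using cG(2) by blast
    then show False
    proof
      assume y: "Y0 = {}"
      have "Inr (x, i) \<notin> Y" if "x \<in> edges G" "i < 10" for x i
        using k[OF that(1)] that(2) y by blast
      then have "Y = {}" using Y y by (auto simp: Y0_def inflate_simps)
      then show False using Y by simp
    next
      assume y: "Y0 = verts G"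
      have "Inr (x, i) \<in> Y" if x: "x \<in> edges G" "i < 10" for x i
      proof -
        have "tail G x \<in> Y0" using tail_head(3)[OF G x(1)] y by simp
        then have "{i. i < 10 \<and> Inr (x, i) \<in> Y} = {..<10}" using k[OF x(1)] by blast
        then show ?thesis using x(2) by blast
      qed
      then have "verts (inflate m G) \<subseteq> Y" using y by (auto simp: Y0_def inflate_simps)
      then show False using Y by blast
    qed
  qed
qed

text \<open>If \<open>Y\<close> meets every gadget evenly, \<open>Y0\<close> is odd and each edge in
  its cut in \<open>G\<close> contributes a cut edge. Otherwise a gadget met in an odd set provides
  \<open>m + 2\<close> edges, or \<open>m + 1\<close> if its edge lies in the cut of
  \<open>Y0\<close>; then that cut contains a second edge, which contributes the missing
  one.\<close>

lemma r_graph_inflate: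
  assumes m: "m \<ge> 1" and c: "connected_graph G" and rG: "r_graph (m + 2) G"
  shows "r_graph (m + 2) (inflate m G)"
  unfolding r_graph_def
proof (intro conjI allI impI)
  have G: "graph G" using rG by (simp add: r_graph_def)
  have fE: "finite (edges G)" using G by (simp add: graph_def)
  show "graph (inflate m G)" by (rule graph_inflate[OF G])
  show "regular_graph (m + 2) (inflate m G)"
    unfolding regular_graph_def
  proof
    fix u assume "u \<in> verts (inflate m G)"
    then consider v where "v \<in> verts G" "u = Inl v" | x i where "x \<in> edges G" "i < 10" "u = Inr (x, i)"
      by (auto simp: inflate_simps)
    then show "card (boundary (inflate m G) {u}) = m + 2"
    proof cases
      case 1
      then show ?thesis using bij_betw_same_card[OF link_bij[OF G]] rG by (auto simp: r_graph_def regular_graph_def)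
    next
      case 2
      have "card (boundary (fat_petersen m) {i}) = m + 2"
        using r_graph_fat_petersen[OF m] 2(2) by (simp add: r_graph_def regular_graph_def fat_petersen_simps)
      then show ?thesis using bij_betw_same_card[OF gadget_edge_bij[OF G m 2(1,2)]] 2(3) by simp
    qed
  qed
  fix Y assume Y: "Y \<subseteq> verts (inflate m G) \<and> odd (card Y)"
  define Y0 where "Y0 = {v. Inl v \<in> Y}"
  define Z where "Z x = {i. i < 10 \<and> Inr (x, i) \<in> Y}" for x
  let ?n = "\<lambda>x. card (gadget_cut m G Y x)"
  have s: "Y0 \<subseteq> verts G" using Y by (auto simp: Y0_def inflate_simps)
  note bd = gadget_cut_bounds[OF G m, where Y = Y, folded Z_def Y0_def]
  have cY: "card Y = card Y0 + (\<Sum>x\<in>edges G. card (Z x))"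
    using card_inflate_subset[OF G conjunct1[OF Y]] by (simp add: Y0_def Z_def)
  have "m + 2 \<le> (\<Sum>x\<in>edges G. ?n x)"
  proof (cases "\<exists>x\<in>edges G. odd (card (Z x))")
    case False
    then have "even (\<Sum>x\<in>edges G. card (Z x))" by (intro dvd_sum) simp
    then have "odd (card Y0)" using Y cY by simp
    then have "m + 2 \<le> card (boundary G Y0)" using rG s by (simp add: r_graph_def)
    also have "\<dots> = (\<Sum>x\<in>boundary G Y0. 1)" by simp
    also have "\<dots> \<le> (\<Sum>x\<in>boundary G Y0. ?n x)"
      by (intro sum_mono bd(1)) (auto dest: boundary_edge)
    also have "\<dots> \<le> (\<Sum>x\<in>edges G. ?n x)" by (rule sum_mono2[OF fE boundary_subset]) simp
    finally show ?thesis .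
  next
    case True
    then obtain x where x: "x \<in> edges G" "odd (card (Z x))" by blast
    show ?thesis
    proof (cases "x \<in> boundary G Y0")
      case False
      then have "m + 2 \<le> ?n x" using bd(3)[OF x(1,2)] by simp
      also have "\<dots> \<le> (\<Sum>x\<in>edges G. ?n x)" using fE x(1) by (intro member_le_sum) auto
      finally show ?thesis .
    next
      case True
      have "boundary G {} = {}" "boundary G (verts G) = {}"
        using boundary_obtain[OF G] by (metis empty_iff equals0I)+
      then have "Y0 \<noteq> {}" "Y0 \<noteq> verts G" using True by auto
      then have "2 \<le> card (boundary G Y0)" using r_graph_even_boundary[OF c rG s] by simp
      then have "\<not> boundary G Y0 \<subseteq> {x}" using card_mono[of "{x}" "boundary G Y0"] by auto
      then obtain y where y: "y \<in> boundary G Y0" "y \<noteq> x" by blast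
      have "m + 2 \<le> ?n x + ?n y"
        using bd(2)[OF x] bd(1)[OF boundary_edge[OF y(1)] y(1)] by simp
      also have "\<dots> = (\<Sum>z\<in>{x, y}. ?n z)" using y(2) by simp
      also have "\<dots> \<le> (\<Sum>z\<in>edges G. ?n z)"
        using fE x(1) boundary_edge[OF y(1)] by (intro sum_mono2) auto
      finally show ?thesis .
    qed
  qed
  then show "m + 2 \<le> card (boundary (inflate m G) Y)" using card_boundary_inflate[OF G] by simp
qed

section \<open>Contracting two-edge cuts\<close>

locale two_edge_cut =
  fixes K :: "('w, 'f) multigraph" and r :: nat and W :: "'w set" and a b :: 'f
  assumes cK: "connected_graph K" and rK: "r_graph r K" and r3: "r \<ge> 3"
    and WK: "W \<subseteq> verts K" and bdW: "boundary K W = {a, b}" and ab: "a \<noteq> b"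
begin

lemma gK: "graph K"
  using rK by (simp add: r_graph_def)

definition outer_end :: "'f \<Rightarrow> 'w" where
  "outer_end e = (SOME p. p \<in> ends K e \<and> p \<notin> W)"

lemma cut_edge:
  assumes "e = a \<or> e = b"
  shows "\<exists>w\<in>W. ends K e = {outer_end e, w}" "outer_end e \<notin> W" "outer_end e \<in> verts K" "e \<in> edges K"
proof -
  have e: "e \<in> boundary K W" using bdW assms by auto
  obtain u v where uv: "ends K e = {u, v}" "u \<in> W" "v \<notin> W" "u \<in> verts K" "v \<in> verts K"
    using boundary_obtain[OF gK e] .
  have "\<exists>p. p \<in> ends K e \<and> p \<notin> W" using uv by blast
  then have "outer_end e \<in> ends K e \<and> outer_end e \<notin> W" unfolding outer_end_def by (rule someI_ex)
  then have "outer_end e = v" using uv by auto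
  then show "\<exists>w\<in>W. ends K e = {outer_end e, w}" "outer_end e \<notin> W" "outer_end e \<in> verts K"
    using uv by (auto simp: insert_commute)
  show "e \<in> edges K" by (rule boundary_edge[OF e])
qed

lemma cut_edge_mem:
  assumes "e = a \<or> e = b" "Y \<inter> W = {} \<or> W \<subseteq> Y"
  shows "e \<in> boundary K Y \<longleftrightarrow> (outer_end e \<in> Y) \<noteq> (W \<subseteq> Y)"
proof -
  obtain w where w: "w \<in> W" "ends K e = {outer_end e, w}" using cut_edge(1)[OF assms(1)] by blast
  have "outer_end e \<noteq> w" using w cut_edge(2)[OF assms(1)] by auto
  then have "e \<in> boundary K Y \<longleftrightarrow> (outer_end e \<in> Y) \<noteq> (w \<in> Y)"
    using mem_boundary[OF w(2)] cut_edge(4)[OF assms(1)] by simp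
  moreover have "w \<in> Y \<longleftrightarrow> W \<subseteq> Y" using assms(2) w(1) by blast
  ultimately show ?thesis by simp
qed

lemma even_W: "even (card W)"
proof (rule ccontr)
  assume "odd (card W)"
  then have "r \<le> card (boundary K W)" using rK WK by (simp add: r_graph_def)
  then show False using bdW r3 card_insert_le_m1[of 2 "{b}" a] by simp
qed

lemma finite_W: "finite W"
  using WK gK by (auto simp: graph_def intro: finite_subset)

text \<open>With a common outer end \<open>p\<close>, adding \<open>p\<close> to \<open>W\<close>
  gives an odd set whose cut consists of edges at \<open>p\<close> other than \<open>a\<close> and
  \<open>b\<close>, at most \<open>r - 2\<close> of them. So the contraction creates no
  loop.\<close>

lemma outer_ends_ne: "outer_end a \<noteq> outer_end b"
proof
  assume eq: "outer_end a = outer_end b"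
  let ?p = "outer_end a" and ?Z = "insert (outer_end a) W"
  have pW: "?p \<notin> W" "?p \<in> verts K" using cut_edge by auto
  have "odd (card ?Z)" using even_W pW finite_W by simp
  then have 1: "r \<le> card (boundary K ?Z)" using rK WK pW by (simp add: r_graph_def)
  have sub: "boundary K ?Z \<subseteq> boundary K {?p} - {a, b}"
  proof
    fix e assume e: "e \<in> boundary K ?Z"
    have nab: "e \<notin> {a, b}"
    proof
      assume "e \<in> {a, b}"
      then have "e = a \<or> e = b" by simp
      then show False using cut_edge_mem[of e ?Z] e eq by auto
    qed
    obtain u v where uv: "ends K e = {u, v}" "u \<in> ?Z" "v \<notin> ?Z" using boundary_obtain[OF gK e] .
    have "u \<notin> W"
    proof
      assume "u \<in> W"
      then have "e \<in> boundary K W" using mem_boundary[OF uv(1), of W] uv boundary_edge[OF e] by auto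
      then show False using nab bdW by simp
    qed
    then have "u = ?p" using uv by simp
    then have "e \<in> boundary K {?p}" unfolding boundary_vertex[OF gK] using uv(1) boundary_edge[OF e] by simp
    then show "e \<in> boundary K {?p} - {a, b}" using nab by simp
  qed
  have "a \<in> boundary K {?p}" "b \<in> boundary K {?p}"
    unfolding boundary_vertex[OF gK] using cut_edge[of a] cut_edge[of b] eq by auto
  then have "card (boundary K {?p} - {a, b}) = r - 2"
    using rK pW ab by (simp add: r_graph_def regular_graph_def card_Diff_subset)
  then show False using card_mono[OF _ sub] finite_boundary[OF gK] 1 r3 by fastforce
qed

text \<open>The whole side \<open>W\<close> is replaced by a single edge joining the outer ends of
  \<open>a\<close> and \<open>b\<close>. It reuses the name \<open>a\<close>, so that colours are
  translated by \<rho>, which merges \<open>b\<close> into \<open>a\<close>.\<close>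

definition contract :: "('w, 'f) multigraph" where
  "contract = \<lparr>verts = verts K - W, edges = insert a {e \<in> edges K. ends K e \<inter> W = {}},
     ends = (ends K)(a := {outer_end a, outer_end b})\<rparr>"

definition \<rho> :: "'f \<Rightarrow> 'f" where
  "\<rho> e = (if e = b then a else e)"

lemma contract_simps:
  "verts contract = verts K - W"
  "edges contract = insert a {e \<in> edges K. ends K e \<inter> W = {}}"
  "ends contract a = {outer_end a, outer_end b}"
  "e \<noteq> a \<Longrightarrow> ends contract e = ends K e"
  by (simp_all add: contract_def)

lemma graph_contract: "graph contract"
  unfolding graph_def
proof (intro conjI ballI)
  show "finite (verts contract)" "finite (edges contract)"
    using gK by (auto simp: contract_simps graph_def)
  fix e assume e: "e \<in> edges contract"
  show "ends contract e \<subseteq> verts contract" "card (ends contract e) = 2"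
  proof (atomize(full), cases "e = a")
    case True
    then show "ends contract e \<subseteq> verts contract \<and> card (ends contract e) = 2"
      using cut_edge[of a] cut_edge[of b] outer_ends_ne by (simp add: contract_simps)
  next
    case False
    then have "e \<in> edges K" "ends K e \<inter> W = {}" using e by (auto simp: contract_simps)
    then show "ends contract e \<subseteq> verts contract \<and> card (ends contract e) = 2"
      using False gK by (auto simp: contract_simps graph_def)
  qed
qed

lemma a_not_kept: "ends K a \<inter> W \<noteq> {}" "ends K b \<inter> W \<noteq> {}"
  using cut_edge(1)[of a] cut_edge(1)[of b] by auto

text \<open>A set that does not split \<open>W\<close> keeps its cut up to renaming. Both
  \<open>a\<close> and \<open>b\<close> in the cut must be excluded: then the two outer ends are on
  the same side and the new edge is not cut at all.\<close>

lemma contract_boundary: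
  assumes Y: "Y \<inter> W = {} \<or> W \<subseteq> Y" and n: "\<not> {a, b} \<subseteq> boundary K Y"
  shows "boundary contract (Y - W) = \<rho> ` boundary K Y" "inj_on \<rho> (boundary K Y)"
proof -
  have am: "a \<in> boundary contract (Y - W) \<longleftrightarrow> a \<in> boundary K Y \<or> b \<in> boundary K Y"
  proof -
    have "a \<in> boundary contract (Y - W) \<longleftrightarrow> (outer_end a \<in> Y - W) \<noteq> (outer_end b \<in> Y - W)"
      using mem_boundary[OF contract_simps(3) outer_ends_ne, of "Y - W"] by (simp add: contract_simps)
    also have "\<dots> \<longleftrightarrow> (outer_end a \<in> Y) \<noteq> (outer_end b \<in> Y)" using cut_edge(2) by simp
    also have "\<dots> \<longleftrightarrow> a \<in> boundary K Y \<or> b \<in> boundary K Y"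
      using cut_edge_mem[OF _ Y, of a] cut_edge_mem[OF _ Y, of b] n by auto
    finally show ?thesis .
  qed
  have kept: "e \<in> boundary contract (Y - W) \<longleftrightarrow> e \<in> boundary K Y" if e: "e \<noteq> a" "e \<noteq> b" for e
  proof (cases "e \<in> edges K \<and> ends K e \<inter> W = {}")
    case True
    then have "ends K e \<inter> (Y - W) = ends K e \<inter> Y" by blast
    then show ?thesis using True e by (simp add: boundary_def contract_simps)
  next
    case False
    have "e \<notin> boundary K Y"
    proof
      assume b: "e \<in> boundary K Y"
      obtain u v where uv: "ends K e = {u, v}" "u \<in> Y" "v \<notin> Y" using boundary_obtain[OF gK b] .
      have "ends K e \<inter> W \<noteq> {}" using False boundary_edge[OF b] by blast
      then have uvW: "u \<in> W \<or> v \<in> W" using uv(1) by auto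
      have "(u \<in> W) \<noteq> (v \<in> W)"
        using Y
      proof
        assume "Y \<inter> W = {}"
        then have "u \<notin> W" using uv(2) by auto
        then show ?thesis using uvW by simp
      next
        assume "W \<subseteq> Y"
        then have "v \<notin> W" using uv(3) by auto
        then show ?thesis using uvW by simp
      qed
      moreover have "u \<noteq> v" using uv by auto
      ultimately have "e \<in> boundary K W" using mem_boundary[OF uv(1)] boundary_edge[OF b] by simp
      then show False using e bdW by simp
    qed
    moreover have "e \<notin> edges contract" using False e by (auto simp: contract_simps)
    then have "e \<notin> boundary contract (Y - W)" using boundary_edge by metis
    ultimately show ?thesis by simp
  qed
  have bn: "b \<notin> boundary contract (Y - W)"
    using boundary_edge[of b contract] a_not_kept ab by (auto simp: contract_simps)
  show "boundary contract (Y - W) = \<rho> ` boundary K Y"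
  proof (intro equalityI subsetI)
    fix e assume e: "e \<in> boundary contract (Y - W)"
    show "e \<in> \<rho> ` boundary K Y"
    proof (cases "e = a")
      case True
      then have "a \<in> boundary K Y \<or> b \<in> boundary K Y" using am e by simp
      moreover have "\<rho> a = a" "\<rho> b = a" using ab by (simp_all add: \<rho>_def)
      ultimately show ?thesis using True by (metis imageI)
    next
      case False
      then have eb: "e \<noteq> b" using e bn by blast
      then have "e \<in> boundary K Y" "\<rho> e = e" using kept[OF False eb] e by (simp_all add: \<rho>_def)
      then show ?thesis by (metis imageI)
    qed
  next
    fix e' assume "e' \<in> \<rho> ` boundary K Y"
    then obtain e where e: "e \<in> boundary K Y" "e' = \<rho> e" by blast
    then show "e' \<in> boundary contract (Y - W)"
      using am kept[of e] ab by (cases "e = a"; cases "e = b") (simp_all add: \<rho>_def)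
  qed
  show "inj_on \<rho> (boundary K Y)" using n by (auto simp: inj_on_def \<rho>_def split: if_splits)
qed

lemma contract_star:
  assumes u: "u \<in> verts K - W"
  shows "bij_betw \<rho> (boundary K {u}) (boundary contract {u})"
proof -
  have "\<not> W \<subseteq> {u}"
  proof
    assume "W \<subseteq> {u}"
    then have "W = {}" using u by blast
    then show False using cut_edge(1)[of a] by blast
  qed
  then have "a \<in> boundary K {u} \<longleftrightarrow> outer_end a = u" "b \<in> boundary K {u} \<longleftrightarrow> outer_end b = u"
    using cut_edge_mem[of a "{u}"] cut_edge_mem[of b "{u}"] u by auto
  then have "\<not> {a, b} \<subseteq> boundary K {u}" using outer_ends_ne by auto
  moreover have "{u} - W = {u}" "{u} \<inter> W = {}" using u by auto
  ultimately show ?thesis using contract_boundary[of "{u}"] by (simp add: bij_betw_def)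
qed

text \<open>\<open>W\<close> is added to \<open>Y\<close> exactly when both outer ends lie in
  \<open>Y\<close>. This keeps \<open>a\<close> and \<open>b\<close> from being cut
  together.\<close>

lemma contract_cut:
  assumes Y: "Y \<subseteq> verts contract"
  shows "\<exists>Z \<subseteq> verts K. Z - W = Y \<and> (Z = Y \<or> Z = Y \<union> W) \<and> card (boundary contract Y) = card (boundary K Z)"
proof -
  have YW: "Y \<inter> W = {}" "Y \<subseteq> verts K" using Y by (auto simp: contract_simps)
  have W: "\<not> W \<subseteq> Y" using YW(1) cut_edge(1)[of a] by blast
  show ?thesis
  proof (cases "outer_end a \<in> Y \<and> outer_end b \<in> Y")
    case True
    let ?Z = "Y \<union> W"
    have "a \<notin> boundary K ?Z" using cut_edge_mem[of a ?Z] True by auto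
    then have "card (boundary contract (?Z - W)) = card (boundary K ?Z)"
      using contract_boundary[of ?Z] by (simp add: card_image)
    moreover have "?Z - W = Y" using YW by blast
    ultimately show ?thesis using YW WK by (intro exI[of _ ?Z]) auto
  next
    case False
    have "\<not> {a, b} \<subseteq> boundary K Y"
      using cut_edge_mem[of a Y] cut_edge_mem[of b Y] YW W False by auto
    then have "card (boundary contract (Y - W)) = card (boundary K Y)"
      using contract_boundary[of Y] YW by (simp add: card_image)
    moreover have "Y - W = Y" using YW by blast
    ultimately show ?thesis using YW by (intro exI[of _ Y]) auto
  qed
qed

lemma connected_contract: "connected_graph contract"
  unfolding connected_graph_iff_boundary[OF graph_contract]
proof (intro conjI allI impI)
  show "verts contract \<noteq> {}" using cut_edge[of a] by (auto simp: contract_simps)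
  fix Y assume Y: "Y \<subseteq> verts contract \<and> Y \<noteq> {} \<and> Y \<noteq> verts contract"
  obtain Z where Z: "Z \<subseteq> verts K" "Z - W = Y" "card (boundary contract Y) = card (boundary K Z)"
    using contract_cut[OF conjunct1[OF Y]] by blast
  then have "Z \<noteq> {}" "Z \<noteq> verts K" using Y by (auto simp: contract_simps)
  then have "2 \<le> card (boundary K Z)" using r_graph_even_boundary[OF cK rK Z(1)] r3 by simp
  then show "boundary contract Y \<noteq> {}" using Z(3) by (metis card.empty not_numeral_le_zero)
qed

lemma r_graph_contract: "r_graph r contract"
  unfolding r_graph_def
proof (intro conjI allI impI)
  show "graph contract" by (rule graph_contract)
  show "regular_graph r contract"
    using bij_betw_same_card[OF contract_star] rK
    by (auto simp: regular_graph_def r_graph_def contract_simps)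
  fix Y assume Y: "Y \<subseteq> verts contract \<and> odd (card Y)"
  obtain Z where Z: "Z \<subseteq> verts K" "Z = Y \<or> Z = Y \<union> W" "card (boundary contract Y) = card (boundary K Z)"
    using contract_cut[OF conjunct1[OF Y]] by blast
  have "finite Y" "Y \<inter> W = {}" using Y finite_subset[of Y] graph_contract by (auto simp: graph_def contract_simps)
  then have "odd (card Z)" using Z(2) Y even_W finite_W by (auto simp: card_Un_disjoint)
  then show "r \<le> card (boundary contract Y)" using rK Z by (simp add: r_graph_def)
qed

text \<open>If \<open>Y\<close> split \<open>W\<close>, the cuts of \<open>W \<inter> Y\<close> and
  of \<open>W - Y\<close> would consist of edges among \<open>a\<close> and \<open>b\<close>, since
  no edge bounding \<open>Y\<close> runs inside \<open>W\<close>. Both cuts need two edges, so both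
  would contain \<open>a\<close>, whose end in \<open>W\<close> lies in only one of the
  parts.\<close>

lemma other_cut:
  assumes Y: "Y \<subseteq> verts K" "boundary K Y = {c, d}" and c: "\<not> ends K c \<subseteq> W" "\<not> ends K d \<subseteq> W"
  shows "Y \<inter> W = {} \<or> W \<subseteq> Y"
proof (rule ccontr)
  assume n: "\<not> ?thesis"
  have *: "boundary K X \<subseteq> {a, b}" if X: "X = W \<inter> Y \<or> X = W - Y" for X
  proof
    fix e assume e: "e \<in> boundary K X"
    obtain u v where uv: "ends K e = {u, v}" "u \<in> X" "v \<notin> X" using boundary_obtain[OF gK e] .
    then have ne: "u \<noteq> v" by auto
    have "v \<notin> W"
    proof
      assume v: "v \<in> W"
      then have "(u \<in> Y) \<noteq> (v \<in> Y)" using X uv by blast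
      then have "e \<in> boundary K Y" using mem_boundary[OF uv(1) ne] boundary_edge[OF e] by simp
      then have "e = c \<or> e = d" using Y(2) by simp
      moreover have "ends K e \<subseteq> W" using uv X v by auto
      ultimately show False using c by blast
    qed
    moreover have "u \<in> W" using uv X by blast
    ultimately have "e \<in> boundary K W" using mem_boundary[OF uv(1) ne] boundary_edge[OF e] by simp
    then show "e \<in> {a, b}" using bdW by simp
  qed
  have full: "boundary K X = {a, b}" if X: "X = W \<inter> Y \<or> X = W - Y" for X
  proof -
    have "X \<subseteq> verts K" "X \<noteq> {}" using X n WK by auto
    moreover have "X \<noteq> verts K" using X cut_edge(2,3)[of a] by blast
    ultimately have "2 \<le> card (boundary K X)" using r_graph_even_boundary[OF cK rK] r3 by simp
    then show ?thesis using card_subset_eq[OF _ *[OF X]] card_mono[OF _ *[OF X]] ab by simp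
  qed
  obtain w where w: "w \<in> W" "ends K a = {outer_end a, w}" "outer_end a \<noteq> w" "outer_end a \<notin> W"
    using cut_edge(1,2)[of a] by auto
  have "w \<in> X" if "X = W \<inter> Y \<or> X = W - Y" for X
    using full[OF that] mem_boundary[OF w(2,3), of X] w(4) that by auto
  then show False by blast
qed

end

section \<open>Colourings as bijections between stars\<close>

lemma is_coloringI:
  assumes G: "graph G"
    and star: "\<And>v. v \<in> verts G \<Longrightarrow> \<exists>u\<in>verts K. bij_betw f (boundary G {v}) (boundary K {u})"
  shows "is_coloring K G f"
  unfolding is_coloring_def
proof (intro conjI allI impI ballI)
  show "f \<in> edges G \<rightarrow> edges K"
  proof
    fix e assume e: "e \<in> edges G"
    obtain u v where uv: "ends G e = {u, v}" "u \<noteq> v" "u \<in> verts G" using ends_obtain[OF G e] .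
    then have "e \<in> boundary G {u}" using e by (simp add: boundary_vertex[OF G])
    then show "f e \<in> edges K" using star[OF uv(3)] boundary_edge by (metis bij_betwE)
  qed
  fix e1 e2 assume a: "adjacent_edges G e1 e2"
  then obtain v where v: "v \<in> ends G e1" "v \<in> ends G e2" "e1 \<in> edges G" "e2 \<in> edges G" "e1 \<noteq> e2"
    by (auto simp: adjacent_edges_def)
  then have "v \<in> verts G" "e1 \<in> boundary G {v}" "e2 \<in> boundary G {v}"
    using G by (auto simp: graph_def boundary_vertex[OF G])
  then show "f e1 \<noteq> f e2" using star v(5) by (metis bij_betw_def inj_on_eq_iff)
next
  fix v assume "v \<in> verts G"
  then show "\<exists>u\<in>verts K. f ` boundary G {v} = boundary K {u}" using star by (metis bij_betw_def)
qed

lemma is_coloring_star: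
  assumes G: "graph G" and f: "is_coloring K G f"
  shows "\<exists>\<phi>. \<forall>v\<in>verts G. \<phi> v \<in> verts K \<and> bij_betw f (boundary G {v}) (boundary K {\<phi> v})"
proof -
  have "\<forall>v\<in>verts G. \<exists>u. u \<in> verts K \<and> bij_betw f (boundary G {v}) (boundary K {u})"
  proof
    fix v assume "v \<in> verts G"
    then obtain u where u: "u \<in> verts K" "f ` boundary G {v} = boundary K {u}"
      using f by (auto simp: is_coloring_def)
    have "inj_on f (boundary G {v})"
    proof (rule inj_onI, rule ccontr)
      fix e e' assume e: "e \<in> boundary G {v}" "e' \<in> boundary G {v}" "f e = f e'" "e \<noteq> e'"
      then have "adjacent_edges G e e'" by (auto simp: adjacent_edges_def boundary_vertex[OF G])
      then show False using f e(3) unfolding is_coloring_def by blast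
    qed
    then show "\<exists>u. u \<in> verts K \<and> bij_betw f (boundary G {v}) (boundary K {u})"
      using u by (auto simp: bij_betw_def)
  qed
  then show ?thesis by (rule bchoice)
qed

text \<open>\<open>h v x\<close> is the colour of \<open>x\<close> seen from its end
  \<open>v\<close>, so \<open>h\<close> is a colouring whose edges may have two colours. Where the
  two views differ, they bound a set free of images of vertices of \<open>G\<close>, and contracting
  that set merges them. Several edges of \<open>G\<close> may be settled by one contraction, as
  their sets may share the same two boundary edges. Once all views agree, \<open>h\<close> is a
  genuine colouring.\<close>

lemma reduce_two_edge_cuts:
  fixes K :: "('w, 'f) multigraph" and G :: "('v, 'e) multigraph"
  assumes r: "r \<ge> 3" and G: "graph G" and "connected_graph K" "r_graph r K"
    and "\<And>v. v \<in> verts G \<Longrightarrow> \<phi> v \<in> verts K \<and> bij_betw (h v) (boundary G {v}) (boundary K {\<phi> v})"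
    and "\<And>x s t. x \<in> edges G \<Longrightarrow> ends G x = {s, t} \<Longrightarrow> h s x = h t x \<or>
      (\<exists>W\<subseteq>verts K. boundary K W = {h s x, h t x} \<and> W \<inter> \<phi> ` verts G = {})"
  shows "\<exists>L :: ('w, 'f) multigraph. connected_graph L \<and> r_graph r L \<and> colors L G \<and> card (verts L) \<le> card (verts K) \<and>
    ((\<exists>x\<in>edges G. \<exists>s t. ends G x = {s, t} \<and> h s x \<noteq> h t x) \<longrightarrow> card (verts L) < card (verts K))"
  using assms(3-)
proof (induction "card (verts K)" arbitrary: K h rule: less_induct)
  case less
  note cK = less.prems(1) and rK = less.prems(2) and star = less.prems(3) and cut = less.prems(4)
  show ?case
  proof (cases "\<exists>x\<in>edges G. \<exists>s t. ends G x = {s, t} \<and> h s x \<noteq> h t x")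
    case False
    define f where "f x = h (tail G x) x" for x
    have fh: "f x = h v x" if "x \<in> edges G" "v \<in> ends G x" for x v
    proof -
      have "v = tail G x \<or> v = head G x" "ends G x = {tail G x, head G x}" using tail_head(1)[OF G that(1)] that(2) by auto
      then show ?thesis using False that(1) f_def by metis
    qed
    have "bij_betw f (boundary G {v}) (boundary K {\<phi> v})" if "v \<in> verts G" for v
      using star[OF that] by (subst bij_betw_cong[of _ f "h v"]) (auto simp: boundary_vertex[OF G] fh)
    then have "is_coloring K G f" using is_coloringI[OF G, of K f] star by blast
    then have "colors K G" by (auto simp: colors_def)
    then show ?thesis using cK rK False by (intro exI[of _ K]) simp
  next
    case True
    then obtain x s t where x: "x \<in> edges G" "ends G x = {s, t}" "h s x \<noteq> h t x" by blast
    obtain W where W: "W \<subseteq> verts K" "boundary K W = {h s x, h t x}" "W \<inter> \<phi> ` verts G = {}"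
      using cut[OF x(1,2)] x(3) by blast
    interpret c: two_edge_cut K r W "h s x" "h t x"
      using cK rK r W x(3) by unfold_locales
    have gK: "graph K" by (rule c.gK)
    have "W \<noteq> {}" using c.cut_edge(1)[of "h s x"] by blast
    then have lt: "card (verts c.contract) < card (verts K)"
      using W(1) gK unfolding c.contract_simps graph_def by (intro psubset_card_mono) auto
    have out: "\<phi> v \<in> verts K - W" if "v \<in> verts G" for v using star[OF that] W(3) that by blast
    have star': "\<phi> v \<in> verts c.contract \<and> bij_betw (c.\<rho> \<circ> h v) (boundary G {v}) (boundary c.contract {\<phi> v})"
      if v: "v \<in> verts G" for v
    proof
      show "\<phi> v \<in> verts c.contract" using out[OF v] by (simp add: c.contract_simps)
      show "bij_betw (c.\<rho> \<circ> h v) (boundary G {v}) (boundary c.contract {\<phi> v})"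
        using star[OF v] c.contract_star[OF out[OF v]] by (blast intro: bij_betw_trans)
    qed
    have cut': "(c.\<rho> \<circ> h u) y = (c.\<rho> \<circ> h v) y \<or>
      (\<exists>Z\<subseteq>verts c.contract. boundary c.contract Z = {(c.\<rho> \<circ> h u) y, (c.\<rho> \<circ> h v) y} \<and> Z \<inter> \<phi> ` verts G = {})"
      if y: "y \<in> edges G" "ends G y = {u, v}" for y u v
    proof (cases "c.\<rho> (h u y) = c.\<rho> (h v y)")
      case False
      then have "h u y \<noteq> h v y" by auto
      then obtain Y where Y: "Y \<subseteq> verts K" "boundary K Y = {h u y, h v y}" "Y \<inter> \<phi> ` verts G = {}"
        using cut[OF y] by blast
      have ne: "\<not> ends K (h w y) \<subseteq> W" if "w \<in> {u, v}" for w
      proof -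
        have w: "w \<in> verts G" "y \<in> boundary G {w}"
          using that y G by (auto simp: graph_def boundary_vertex[OF G])
        then have "h w y \<in> boundary K {\<phi> w}" using star[OF w(1)] by (auto simp: bij_betw_def)
        then have "\<phi> w \<in> ends K (h w y)" by (simp add: boundary_vertex[OF gK])
        then show ?thesis using out[OF w(1)] by blast
      qed
      \<comment> \<open>A colour seen from a vertex \<open>w\<close> of \<open>G\<close> ends at
        \<phi> w, outside \<open>W\<close>. So the edges bounding \<open>Y\<close> do not run inside
        \<open>W\<close>.\<close>
      have YW: "Y \<inter> W = {} \<or> W \<subseteq> Y" by (rule c.other_cut[OF Y(1,2)]) (use ne in auto)
      \<comment> \<open>If both cuts had the same two edges, \<rho> would have merged the two
        colours of \<open>y\<close>.\<close>
      have "\<not> {h s x, h t x} \<subseteq> boundary K Y"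
      proof
        assume "{h s x, h t x} \<subseteq> boundary K Y"
        then have "{h s x, h t x} = {h u y, h v y}" using Y(2) x(3) by auto
        then have "h u y \<in> {h s x, h t x}" "h v y \<in> {h s x, h t x}" by blast+
        then have "c.\<rho> (h u y) = h s x" "c.\<rho> (h v y) = h s x" by (auto simp: c.\<rho>_def)
        then show False using False by simp
      qed
      then have "boundary c.contract (Y - W) = c.\<rho> ` {h u y, h v y}"
        using c.contract_boundary(1)[OF YW] Y(2) by simp
      then show ?thesis using Y by (intro disjI2 exI[of _ "Y - W"]) (auto simp: c.contract_simps)
    qed simp
    obtain L :: "('w, 'f) multigraph" where "connected_graph L" "r_graph r L" "colors L G" "card (verts L) \<le> card (verts c.contract)"
      using less.hyps[OF lt c.connected_contract c.r_graph_contract star' cut'] by blast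
    then show ?thesis using lt by (intro exI[of _ L]) simp
  qed
qed

section \<open>Colourings of an inflated graph\<close>

text \<open>Each star is mapped bijectively onto a star of \<open>K\<close>, which meets
  \<open>N\<close> in one edge.\<close>

lemma perfect_matching_preimage:
  assumes N: "perfect_matching K N"
    and star: "\<And>v. v \<in> verts G \<Longrightarrow> \<phi> v \<in> verts K \<and> bij_betw f (boundary G {v}) (boundary K {\<phi> v})"
  shows "perfect_matching G {e \<in> edges G. f e \<in> N}"
  unfolding perfect_matching_def
proof (intro conjI ballI)
  fix v assume v: "v \<in> verts G"
  have b: "bij_betw f (boundary G {v}) (boundary K {\<phi> v})" using star[OF v] by simp
  let ?M = "{e \<in> edges G. f e \<in> N} \<inter> boundary G {v}"
  have "f ` ?M = N \<inter> boundary K {\<phi> v}"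
  proof -
    have "?M = {e \<in> boundary G {v}. f e \<in> N}" using boundary_edge[of _ G "{v}"] by blast
    then show ?thesis using b unfolding bij_betw_def by auto
  qed
  moreover have "inj_on f ?M" using b by (auto simp: bij_betw_def inj_on_def)
  ultimately have "card ?M = card (N \<inter> boundary K {\<phi> v})" using card_image by metis
  then show "card ?M = 1" using N star[OF v] by (simp add: perfect_matching_def)
qed auto

lemma edges_nonempty:
  assumes "connected_graph G" "r_graph r G" "r \<ge> 1"
  shows "edges G \<noteq> {}"
proof -
  obtain v where "v \<in> verts G" using assms(1) by (auto simp: connected_graph_def)
  then have "card (boundary G {v}) = r" using assms(2) by (auto simp: r_graph_def regular_graph_def)
  then show ?thesis using assms(3) boundary_subset[of G "{v}"] by auto
qed

locale inflate_coloring =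
  fixes K :: "('w, 'f) multigraph" and G :: "('v, 'e) multigraph" and m :: nat
    and f :: "'e \<times> nat \<times> nat \<Rightarrow> 'f" and \<phi> :: "'v + 'e \<times> nat \<Rightarrow> 'w"
  assumes m: "m \<ge> 1" and cK: "connected_graph K" and rK: "r_graph (m + 2) K"
    and cG: "connected_graph G" and rG: "r_graph (m + 2) G"
    and star: "\<And>u. u \<in> verts (inflate m G) \<Longrightarrow>
      \<phi> u \<in> verts K \<and> bij_betw f (boundary (inflate m G) {u}) (boundary K {\<phi> u})"
begin

lemma gG: "graph G" and gK: "graph K"
  using rG rK by (simp_all add: r_graph_def)

text \<open>The condition \<open>outer\<close> is the one with content. The gadget has ten vertices
  and exactly two edges leaving it, so by parity a pulled-back perfect matching contains both or
  neither.\<close>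

lemma gadget_coloring:
  assumes x: "x \<in> edges G"
  shows "gadget_coloring K m (\<lambda>i. \<phi> (Inr (x, i))) (\<lambda>i g. f (gadget_edge x i g))"
proof
  show "r_graph (m + 2) K" "m \<ge> 1" by (rule rK, rule m)
  fix i :: nat assume i: "i < 10"
  then have v: "Inr (x, i) \<in> verts (inflate m G)" using x by (simp add: inflate_simps)
  show "\<phi> (Inr (x, i)) \<in> verts K" using star[OF v] by simp
  have "bij_betw (f \<circ> gadget_edge x i) (boundary (fat_petersen m) {i}) (boundary K {\<phi> (Inr (x, i))})"
    using gadget_edge_bij[OF gG m x i] star[OF v] by (blast intro: bij_betw_trans)
  then show "bij_betw (\<lambda>g. f (gadget_edge x i g)) (boundary (fat_petersen m) {i}) (boundary K {\<phi> (Inr (x, i))})"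
    by (simp add: comp_def)
next
  fix g :: "nat \<times> nat" and i j :: nat assume "g \<noteq> (0, 0)"
  then show "f (gadget_edge x i g) = f (gadget_edge x j g)" by (simp add: gadget_edge_def)
next
  fix N assume N: "perfect_matching K N"
  let ?N = "{e \<in> edges (inflate m G). f e \<in> N}"
  let ?X = "(\<lambda>i. Inr (x, i)) ` {..<10} :: ('v + 'e \<times> nat) set"
  have pm: "perfect_matching (inflate m G) ?N" by (rule perfect_matching_preimage[OF N star])
  have X: "?X \<subseteq> verts (inflate m G)" using x by (auto simp: inflate_simps)
  have "card ?X = 10" by (subst card_image) (auto simp: inj_on_def)
  then have ev: "even (card (?N \<inter> boundary (inflate m G) ?X))"
    using perfect_matching_even[OF graph_inflate[OF gG] pm X] by simp
  have bd: "boundary (inflate m G) ?X = {(x, (15, 0)), (x, (16, 0))}"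
  proof (intro equalityI subsetI)
    fix e assume e: "e \<in> boundary (inflate m G) ?X"
    obtain u v where uv: "ends (inflate m G) e = {u, v}" "u \<in> ?X" "v \<notin> ?X"
      using boundary_obtain[OF graph_inflate[OF gG] e] .
    obtain i where i: "u = Inr (x, i)" "i < 10" using uv(2) by auto
    from boundary_edge[OF e] show "e \<in> {(x, (15, 0)), (x, (16, 0))}"
    proof (cases rule: inflate_edge_cases)
      case (1 y)
      then show ?thesis using uv(1) i by (auto simp: inflate_simps doubleton_eq_iff)
    next
      case (2 y)
      then show ?thesis using uv(1) i by (auto simp: inflate_simps doubleton_eq_iff)
    next
      case (3 y g)
      then have e: "(\<lambda>j. Inr (y, j)) ` pos_ends (fst g) = {u, v}" using uv(1) by (simp add: inflate_simps)
      have "v \<in> (\<lambda>j. Inr (y, j)) ` pos_ends (fst g)" "u \<in> (\<lambda>j. Inr (y, j)) ` pos_ends (fst g)"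
        unfolding e by simp_all
      then obtain j j' where "v = Inr (y, j)" "j \<in> pos_ends (fst g)" and u': "u = Inr (y, j')" by blast
      moreover have "y = x" using u' i(1) by simp
      moreover have "pos_ends (fst g) \<subseteq> {..<10}" using 3(2) pos_ends_card[of "fst g"] by (auto simp: fat_petersen_simps)
      ultimately show ?thesis using uv(3) by blast
    qed
  next
    fix e :: "'e \<times> nat \<times> nat" assume e: "e \<in> {(x, (15, 0)), (x, (16, 0))}"
    have m15: "(x, (15, 0)) \<in> boundary (inflate m G) ?X"
      by (subst mem_boundary[of _ _ "Inl (tail G x)" "Inr (x, 0)"]) (use x in \<open>auto simp: inflate_simps\<close>)
    have m16: "(x, (16, 0)) \<in> boundary (inflate m G) ?X"
      by (subst mem_boundary[of _ _ "Inl (head G x)" "Inr (x, 1)"]) (use x in \<open>auto simp: inflate_simps\<close>)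
    show "e \<in> boundary (inflate m G) ?X" using e m15 m16 by blast
  qed
  have E: "(x, (15, 0)) \<in> edges (inflate m G)" "(x, (16, 0)) \<in> edges (inflate m G)"
    using x by (simp_all add: inflate_simps)
  show "f (gadget_edge x 0 (0, 0)) \<in> N \<longleftrightarrow> f (gadget_edge x 1 (0, 0)) \<in> N"
  proof (rule ccontr)
    assume "\<not> ?thesis"
    then have "?N \<inter> {(x, (15, 0)), (x, (16, 0))} = {(x, (15, 0))} \<or> ?N \<inter> {(x, (15, 0)), (x, (16, 0))} = {(x, (16, 0))}"
      using E by (auto simp: gadget_edge_def)
    then have "card (?N \<inter> {(x, (15, 0)), (x, (16, 0))}) = 1" by auto
    then show False using ev bd by simp
  qed
qed

definition copy :: "'e \<Rightarrow> 'w set" where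
  "copy x = (\<lambda>i. \<phi> (Inr (x, i))) ` {..<10}"

lemma copy_facts:
  assumes x: "x \<in> edges G"
  shows "copy x \<subseteq> verts K" "card (copy x) = 10"
    and "f (x, (15, 0)) \<noteq> f (x, (16, 0)) \<Longrightarrow> boundary K (copy x) = {f (x, (15, 0)), f (x, (16, 0))}"
proof -
  interpret g: gadget_coloring K m "\<lambda>i. \<phi> (Inr (x, i))" "\<lambda>i g. f (gadget_edge x i g)"
    by (rule gadget_coloring[OF x])
  show "copy x \<subseteq> verts K" "card (copy x) = 10" unfolding copy_def by (rule g.W_subset, rule g.card_W)
  assume "f (x, (15, 0)) \<noteq> f (x, (16, 0))"
  then show "boundary K (copy x) = {f (x, (15, 0)), f (x, (16, 0))}"
    using g.boundary_W_split by (simp add: copy_def gadget_edge_def)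
qed

lemma link_star:
  assumes v: "v \<in> verts G"
  shows "\<phi> (Inl v) \<in> verts K \<and> bij_betw (\<lambda>x. f (link G v x)) (boundary G {v}) (boundary K {\<phi> (Inl v)})"
proof -
  have i: "Inl v \<in> verts (inflate m G)" using v by (simp add: inflate_simps)
  have "bij_betw (f \<circ> link G v) (boundary G {v}) (boundary K {\<phi> (Inl v)})"
    using link_bij[OF gG, of v m] star[OF i] by (blast intro: bij_betw_trans)
  then show ?thesis using star[OF i] by (simp add: comp_def)
qed

text \<open>One gadget with equal halves fills all of \<open>K\<close>, which then has ten vertices.
  Every other image also has ten vertices, so it fills \<open>K\<close> and has an empty cut; hence
  all gadgets have equal halves, and reading a half of each gives a colouring of
  \<open>G\<close>.\<close>

lemma folded:
  assumes x: "x \<in> edges G" and eq: "f (x, (15, 0)) = f (x, (16, 0))"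
  shows "isomorphic (fat_petersen m) K" "m = 1" "colors K G"
proof -
  have fold: "f (y, (15, 0)) = f (y, (16, 0))" if y: "y \<in> edges G" for y
  proof (rule ccontr)
    assume ne: "f (y, (15, 0)) \<noteq> f (y, (16, 0))"
    interpret g: gadget_coloring K m "\<lambda>i. \<phi> (Inr (x, i))" "\<lambda>i g. f (gadget_edge x i g)"
      by (rule gadget_coloring[OF x])
    have "copy x = verts K" unfolding copy_def by (rule g.W_all) (use eq cK in \<open>simp_all add: gadget_edge_def\<close>)
    then have "copy y = verts K"
      using copy_facts(1,2)[OF y] copy_facts(2)[OF x] card_subset_eq[of "verts K" "copy y"] gK
      by (simp add: graph_def)
    moreover have "boundary K (verts K) = {}"
      using boundary_obtain[OF gK, of _ "verts K"] by (metis equals0I)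
    ultimately show False using copy_facts(3)[OF y ne] by simp
  qed
  have lnk: "f (link G v y) = f (y, (15, 0))" if "y \<in> edges G" for v y
    using fold[OF that] by (simp add: link_def)
  interpret g: gadget_coloring K m "\<lambda>i. \<phi> (Inr (x, i))" "\<lambda>i g. f (gadget_edge x i g)"
    by (rule gadget_coloring[OF x])
  have eqx: "f (gadget_edge x 0 (0, 0)) = f (gadget_edge x 1 (0, 0))" using eq by (simp add: gadget_edge_def)
  show "isomorphic (fat_petersen m) K" by (rule g.fat_petersen_isomorphic[OF eqx cK])
  show "m = 1"
  proof (rule ccontr)
    assume "m \<noteq> 1"
    then have m2: "m \<ge> 2" using m by simp
    obtain v where v: "v \<in> verts G" using cG by (auto simp: connected_graph_def)
    \<comment> \<open>In a fat Petersen graph with \<open>m \<ge> 2\<close> every vertex has an edge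
      with a parallel one. At the image of an original vertex this edge is the colour of a
      half-edge, which has no parallel.\<close>
    obtain a b where ab: "a \<in> boundary K {\<phi> (Inl v)}" "b \<in> edges K" "a \<noteq> b" "ends K b = ends K a"
      using g.parallel_at[OF eqx cK m2, of "\<phi> (Inl v)"] link_star[OF v] by blast
    then obtain y where y: "y \<in> boundary G {v}" "a = f (link G v y)"
      using link_star[OF v] unfolding bij_betw_def by blast
    have yE: "y \<in> edges G" by (rule boundary_edge[OF y(1)])
    interpret h: gadget_coloring K m "\<lambda>i. \<phi> (Inr (y, i))" "\<lambda>i g. f (gadget_edge y i g)"
      by (rule gadget_coloring[OF yE])
    have eqy: "f (gadget_edge y 0 (0, 0)) = f (gadget_edge y 1 (0, 0))"
      using fold[OF yE] by (simp add: gadget_edge_def)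
    have "a = f (gadget_edge y 0 (0, 0))" using lnk[OF yE] y(2) by (simp add: gadget_edge_def)
    then show False using h.no_parallel[OF eqy cK ab(2)] ab(3,4) by simp
  qed
  have "is_coloring K G (\<lambda>y. f (y, (15, 0)))"
  proof (rule is_coloringI[OF gG])
    fix v assume v: "v \<in> verts G"
    have "bij_betw (\<lambda>y. f (y, (15, 0))) (boundary G {v}) (boundary K {\<phi> (Inl v)})"
      using link_star[OF v] lnk boundary_edge[of _ G "{v}"]
      by (subst bij_betw_cong[of _ _ "\<lambda>y. f (link G v y)"]) auto
    then show "\<exists>u\<in>verts K. bij_betw (\<lambda>y. f (y, (15, 0))) (boundary G {v}) (boundary K {u})"
      using link_star[OF v] by blast
  qed
  then show "colors K G" by (auto simp: colors_def)
qed

section \<open>Gadgets whose halves have different colours\<close>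

context
  assumes unfolded: "\<And>x. x \<in> edges G \<Longrightarrow> f (x, (15, 0)) \<noteq> f (x, (16, 0))"
begin

text \<open>\<open>copy y\<close> is bounded by two edges, and at least two of its boundary edges
  lie inside \<open>copy x\<close>; so these are all. A third one, which exists if both half-edges
  of \<open>x\<close> start on the same side of \<open>copy y\<close>, is impossible.\<close>

lemma copy_crossing:
  assumes x: "x \<in> edges G" and y: "y \<in> edges G" and i: "copy x \<inter> copy y \<noteq> {}" and n: "\<not> copy x \<subseteq> copy y"
  shows "\<forall>a\<in>boundary K (copy y). ends K a \<subseteq> copy x"
    and "(\<phi> (Inr (x, 0)) \<in> copy y) \<noteq> (\<phi> (Inr (x, 1)) \<in> copy y)"
proof -
  interpret g: gadget_coloring K m "\<lambda>i. \<phi> (Inr (x, i))" "\<lambda>i g. f (gadget_edge x i g)"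
    by (rule gadget_coloring[OF x])
  let ?I = "{a \<in> boundary K (copy y). ends K a \<subseteq> copy x}"
  note cr = g.W_crossing[of "copy y", folded copy_def, OF i n]
  have c2: "card (boundary K (copy y)) = 2" using copy_facts(3)[OF y] unfolded[OF y] by simp
  have f: "finite (boundary K (copy y))" by (rule finite_boundary[OF gK])
  have le: "card ?I \<le> card (boundary K (copy y))" by (rule card_mono[OF f]) auto
  then have "?I = boundary K (copy y)" using card_subset_eq[OF f, of ?I] cr(1) c2 by auto
  then show "\<forall>a\<in>boundary K (copy y). ends K a \<subseteq> copy x" by blast
  show "(\<phi> (Inr (x, 0)) \<in> copy y) \<noteq> (\<phi> (Inr (x, 1)) \<in> copy y)" using cr(2) le c2 by auto
qed

text \<open>Exchanging the roles of \<open>x\<close> and \<open>y\<close> puts both boundary edges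
  of \<open>copy x\<close> inside \<open>copy y\<close>. Then both half-edges of \<open>x\<close>
  start in \<open>copy y\<close>, although exactly one of them should.\<close>

lemma copies_disjoint:
  assumes x: "x \<in> edges G" and y: "y \<in> edges G" and i: "copy x \<inter> copy y \<noteq> {}"
  shows "copy x = copy y"
proof (rule ccontr)
  assume ne: "copy x \<noteq> copy y"
  have fin: "finite (copy z)" for z by (simp add: copy_def)
  have n: "\<not> copy x \<subseteq> copy y" "\<not> copy y \<subseteq> copy x"
    using card_subset_eq[OF fin] copy_facts(2)[OF x] copy_facts(2)[OF y] ne by metis+
  have i': "copy y \<inter> copy x \<noteq> {}" using i by blast
  interpret g: gadget_coloring K m "\<lambda>i. \<phi> (Inr (x, i))" "\<lambda>i g. f (gadget_edge x i g)"
    by (rule gadget_coloring[OF x])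
  have h: "ends K (f (x, (15, 0))) \<subseteq> copy y" "ends K (f (x, (16, 0))) \<subseteq> copy y"
    using copy_crossing(1)[OF y x i' n(2)] copy_facts(3)[OF x unfolded[OF x]] by auto
  have "\<phi> (Inr (x, 0)) \<in> ends K (f (x, (15, 0)))" "\<phi> (Inr (x, 1)) \<in> ends K (f (x, (16, 0)))"
    using g.half_edge[of 0] g.half_edge[of 1] unfolded[OF x] by (auto simp: gadget_edge_def)
  then show False using copy_crossing(2)[OF x y i n(1)] h by blast
qed

text \<open>Every edge at the image of an original vertex is the colour of a half-edge and so bounds
  some \<open>copy y\<close>. But each vertex of \<open>copy x\<close> has an edge inside
  \<open>copy x\<close>; that edge cannot bound \<open>copy y\<close>, which is equal to or disjoint
  from \<open>copy x\<close>.\<close>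

lemma original_outside_copy:
  assumes v: "v \<in> verts G" and x: "x \<in> edges G"
  shows "\<phi> (Inl v) \<notin> copy x"
proof
  assume "\<phi> (Inl v) \<in> copy x"
  then obtain j where j: "j < 10" "\<phi> (Inl v) = \<phi> (Inr (x, j))" by (auto simp: copy_def)
  interpret g: gadget_coloring K m "\<lambda>i. \<phi> (Inr (x, i))" "\<lambda>i g. f (gadget_edge x i g)"
    by (rule gadget_coloring[OF x])
  \<comment> \<open>A vertex has two cycle edges, so one of them is not the opened edge at position
    0.\<close>
  obtain p where p: "p < 10" "p \<noteq> 0" "j \<in> pos_ends p"
    using pos_ends_cycle_two[OF j(1)] by metis
  let ?a = "f (gadget_edge x j (p, 0))"
  have p15: "p < 15" "0 < mult m p" using p by (simp_all add: mult_def)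
  have aj: "?a \<in> boundary K {\<phi> (Inr (x, j))}" by (rule g.lab_in[OF p15 p(3)])
  have "ends K ?a = (\<lambda>i. \<phi> (Inr (x, i))) ` pos_ends p" using g.lab_ends[OF p15 p(3)] p(2) by simp
  then have ax: "ends K ?a \<subseteq> copy x" using pos_ends_card[OF p15(1)] by (auto simp: copy_def)
  obtain y where y: "y \<in> boundary G {v}" "?a = f (link G v y)"
    using link_star[OF v] aj j(2) unfolding bij_betw_def by (metis imageE)
  have yE: "y \<in> edges G" by (rule boundary_edge[OF y(1)])
  have "?a \<in> boundary K (copy y)"
    using copy_facts(3)[OF yE unfolded[OF yE]] y(2) by (simp add: link_def)
  then obtain u w where uw: "ends K ?a = {u, w}" "u \<in> copy y" "w \<notin> copy y"
    using boundary_obtain[OF gK] by metis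
  then have "copy x = copy y" using copies_disjoint[OF x yE] ax by blast
  then show False using uw ax by blast
qed

lemma smaller_coloring:
  "\<exists>L :: ('w, 'f) multigraph. connected_graph L \<and> r_graph (m + 2) L \<and> colors L G \<and> card (verts L) < card (verts K)"
proof -
  have cut: "f (link G s x) = f (link G t x) \<or> (\<exists>W\<subseteq>verts K. boundary K W = {f (link G s x), f (link G t x)} \<and>
      W \<inter> (\<lambda>v. \<phi> (Inl v)) ` verts G = {})" if x: "x \<in> edges G" "ends G x = {s, t}" for x s t
  proof (intro disjI2 exI conjI)
    show "copy x \<subseteq> verts K" by (rule copy_facts(1)[OF x(1)])
    have "{s, t} = {tail G x, head G x}" "tail G x \<noteq> head G x" using tail_head(1,2)[OF gG x(1)] x(2) by auto
    then have "{f (link G s x), f (link G t x)} = {f (x, (15, 0)), f (x, (16, 0))}"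
      by (auto simp: doubleton_eq_iff link_def)
    then show "boundary K (copy x) = {f (link G s x), f (link G t x)}"
      using copy_facts(3)[OF x(1) unfolded[OF x(1)]] by simp
    show "copy x \<inter> (\<lambda>v. \<phi> (Inl v)) ` verts G = {}" using original_outside_copy[OF _ x(1)] by blast
  qed
  have r3: "m + 2 \<ge> 3" using m by simp
  obtain L :: "('w, 'f) multigraph" where L: "connected_graph L" "r_graph (m + 2) L" "colors L G"
    "(\<exists>x\<in>edges G. \<exists>s t. ends G x = {s, t} \<and> f (link G s x) \<noteq> f (link G t x)) \<longrightarrow> card (verts L) < card (verts K)"
    using reduce_two_edge_cuts[OF r3 gG cK rK link_star cut] by blast
  obtain x where x: "x \<in> edges G" using edges_nonempty[OF cG rG] m by auto
  have "f (link G (tail G x) x) \<noteq> f (link G (head G x) x)"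
    using unfolded[OF x] tail_head(2)[OF gG x] by (simp add: link_def)
  then show ?thesis using L tail_head(1)[OF gG x] x by blast
qed

end

end

section \<open>Isomorphic copies\<close>

lemma isomorphic_boundary_set:
  assumes "graph G" and phi: "bij_betw \<phi> (verts G) (verts H)"
    and psi: "bij_betw \<psi> (edges G) (edges H)"
    and e: "\<forall>e\<in>edges G. ends H (\<psi> e) = \<phi> ` ends G e" and X: "X \<subseteq> verts G"
  shows "\<psi> ` boundary G X = boundary H (\<phi> ` X)"
proof -
  have eq: "card (ends H (\<psi> x) \<inter> \<phi> ` X) = card (ends G x \<inter> X)" if x: "x \<in> edges G" for x
  proof -
    have s: "ends G x \<subseteq> verts G" using assms(1) x by (simp add: graph_def)
    have inj: "inj_on \<phi> (verts G)" using phi by (simp add: bij_betw_def)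
    have "ends H (\<psi> x) \<inter> \<phi> ` X = \<phi> ` (ends G x \<inter> X)"
      using e x inj_on_image_Int[OF inj s X] by simp
    moreover have "inj_on \<phi> (ends G x \<inter> X)" using inj s by (meson inf.coboundedI1 inj_on_subset)
    ultimately show ?thesis by (simp add: card_image)
  qed
  have im: "edges H = \<psi> ` edges G" using psi by (auto simp: bij_betw_def)
  show ?thesis unfolding boundary_def im using eq by auto
qed

lemma isomorphic_graph:
  assumes G: "graph G" and iso: "isomorphic G H"
  shows "graph H"
proof -
  obtain \<phi> \<psi> where i: "bij_betw \<phi> (verts G) (verts H)" "bij_betw \<psi> (edges G) (edges H)"
    "\<forall>e\<in>edges G. ends H (\<psi> e) = \<phi> ` ends G e" using iso by (auto simp: isomorphic_def)
  show ?thesis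
    unfolding graph_def
  proof (intro conjI ballI)
    show "finite (verts H)" "finite (edges H)"
      using i(1,2) G bij_betw_finite by (auto simp: graph_def)
    fix e' assume "e' \<in> edges H"
    then obtain e where e: "e \<in> edges G" "e' = \<psi> e" using i(2) by (auto simp: bij_betw_def)
    have s: "ends G e \<subseteq> verts G" "card (ends G e) = 2" using G e by (auto simp: graph_def)
    have "inj_on \<phi> (ends G e)" using i(1) s(1) by (meson bij_betw_def inj_on_subset)
    moreover have "ends H e' = \<phi> ` ends G e" "verts H = \<phi> ` verts G"
      using i(1,3) e by (auto simp: bij_betw_def)
    ultimately show "ends H e' \<subseteq> verts H" "card (ends H e') = 2"
      using s by (simp_all add: image_mono card_image)
  qed
qed

lemma isomorphic_connected_r_graph:
  assumes c: "connected_graph G" and rG: "r_graph r G" and iso: "isomorphic G H"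
  shows "connected_graph H" "r_graph r H"
proof -
  have G: "graph G" using rG by (simp add: r_graph_def)
  have H: "graph H" by (rule isomorphic_graph[OF G iso])
  obtain \<phi> \<psi> where i: "bij_betw \<phi> (verts G) (verts H)" "bij_betw \<psi> (edges G) (edges H)"
    "\<forall>e\<in>edges G. ends H (\<psi> e) = \<phi> ` ends G e" using iso by (auto simp: isomorphic_def)
  have cut: "\<exists>X\<subseteq>verts G. Y = \<phi> ` X \<and> card X = card Y \<and> card (boundary G X) = card (boundary H Y)"
    if Y: "Y \<subseteq> verts H" for Y
  proof -
    define X where "X = {v \<in> verts G. \<phi> v \<in> Y}"
    have X: "X \<subseteq> verts G" "Y = \<phi> ` X" using Y i(1) by (auto simp: X_def bij_betw_def)
    have "inj_on \<phi> X" using i(1) X(1) by (meson bij_betw_def inj_on_subset)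
    then have "card X = card Y" using X(2) by (simp add: card_image)
    moreover have "inj_on \<psi> (boundary G X)" using i(2) boundary_subset by (meson bij_betw_def inj_on_subset)
    then have "card (\<psi> ` boundary G X) = card (boundary G X)" by (rule card_image)
    then have "card (boundary G X) = card (boundary H Y)"
      unfolding isomorphic_boundary_set[OF G i X(1)] X(2)[symmetric] by simp
    ultimately show ?thesis using X by blast
  qed
  show "connected_graph H"
    unfolding connected_graph_iff_boundary[OF H]
  proof (intro conjI allI impI)
    show "verts H \<noteq> {}" using c i(1) by (auto simp: connected_graph_def bij_betw_def)
    fix Y assume Y: "Y \<subseteq> verts H \<and> Y \<noteq> {} \<and> Y \<noteq> verts H"
    obtain X where X: "X \<subseteq> verts G" "Y = \<phi> ` X" "card (boundary G X) = card (boundary H Y)"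
      using cut[OF conjunct1[OF Y]] by blast
    have "X \<noteq> {}" "X \<noteq> verts G" using X(2) Y i(1) by (auto simp: bij_betw_def)
    then have "boundary G X \<noteq> {}" using c X(1) connected_graph_iff_boundary[OF G] by blast
    then have "card (boundary G X) \<noteq> 0" using finite_boundary[OF G] by simp
    then show "boundary H Y \<noteq> {}" using X(3) by auto
  qed
  have "card (boundary H {u}) = r" if "u \<in> verts H" for u
  proof -
    have "{u} \<subseteq> verts H" using that by simp
    from cut[OF this] obtain X where X: "X \<subseteq> verts G" "card X = card {u}"
      "card (boundary G X) = card (boundary H {u})" by blast
    then obtain v where "X = {v}" by (metis card.empty card_1_singletonE card_insert_disjoint finite.emptyI empty_iff One_nat_def)
    then show ?thesis using X rG by (auto simp: r_graph_def regular_graph_def)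
  qed
  moreover have "r \<le> card (boundary H Y)" if Y: "Y \<subseteq> verts H" "odd (card Y)" for Y
  proof -
    obtain X where X: "X \<subseteq> verts G" "card X = card Y" "card (boundary G X) = card (boundary H Y)"
      using cut[OF Y(1)] by blast
    then show ?thesis using rG Y(2) by (metis r_graph_def)
  qed
  ultimately show "r_graph r H" using H by (auto simp: r_graph_def regular_graph_def)
qed

lemma isomorphic_sym:
  assumes G: "graph G" and iso: "isomorphic G H"
  shows "isomorphic H G"
proof -
  obtain \<phi> \<psi> where i: "bij_betw \<phi> (verts G) (verts H)" "bij_betw \<psi> (edges G) (edges H)"
    "\<forall>e\<in>edges G. ends H (\<psi> e) = \<phi> ` ends G e" using iso by (auto simp: isomorphic_def)
  let ?\<phi> = "inv_into (verts G) \<phi>" and ?\<psi> = "inv_into (edges G) \<psi>"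
  have "ends G (?\<psi> e') = ?\<phi> ` ends H e'" if e': "e' \<in> edges H" for e'
  proof -
    obtain e where e: "e \<in> edges G" "e' = \<psi> e" using i(2) e' by (auto simp: bij_betw_def)
    have "?\<psi> e' = e" using e i(2) by (simp add: bij_betw_def)
    moreover have "?\<phi> ` \<phi> ` ends G e = ends G e"
      using i(1) G e by (intro inv_into_image_cancel) (auto simp: bij_betw_def graph_def)
    ultimately show ?thesis using i(3) e by simp
  qed
  then show ?thesis
    unfolding isomorphic_def using bij_betw_inv_into[OF i(1)] bij_betw_inv_into[OF i(2)] by blast
qed

lemma isomorphic_trans:
  assumes G: "graph G" and 1: "isomorphic G H" and 2: "isomorphic H L"
  shows "isomorphic G L"
proof -
  obtain \<phi> \<psi> where i: "bij_betw \<phi> (verts G) (verts H)" "bij_betw \<psi> (edges G) (edges H)"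
    "\<forall>e\<in>edges G. ends H (\<psi> e) = \<phi> ` ends G e" using 1 by (auto simp: isomorphic_def)
  obtain \<phi>' \<psi>' where j: "bij_betw \<phi>' (verts H) (verts L)" "bij_betw \<psi>' (edges H) (edges L)"
    "\<forall>e\<in>edges H. ends L (\<psi>' e) = \<phi>' ` ends H e" using 2 by (auto simp: isomorphic_def)
  have "\<forall>e\<in>edges G. ends L ((\<psi>' \<circ> \<psi>) e) = (\<phi>' \<circ> \<phi>) ` ends G e"
  proof
    fix e assume e: "e \<in> edges G"
    then have "\<psi> e \<in> edges H" using i(2) by (auto simp: bij_betw_def)
    then show "ends L ((\<psi>' \<circ> \<psi>) e) = (\<phi>' \<circ> \<phi>) ` ends G e" using e i(3) j(3) by (simp add: image_comp)
  qed
  then show ?thesis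
    unfolding isomorphic_def using bij_betw_trans[OF i(1) j(1)] bij_betw_trans[OF i(2) j(2)] by blast
qed

lemma colors_isomorphic:
  assumes G: "graph G" and iso: "isomorphic G H" and c: "colors K H"
  shows "colors K G"
proof -
  have H: "graph H" by (rule isomorphic_graph[OF G iso])
  obtain \<phi> \<psi> where i: "bij_betw \<phi> (verts G) (verts H)" "bij_betw \<psi> (edges G) (edges H)"
    "\<forall>e\<in>edges G. ends H (\<psi> e) = \<phi> ` ends G e" using iso by (auto simp: isomorphic_def)
  obtain f where "is_coloring K H f" using c by (auto simp: colors_def)
  then obtain \<chi> where chi: "\<forall>v\<in>verts H. \<chi> v \<in> verts K \<and> bij_betw f (boundary H {v}) (boundary K {\<chi> v})"
    using is_coloring_star[OF H] by blast
  have "is_coloring K G (f \<circ> \<psi>)"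
  proof (rule is_coloringI[OF G])
    fix v assume v: "v \<in> verts G"
    have w: "\<phi> v \<in> verts H" using i(1) v by (auto simp: bij_betw_def)
    have "\<psi> ` boundary G {v} = boundary H {\<phi> v}" by (rule isomorphic_boundary[OF G i v])
    moreover have "inj_on \<psi> (boundary G {v})" using i(2) boundary_subset by (meson bij_betw_def inj_on_subset)
    ultimately have "bij_betw \<psi> (boundary G {v}) (boundary H {\<phi> v})" by (simp add: bij_betw_def)
    then have "bij_betw (f \<circ> \<psi>) (boundary G {v}) (boundary K {\<chi> (\<phi> v)})"
      using chi w by (blast intro: bij_betw_trans)
    then show "\<exists>u\<in>verts K. bij_betw (f \<circ> \<psi>) (boundary G {v}) (boundary K {u})" using chi w by blast
  qed
  then show ?thesis by (auto simp: colors_def)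
qed

lemma nat_copy:
  assumes G: "graph (G :: ('v, 'e) multigraph)"
  shows "\<exists>H :: (nat, nat) multigraph. isomorphic G H"
proof -
  have f: "finite (verts G)" "finite (edges G)" using G by (auto simp: graph_def)
  obtain \<phi> :: "'v \<Rightarrow> nat" where phi: "inj_on \<phi> (verts G)" using finite_imp_inj_to_nat_seg[OF f(1)] by blast
  obtain \<psi> :: "'e \<Rightarrow> nat" where psi: "inj_on \<psi> (edges G)" using finite_imp_inj_to_nat_seg[OF f(2)] by blast
  let ?H = "\<lparr>verts = \<phi> ` verts G, edges = \<psi> ` edges G,
    ends = (\<lambda>e. \<phi> ` ends G (inv_into (edges G) \<psi> e))\<rparr> :: (nat, nat) multigraph"
  have "isomorphic G ?H"
    unfolding isomorphic_def by (rule exI[of _ \<phi>], rule exI[of _ \<psi>]) (use phi psi in \<open>auto simp: bij_betw_def\<close>)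
  then show ?thesis by blast
qed

text \<open>Completeness speaks of graphs on natural numbers, whereas inflating a graph changes its
  types.\<close>

lemma nat_copy_r_graph:
  assumes "connected_graph (G :: ('v, 'e) multigraph)" "r_graph r G"
  shows "\<exists>H :: (nat, nat) multigraph. connected_graph H \<and> r_graph r H \<and> isomorphic G H"
proof -
  have "graph G" using assms(2) by (simp add: r_graph_def)
  then obtain H :: "(nat, nat) multigraph" where H: "isomorphic G H" using nat_copy by blast
  show ?thesis using isomorphic_connected_r_graph[OF assms H] H by blast
qed

text \<open>The vertex of the Kneser graph corresponding to a vertex of the fat Petersen graph: in terms of
  residues modulo 5, the pairs \<open>{2i, 2i + 1}\<close> form the outer cycle, and \<open>{2i + 2, 2i + 4}\<close> is the
  neighbour of \<open>{2i, 2i + 1}\<close> on the inner one.\<close>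

definition kneser :: "nat \<Rightarrow> nat set" where
  "kneser i = (if i < 5 then {2 * i mod 5, (2 * i + 1) mod 5} else {(2 * i + 2) mod 5, (2 * i + 4) mod 5})"

lemma kneser_inj: "inj_on kneser {..<10}"
proof (rule inj_onI)
  fix i j :: nat assume "i \<in> {..<10}" "j \<in> {..<10}" "kneser i = kneser j"
  then show "i = j"
    using map_distinct_inj[of kneser 10 i j] by (simp add: upt_rec kneser_def doubleton_eq_iff)
qed

lemma kneser_pair: "i < 10 \<Longrightarrow> kneser i \<subseteq> {..<5} \<and> card (kneser i) = 2"
proof -
  have "\<forall>i<10. kneser i \<subseteq> {..<5} \<and> card (kneser i) = 2"
    unfolding all_less_10 by (simp add: kneser_def)
  then show "i < 10 \<Longrightarrow> ?thesis" by simp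
qed

lemma kneser_surj:
  assumes "X \<subseteq> {..<5}" "card X = 2"
  shows "\<exists>i<10. X = kneser i"
proof -
  obtain a b where ab: "X = {a, b}" "a \<noteq> b" using assms(2) by (auto simp: card_2_iff)
  have l: "a < 5" "b < 5" using assms(1) ab by auto
  have k: "kneser 0 = {0, 1}" "kneser 1 = {2, 3}" "kneser 2 = {4, 0}" "kneser 3 = {1, 2}" "kneser 4 = {3, 4}"
    "kneser 5 = {2, 4}" "kneser 6 = {4, 1}" "kneser 7 = {1, 3}" "kneser 8 = {3, 0}" "kneser 9 = {0, 2}"
    by (simp_all add: kneser_def)
  have "\<forall>a<5. \<forall>b<5. a \<noteq> b \<longrightarrow> {a, b} \<in> {kneser 0, kneser 1, kneser 2, kneser 3, kneser 4, kneser 5,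
      kneser 6, kneser 7, kneser 8, kneser 9}"
    unfolding k all_less_5 by (simp add: doubleton_eq_iff)
  then have "X \<in> {kneser 0, kneser 1, kneser 2, kneser 3, kneser 4, kneser 5, kneser 6, kneser 7, kneser 8, kneser 9}"
    using l ab by simp
  then have "\<exists>i\<in>{0, 1, 2, 3, 4, 5, 6, 7, 8, 9}. X = kneser i" by blast
  then obtain i where i: "i \<in> {0, 1, 2, 3, 4, 5, 6, 7, 8, 9}" "X = kneser i" by blast
  have "i < 10" using i(1) by auto
  then show ?thesis using i(2) by blast
qed

lemma kneser_disjoint:
  assumes "i < 10" "j < 10"
  shows "kneser i \<inter> kneser j = {} \<longleftrightarrow> (\<exists>p<15. pos_ends p = {i, j})"
proof -
  have "i = 0 \<or> i = 1 \<or> i = 2 \<or> i = 3 \<or> i = 4 \<or> i = 5 \<or> i = 6 \<or> i = 7 \<or> i = 8 \<or> i = 9"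
    using assms(1) by arith
  then have "\<forall>j<10. kneser i \<inter> kneser j = {} \<longleftrightarrow> (\<exists>p<15. pos_ends p = {i, j})"
    unfolding all_less_10 ex_less_15
    by (elim disjE) (simp_all add: kneser_def pos_ends_def doubleton_eq_iff)
  then show ?thesis using assms(2) by simp
qed

lemma fat_petersen_1: "isomorphic (fat_petersen 1) petersen"
  unfolding isomorphic_def
proof (intro exI conjI ballI)
  let ?\<psi> = "\<lambda>e :: nat \<times> nat. kneser ` pos_ends (fst e)"
  have E: "e \<in> edges (fat_petersen 1) \<longleftrightarrow> fst e < 15 \<and> snd e = 0" for e
    by (cases e) (auto simp: fat_petersen_simps mult_def)
  show "bij_betw kneser (verts (fat_petersen 1)) (verts petersen)"
    unfolding bij_betw_def fat_petersen_simps(1)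
  proof
    show "inj_on kneser {..<10}" by (rule kneser_inj)
    show "kneser ` {..<10} = verts petersen"
    proof (intro equalityI subsetI)
      fix X assume "X \<in> kneser ` {..<10}"
      then show "X \<in> verts petersen" using kneser_pair by (auto simp: petersen_def)
    next
      fix X assume "X \<in> verts petersen"
      then have "X \<subseteq> {..<5}" "card X = 2" by (auto simp: petersen_def)
      then obtain i where "i < 10" "X = kneser i" using kneser_surj by blast
      then show "X \<in> kneser ` {..<10}" by simp
    qed
  qed
  have "inj_on ?\<psi> (edges (fat_petersen 1))"
  proof (rule inj_onI)
    fix e e' assume e: "e \<in> edges (fat_petersen 1)" "e' \<in> edges (fat_petersen 1)" "?\<psi> e = ?\<psi> e'"
    then have l: "fst e < 15" "fst e' < 15" "snd e = 0" "snd e' = 0" using E by auto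
    have pe: "pos_ends (fst e) = pos_ends (fst e')"
      using inj_on_image_eq_iff[OF kneser_inj, of "pos_ends (fst e)" "pos_ends (fst e')"]
        pos_ends_card[OF l(1)] pos_ends_card[OF l(2)] e(3) by simp
    obtain i j where ij: "pos_ends (fst e) = {i, j}" "i \<noteq> j"
      using pos_ends_card[OF l(1)] by (auto simp: card_2_iff)
    have "fst e = fst e'" by (rule pos_ends_inj[OF l(1,2) ij(2)]) (use ij pe in auto)
    then show "e = e'" using l by (simp add: prod_eq_iff)
  qed
  moreover have "?\<psi> ` edges (fat_petersen 1) = edges petersen"
  proof (intro equalityI subsetI)
    fix e' assume "e' \<in> ?\<psi> ` edges (fat_petersen 1)"
    then obtain e where e: "fst e < 15" "e' = ?\<psi> e" using E by auto
    obtain i j where ij: "pos_ends (fst e) = {i, j}" "i < 10" "j < 10"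
      using pos_ends_card[OF e(1)] by (auto simp: card_2_iff)
    have "kneser i \<inter> kneser j = {}" using kneser_disjoint[OF ij(2,3)] ij(1) e(1) by auto
    moreover have "e' = {kneser i, kneser j}" using e(2) ij(1) by simp
    ultimately show "e' \<in> edges petersen"
      using kneser_pair[OF ij(2)] kneser_pair[OF ij(3)] unfolding petersen_def by auto
  next
    fix e' assume "e' \<in> edges petersen"
    then obtain X Y where XY: "e' = {X, Y}" "X \<subseteq> {..<5}" "card X = 2" "Y \<subseteq> {..<5}" "card Y = 2" "X \<inter> Y = {}"
      unfolding petersen_def by auto
    obtain i where i: "i < 10" "X = kneser i" using kneser_surj[OF XY(2,3)] by blast
    obtain j where j: "j < 10" "Y = kneser j" using kneser_surj[OF XY(4,5)] by blast
    obtain p where p: "p < 15" "pos_ends p = {i, j}" using kneser_disjoint[OF i(1) j(1)] XY(6) i(2) j(2) by auto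
    have "e' = ?\<psi> (p, 0)" using p XY i j by simp
    then show "e' \<in> ?\<psi> ` edges (fat_petersen 1)" using E[of "(p, 0)"] p(1) by (intro image_eqI) auto
  qed
  ultimately show "bij_betw ?\<psi> (edges (fat_petersen 1)) (edges petersen)" by (simp add: bij_betw_def)
  fix e assume "e \<in> edges (fat_petersen 1)"
  show "ends petersen (?\<psi> e) = kneser ` ends (fat_petersen 1) e"
    by (simp add: petersen_def fat_petersen_simps)
qed

section \<open>From colourings to complete sets\<close>

text \<open>An ordinary colouring is a gadget colouring whose labels do not depend on the end, so
  the two halves agree trivially.\<close>

lemma colors_fat_petersen:
  assumes m: "m \<ge> 1" and K: "connected_graph K" "r_graph (m + 2) K" and c: "colors K (fat_petersen m)"
  shows "isomorphic (fat_petersen m) K"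
proof -
  obtain f where "is_coloring K (fat_petersen m) f" using c by (auto simp: colors_def)
  then obtain \<phi> where phi: "\<forall>v\<in>verts (fat_petersen m). \<phi> v \<in> verts K \<and>
      bij_betw f (boundary (fat_petersen m) {v}) (boundary K {\<phi> v})"
    using is_coloring_star[OF graph_fat_petersen] by blast
  interpret gadget_coloring K m \<phi> "\<lambda>i. f"
    using K m phi by unfold_locales (auto simp: fat_petersen_simps)
  show ?thesis by (rule fat_petersen_isomorphic[OF refl K(1)])
qed

lemma inflate_coloring_exists:
  assumes "m \<ge> 1" "connected_graph K" "r_graph (m + 2) K" "connected_graph G" "r_graph (m + 2) G"
    "colors K (inflate m G)"
  shows "\<exists>f \<phi>. inflate_coloring K G m f \<phi>"
proof -
  have G: "graph G" using assms(5) by (simp add: r_graph_def)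
  obtain f where "is_coloring K (inflate m G) f" using assms(6) by (auto simp: colors_def)
  then obtain \<phi> where "\<forall>v\<in>verts (inflate m G). \<phi> v \<in> verts K \<and>
      bij_betw f (boundary (inflate m G) {v}) (boundary K {\<phi> v})"
    using is_coloring_star[OF graph_inflate[OF G]] by blast
  then have "inflate_coloring K G m f \<phi>" using assms(1-5) by unfold_locales auto
  then show ?thesis by blast
qed

text \<open>An image of a gadget has ten vertices and thus fills the fat Petersen graph, leaving no
  edges to bound it; so the halves must agree. In contrapositive form, inflating preserves the
  property of not being coloured by this graph.\<close>

lemma fat_petersen_colors_inflate:
  assumes m: "m \<ge> 1" and G: "connected_graph G" "r_graph (m + 2) G"
    and c: "colors (fat_petersen m) (inflate m G)"
  shows "m = 1 \<and> colors (fat_petersen m) G"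
proof -
  obtain f \<phi> where "inflate_coloring (fat_petersen m) G m f \<phi>"
    using inflate_coloring_exists[OF m connected_fat_petersen[OF m] r_graph_fat_petersen[OF m] G c] by blast
  then interpret inflate_coloring "fat_petersen m" G m f \<phi> .
  obtain x where x: "x \<in> edges G" using edges_nonempty[OF G] m by auto
  have "f (x, (15, 0)) = f (x, (16, 0))"
  proof (rule ccontr)
    assume ne: "f (x, (15, 0)) \<noteq> f (x, (16, 0))"
    have "copy x = verts (fat_petersen m)"
      using card_subset_eq[of "verts (fat_petersen m)" "copy x"] copy_facts(1,2)[OF x]
      by (simp add: fat_petersen_simps)
    then have "boundary (fat_petersen m) (verts (fat_petersen m)) \<noteq> {}" using copy_facts(3)[OF x ne] by simp
    then obtain e where e: "e \<in> boundary (fat_petersen m) (verts (fat_petersen m))" by blast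
    then show False using boundary_obtain[OF graph_fat_petersen e] by metis
  qed
  then show ?thesis using folded(2,3)[OF x] by blast
qed

text \<open>A gadget with equal halves would force \<open>m = 1\<close> and make \<open>K\<close> a
  Petersen graph that colours \<open>G\<close>, against the last hypothesis. So every gadget has
  different halves and can be contracted.\<close>

lemma inflate_needs_more_vertices:
  fixes K :: "('w, 'f) multigraph"
  assumes m: "m \<ge> 1" and K: "connected_graph K" "r_graph (m + 2) K"
    and G: "connected_graph G" "r_graph (m + 2) G" and c: "colors K (inflate m G)"
    and n: "m = 1 \<longrightarrow> \<not> colors (fat_petersen m) G"
  shows "\<exists>L :: ('w, 'f) multigraph. connected_graph L \<and> r_graph (m + 2) L \<and> colors L G \<and> card (verts L) < card (verts K)"
proof -
  obtain f \<phi> where "inflate_coloring K G m f \<phi>" using inflate_coloring_exists[OF m K G c] by blast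
  then interpret inflate_coloring K G m f \<phi> .
  have "f (x, (15, 0)) \<noteq> f (x, (16, 0))" if x: "x \<in> edges G" for x
  proof
    assume eq: "f (x, (15, 0)) = f (x, (16, 0))"
    have "isomorphic K (fat_petersen m)" using isomorphic_sym[OF graph_fat_petersen folded(1)[OF x eq]] .
    then have "colors (fat_petersen m) G" using isomorphic_colors[OF _ gK folded(3)[OF x eq]] by blast
    then show False using n folded(2)[OF x eq] by blast
  qed
  then show ?thesis by (rule smaller_coloring)
qed

text \<open>Among the graphs \<open>G\<close> in question choose one for which the least number of vertices of a graph
  colouring \<open>G\<close> is as large as possible: inflating it would make this number larger.\<close>

lemma finite_complete_imp_colors:
  assumes m: "m \<ge> 1" and A: "r_complete (m + 2) A" "finite A"
    and G0: "connected_graph G0" "r_graph (m + 2) G0"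
  shows "m = 1 \<and> colors (fat_petersen m) (G0 :: (nat, nat) multigraph)"
proof (rule ccontr)
  assume n: "\<not> ?thesis"
  \<comment> \<open>For \<open>m \<ge> 2\<close> the implication holds vacuously and all connected
    graphs in question are good; for \<open>m = 1\<close> only those that the Petersen graph does
    not colour.\<close>
  define good :: "(nat, nat) multigraph \<Rightarrow> bool" where
    "good G \<longleftrightarrow> connected_graph G \<and> r_graph (m + 2) G \<and> (m = 1 \<longrightarrow> \<not> colors (fat_petersen m) G)" for G
  define size :: "(nat, nat) multigraph \<Rightarrow> nat \<Rightarrow> bool" where
    "size G k \<longleftrightarrow> (\<exists>K :: (nat, nat) multigraph. connected_graph K \<and> r_graph (m + 2) K \<and> colors K G \<and> card (verts K) = k)" for G k
  define c where "c G = (LEAST k. size G k)" for G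
  have complete: "\<forall>H\<in>A. connected_graph H \<and> r_graph (m + 2) H"
    "\<forall>G :: (nat, nat) multigraph. connected_graph G \<and> r_graph (m + 2) G \<longrightarrow> (\<exists>H\<in>A. colors H G)"
    by (rule conjunct1[OF A(1)[unfolded r_complete_def]], rule conjunct2[OF A(1)[unfolded r_complete_def]])
  have some: "\<exists>k \<le> Max ((card \<circ> verts) ` A). size G k" if "good G" for G
  proof -
    have "connected_graph G \<and> r_graph (m + 2) G" using that unfolding good_def by (elim conjE) (intro conjI)
    then have "\<exists>H\<in>A. colors H G" using complete(2) by simp
    then obtain H where H: "H \<in> A" "colors H G" ..
    have "connected_graph H \<and> r_graph (m + 2) H" using complete(1) H(1) by simp
    then have "size G (card (verts H))" unfolding size_def using H(2) by blast
    moreover have "card (verts H) \<le> Max ((card \<circ> verts) ` A)" using H(1) A(2) by (intro Max_ge) auto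
    ultimately show ?thesis by blast
  qed
  have cs: "size G (c G)" if "good G" for G using some[OF that] unfolding c_def by (metis LeastI)
  have cb: "c G \<le> Max ((card \<circ> verts) ` A)" if "good G" for G
    using some[OF that] unfolding c_def by (meson Least_le order_trans)
  have "good G0" using G0 n by (simp add: good_def)
  then obtain G where G: "good G" "\<forall>G'. good G' \<longrightarrow> c G' \<le> c G"
    using bounded_nat_has_greatest[of good G0 c] cb by blast
  have gG: "connected_graph G" "r_graph (m + 2) G" "graph G" using G(1) by (auto simp: good_def r_graph_def)
  obtain G' :: "(nat, nat) multigraph" where G': "connected_graph G'" "r_graph (m + 2) G'" "isomorphic (inflate m G) G'"
    using nat_copy_r_graph[OF connected_inflate[OF m gG(1,3)] r_graph_inflate[OF m gG(1,2)]] by blast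
  have nG: "m = 1 \<longrightarrow> \<not> colors (fat_petersen m) G" using G(1) unfolding good_def by (elim conjE)
  have "\<not> colors (fat_petersen m) G'" if "m = 1"
  proof
    assume "colors (fat_petersen m) G'"
    then have "colors (fat_petersen m) (inflate m G)"
      by (rule colors_isomorphic[OF graph_inflate[OF gG(3)] G'(3)])
    then have "colors (fat_petersen m) G"
      using fat_petersen_colors_inflate[OF m gG(1,2)] by blast
    then show False using nG that by simp
  qed
  then have good': "good G'" unfolding good_def using G'(1,2) by (intro conjI impI)
  have "size G' (c G')" "c G' \<le> c G" using cs[OF good'] G(2) good' by simp_all
  then obtain K :: "(nat, nat) multigraph" where K: "connected_graph K" "r_graph (m + 2) K" "colors K G'" "card (verts K) \<le> c G"
    unfolding size_def by auto
  have "colors K (inflate m G)" by (rule colors_isomorphic[OF graph_inflate[OF gG(3)] G'(3) K(3)])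
  then obtain L :: "(nat, nat) multigraph" where "connected_graph L" "r_graph (m + 2) L" "colors L G" "card (verts L) < card (verts K)"
    using inflate_needs_more_vertices[OF m K(1,2) gG(1,2) _ nG] by blast
  then have "size G (card (verts L))" "card (verts L) < c G" using K(4) unfolding size_def by auto
  then show False unfolding c_def using not_less_Least by blast
qed

lemma finite_minimal_3_complete:
  assumes A: "minimal_r_complete 3 A" and f: "finite A"
  shows "\<exists>P. A = {P} \<and> isomorphic P petersen"
proof -
  have c: "r_complete 3 A" using A by (simp add: minimal_r_complete_def)
  have all: "colors (fat_petersen 1) G" if "connected_graph G" "r_graph 3 G" for G :: "(nat, nat) multigraph"
    using finite_complete_imp_colors[of 1 A G] c f that by (simp add: numeral_3_eq_3)
  have r1: "r_graph 3 (fat_petersen 1)" using r_graph_fat_petersen[of 1] by (simp add: numeral_3_eq_3)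
  obtain Q :: "(nat, nat) multigraph" where Q: "connected_graph Q" "r_graph 3 Q" "isomorphic (fat_petersen 1) Q"
    using nat_copy_r_graph[OF connected_fat_petersen r1] by auto
  obtain P where P: "P \<in> A" "colors P Q" using c Q by (auto simp: r_complete_def)
  have gP: "connected_graph P" "r_graph 3 P" "graph P" using c P(1) by (auto simp: r_complete_def r_graph_def)
  \<comment> \<open>Only the Petersen graph colours the Petersen graph, so it occurs in
    \<open>A\<close> up to isomorphism. As it colours everything, minimality leaves no other
    member.\<close>
  have "colors P (fat_petersen 1)" by (rule colors_isomorphic[OF graph_fat_petersen Q(3) P(2)])
  then have iso: "isomorphic (fat_petersen 1) P"
    using colors_fat_petersen[of 1 P] gP by (simp add: numeral_3_eq_3)
  have "r_complete 3 {P}"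
    unfolding r_complete_def using gP all isomorphic_colors[OF iso graph_fat_petersen] by blast
  then have "A = {P}" using A P(1) unfolding minimal_r_complete_def by blast
  moreover have "isomorphic P petersen"
    by (rule isomorphic_trans[OF gP(3) isomorphic_sym[OF graph_fat_petersen iso] fat_petersen_1])
  ultimately show ?thesis by blast
qed

theorem corollary3p12:
  "(\<forall>A. minimal_r_complete 3 A \<longrightarrow> (\<exists>P. A = {P} \<and> isomorphic P petersen) \<or> infinite A) \<and>
   (\<forall>r\<ge>4. \<forall>A. minimal_r_complete r A \<longrightarrow> infinite A)"
proof (intro conjI allI impI)
  fix A assume "minimal_r_complete 3 A"
  then show "(\<exists>P. A = {P} \<and> isomorphic P petersen) \<or> infinite A" using finite_minimal_3_complete by blast
next
  fix r :: nat and A assume r: "4 \<le> r" and A: "minimal_r_complete r A"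
  define m where "m = r - 2"
  have m: "m \<ge> 2" "r = m + 2" using r by (auto simp: m_def)
  \<comment> \<open>For \<open>r \<ge> 4\<close> any connected \<open>r\<close>-graph refutes
    finiteness; the fat Petersen graph shows that one exists.\<close>
  obtain G0 :: "(nat, nat) multigraph" where "connected_graph G0" "r_graph (m + 2) G0"
    using nat_copy_r_graph[OF connected_fat_petersen[of m] r_graph_fat_petersen[of m]] m(1) by auto
  moreover have "r_complete (m + 2) A" using A m(2) by (simp add: minimal_r_complete_def)
  ultimately show "infinite A" using finite_complete_imp_colors[of m A G0] m(1) by auto
qed

end
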